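(* Let $K$ be a field of algebraic numbers that is not big. If $K$ does not contain an imaginary quadratic field, or $K$ is a CM-field, then $R_K=\mathbb{Z}$, i.e. $$\{x\in\mathcal{O}_K : \forall \varepsilon\in\mathcal{O}_K^\times\ \exists\delta\in\mathcal{O}_K^\times \text{ such that } \delta-1\equiv(\varepsilon-1)x \pmod{(\varepsilon-1)^2\mathcal{O}_K}\}=\mathbb{Z}.$$
   Context: A field of algebraic numbers is an algebraic, possibly infinite, extension $K$ of $\mathbb{Q}$; $\mathcal{O}_K$ is its ring of algebraic integers and $\mathcal{O}_K^\times$ its unit group. $R_K$ denotes the set displayed on the left-hand side in the claim. $K$ is big if for every positive integer $n$ it contains a number field $F$ with $n\mid[F:\mathbb{Q}]$. $K$ is a CM-field if it is a totally imaginary quadratic extension of a totally real field (the case $[K:\mathbb{Q}]=\infty$ is included).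
   Formalization: In the CM-field alternative, K is additionally assumed not to be itself an imaginary quadratic field; for such K (e.g. Q(i), where 2i lies in R_K) the unit group is finite and the claim is false. *)

theory Defs
  imports "HOL-Algebra.Algebraic_Closure_Type"
begin

text \<open>
  Fields live inside an arbitrary ambient type of class \<open>field_char_0\<close>, viewed as a HOL-Algebra
  ring; its prime field is \<open>\<rat>\<close>.  Taking the type itself as the field covers abstract algebraic
  extensions of \<open>\<rat>\<close>.
\<close>

abbreviation ambient :: "'a::field_char_0 ring"
  where "ambient \<equiv> ring_of_type_algebra"

definition field_of_algebraic_numbers :: "'a::field_char_0 set \<Rightarrow> bool"
  where "field_of_algebraic_numbers K \<longleftrightarrow> subfield K ambient \<and> (\<forall>x\<in>K. algebraic x)"

text \<open>
  \<open>has_degree K L n\<close> is \<open>[K : L] = n\<close> and in particular says that the degree is finite.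
\<close>

definition has_degree :: "'a::field_char_0 set \<Rightarrow> 'a set \<Rightarrow> nat \<Rightarrow> bool"
  where "has_degree K L n \<longleftrightarrow>
    subfield L ambient \<and> subfield K ambient \<and> L \<subseteq> K \<and> ring.dimension ambient n L K"

definition big_field :: "'a::field_char_0 set \<Rightarrow> bool"
  where "big_field K \<longleftrightarrow>
    (\<forall>n::nat. n > 0 \<longrightarrow> (\<exists>F d. F \<subseteq> K \<and> has_degree F \<rat> d \<and> n dvd d))"

definition embeddings :: "'a::field_char_0 set \<Rightarrow> ('a \<Rightarrow> complex) set"
  where "embeddings K = ring_hom (ambient\<lparr>carrier := K\<rparr>) ambient"

definition totally_real :: "'a::field_char_0 set \<Rightarrow> bool"
  where "totally_real K \<longleftrightarrow> (\<forall>\<sigma>\<in>embeddings K. \<sigma> ` K \<subseteq> \<real>)"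

definition totally_imaginary :: "'a::field_char_0 set \<Rightarrow> bool"
  where "totally_imaginary K \<longleftrightarrow> (\<forall>\<sigma>\<in>embeddings K. \<not> \<sigma> ` K \<subseteq> \<real>)"

definition imaginary_quadratic_field :: "'a::field_char_0 set \<Rightarrow> bool"
  where "imaginary_quadratic_field F \<longleftrightarrow> has_degree F \<rat> 2 \<and> totally_imaginary F"

definition CM_field :: "'a::field_char_0 set \<Rightarrow> bool"
  where "CM_field K \<longleftrightarrow>
    field_of_algebraic_numbers K \<and> totally_imaginary K \<and>
    (\<exists>L. totally_real L \<and> has_degree K L 2)"

text \<open>
  An imaginary quadratic field \<open>K\<close> is itself a CM-field (with \<open>L = \<rat>\<close>) and is not big, but has
  only finitely many units, so that \<open>unit_set K\<close> below contains every multiple in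
  \<open>integers_of K\<close> of the product of the nonzero \<open>(\<epsilon> - 1)\<close> (take \<open>\<delta> = 1\<close>) and is not \<open>\<int>\<close>.
  A theorem saying that \<open>unit_set K = \<int>\<close> for CM-fields must therefore exclude such \<open>K\<close>.
\<close>

definition integers_of :: "'a::field_char_0 set \<Rightarrow> 'a set"
  where "integers_of K = {x\<in>K. algebraic_int x}"

definition integer_units :: "'a::field_char_0 set \<Rightarrow> 'a set"
  where "integer_units K = {u\<in>integers_of K. \<exists>v\<in>integers_of K. u * v = 1}"

definition unit_set :: "'a::field_char_0 set \<Rightarrow> 'a set"
  where "unit_set K = {x\<in>integers_of K. \<forall>\<epsilon>\<in>integer_units K. \<exists>\<delta>\<in>integer_units K.
    \<exists>y\<in>integers_of K. (\<delta> - 1) - (\<epsilon> - 1) * x = (\<epsilon> - 1)\<^sup>2 * y}"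

end

theory Submission
  imports Defs "Jordan_Normal_Form.Char_Poly" "HOL-Computational_Algebra.Fundamental_Theorem_Algebra"
    "HOL-Library.Countable_Set"
begin

text \<open>
  The set \<open>R = unit_set K\<close> is a subring of \<open>K\<close>.  Let \<open>x \<in> R\<close> have degree \<open>n > 1\<close> over \<open>\<rat>\<close> and suppose
  that \<open>\<int>[x]\<close> has units of infinite order.  Then it has a unit \<open>\<epsilon> = 1 + a \<beta> \<noteq> 1\<close> with \<open>\<beta>\<close> primitive
  and \<open>a\<close> a multiple of any prescribed integer.  As the trace form is nondegenerate, some \<open>z \<in> \<int>[x]\<close>
  makes \<open>t = Tr(\<beta> z)\<close> divide a constant \<open>D \<noteq> 0\<close> that depends only on \<open>x\<close>.  Since \<open>z \<in> R\<close>, there is a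
  unit \<open>\<delta> \<equiv> 1 + a \<beta> z\<close> modulo \<open>a\<^sup>2\<close>; with \<open>k = [\<rat>(x,\<delta>) : \<rat>(x)]\<close> its norm down to \<open>\<rat>\<close> is
  \<open>\<plusminus>1 \<equiv> 1 + a k t\<close> modulo \<open>a\<^sup>2\<close>, so \<open>a\<close> divides \<open>k t\<close>.  Taking \<open>a\<close> to be a multiple of \<open>N D\<close>
  shows that \<open>N\<close> divides \<open>k\<close>; as \<open>N\<close> is arbitrary, \<open>K\<close> is big.

  Units of infinite order come from the box principle, except when \<open>\<rat>(x)\<close> is imaginary quadratic.
  For a CM-field the latter case is excluded by comparing \<open>\<delta>\<close> with its complex conjugate for a totally
  real unit \<open>\<epsilon>\<close>, which shows that \<open>x\<close> is totally real.
\<close>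

section \<open>Integral elements\<close>

text \<open>As \<open>K\<close> may have infinite degree, it carries no norm or trace. All
  arithmetic happens in fields generated by one element, with sums and products over the complex
  roots of a minimal polynomial as trace and norm. Elements are therefore written as values of
  polynomials: the same polynomial is evaluated at an element of \<open>K\<close> and at its complex
  conjugates, and an identity at one of them holds at all. The constant \<open>D\<close> is the
  absolute value of the discriminant of \<open>\<int>[x]\<close>. It has to be known before the unit
  is chosen, because \<open>a\<close> must be a multiple of it; this is why the content of
  \<epsilon> - 1 is moved into \<open>a\<close> and only a primitive \<beta> is left to the trace
  form. The ring structure of \<open>R\<close> is essential because the trace of \<beta> itself may
  vanish, so a multiplier \<open>z\<close> is needed. The sign of the norm is settled by
  \<open>a \<ge> 3\<close>. The box principle fails for imaginary quadratic fields because a small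
  value at \<open>r\<close> is also small at \<open>cnj r\<close>, and no conjugate is left to
  compensate.\<close>

definition evq :: "rat poly \<Rightarrow> 'a::field_char_0 \<Rightarrow> 'a"
  where "evq p x = poly (map_poly of_rat p) x"

definition evz :: "int poly \<Rightarrow> 'a::field_char_0 \<Rightarrow> 'a"
  where "evz p x = poly (map_poly of_int p) x"

interpretation of_rat_poly_hom: map_poly_inj_idom_hom of_rat ..

lemma evq_simps [simp]:
  "evq 0 x = 0" "evq 1 x = 1" "evq (p + q) x = evq p x + evq q x" "evq (- p) x = - evq p x"
  "evq (p - q) x = evq p x - evq q x" "evq (p * q) x = evq p x * evq q x"
  "evq [:c:] x = of_rat c" "evq [:0, 1:] x = x" "evq (p ^ n) x = evq p x ^ n"
  "evq (smult c p) x = of_rat c * evq p x"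
  by (auto simp: evq_def hom_distribs)

lemma evq_sum [simp]: "evq (sum f A) x = (\<Sum>a\<in>A. evq (f a) x)"
  by (induction A rule: infinite_finite_induct) auto

lemma evz_simps [simp]:
  "evz 0 x = 0" "evz 1 x = 1" "evz (p + q) x = evz p x + evz q x" "evz (- p) x = - evz p x"
  "evz (p - q) x = evz p x - evz q x" "evz (p * q) x = evz p x * evz q x"
  "evz [:c:] x = of_int c" "evz [:0, 1:] x = x" "evz (p ^ n) x = evz p x ^ n"
  "evz (smult c p) x = of_int c * evz p x"
  by (auto simp: evz_def hom_distribs)

lemma evz_sum [simp]: "evz (sum f A) x = (\<Sum>a\<in>A. evz (f a) x)"
  by (induction A rule: infinite_finite_induct) auto

lemma evq_of_int_poly: "evq (map_poly of_int p) x = evz p x"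
  unfolding evq_def evz_def by (subst map_poly_map_poly) (auto simp: o_def)

lemma evq_pCons: "evq (pCons a p) x = of_rat a + x * evq p x"
  by (simp add: evq_def of_rat_hom.map_poly_pCons_hom)

lemma evz_pCons: "evz (pCons a p) x = of_int a + x * evz p x"
  by (simp add: evz_def of_int_hom.map_poly_pCons_hom)

lemma evq_pcompose: "evq (pcompose p q) x = evq p (evq q x)"
  by (induction p) (auto simp: evq_pCons pcompose_pCons)

lemma evz_pcompose: "evz (pcompose p q) x = evz p (evz q x)"
  by (induction p) (auto simp: evz_pCons pcompose_pCons)

lemma evz_altdef: "degree p < n \<Longrightarrow> evz p x = (\<Sum>i<n. of_int (coeff p i) * x ^ i)"
proof -
  assume "degree p < n"
  then have "(\<Sum>i<n. of_int (coeff p i) * x ^ i) = (\<Sum>i\<le>degree p. of_int (coeff p i) * x ^ i)"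
    by (intro sum.mono_neutral_right) (auto simp: coeff_eq_0)
  then show ?thesis by (simp add: evz_def poly_altdef)
qed

lemma evq_altdef: "degree p < n \<Longrightarrow> evq p x = (\<Sum>i<n. of_rat (coeff p i) * x ^ i)"
proof -
  assume "degree p < n"
  then have "(\<Sum>i<n. of_rat (coeff p i) * x ^ i) = (\<Sum>i\<le>degree p. of_rat (coeff p i) * x ^ i)"
    by (intro sum.mono_neutral_right) (auto simp: coeff_eq_0)
  then show ?thesis by (simp add: evq_def poly_altdef)
qed

section \<open>Subrings as sets, and division by monic polynomials\<close>

definition is_subring :: "'a::comm_ring_1 set \<Rightarrow> bool"
  where "is_subring S \<longleftrightarrow> 0 \<in> S \<and> 1 \<in> S \<and> (\<forall>a\<in>S. \<forall>b\<in>S. a + b \<in> S \<and> a * b \<in> S) \<and> (\<forall>a\<in>S. - a \<in> S)"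

definition polys_in :: "'a::comm_ring_1 set \<Rightarrow> 'a poly set"
  where "polys_in S = {p. \<forall>i. coeff p i \<in> S}"

lemma is_subringD:
  assumes "is_subring S"
  shows "0 \<in> S" "1 \<in> S" "a \<in> S \<Longrightarrow> b \<in> S \<Longrightarrow> a + b \<in> S" "a \<in> S \<Longrightarrow> b \<in> S \<Longrightarrow> a * b \<in> S"
    "a \<in> S \<Longrightarrow> - a \<in> S" "a \<in> S \<Longrightarrow> b \<in> S \<Longrightarrow> a - b \<in> S"
proof -
  show "a \<in> S \<Longrightarrow> b \<in> S \<Longrightarrow> a - b \<in> S"
    using assms unfolding is_subring_def by (metis add_uminus_conv_diff)
qed (use assms in \<open>auto simp: is_subring_def\<close>)

lemma is_subring_sum: "is_subring S \<Longrightarrow> (\<And>a. a \<in> A \<Longrightarrow> f a \<in> S) \<Longrightarrow> sum f A \<in> S"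
  by (induction A rule: infinite_finite_induct) (auto intro: is_subringD)

lemma is_subring_prod: "is_subring S \<Longrightarrow> (\<And>a. a \<in> A \<Longrightarrow> f a \<in> S) \<Longrightarrow> prod f A \<in> S"
  by (induction A rule: infinite_finite_induct) (auto intro: is_subringD)

lemma is_subring_power: "is_subring S \<Longrightarrow> a \<in> S \<Longrightarrow> a ^ n \<in> S"
  by (induction n) (auto intro: is_subringD)

lemma is_subring_Ints: "is_subring \<int>"
  by (auto simp: is_subring_def)

lemma is_subring_Rats: "is_subring (\<rat> :: 'a :: field_char_0 set)"
  by (auto simp: is_subring_def)

lemma is_subring_polys_in:
  assumes "is_subring S"
  shows "is_subring (polys_in S)"
  using assms unfolding is_subring_def polys_in_def
  by (auto simp: coeff_mult coeff_1 intro!: is_subring_sum[OF assms])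

lemma polys_in_const: "is_subring S \<Longrightarrow> a \<in> S \<Longrightarrow> [:a:] \<in> polys_in S"
  by (auto simp: polys_in_def coeff_pCons is_subringD split: nat.splits)

lemma polys_in_X: "is_subring S \<Longrightarrow> [:0, 1:] \<in> polys_in S"
  by (auto simp: polys_in_def coeff_pCons is_subringD split: nat.splits)

lemma polys_in_monom: "is_subring S \<Longrightarrow> a \<in> S \<Longrightarrow> monom a n \<in> polys_in S"
  by (auto simp: polys_in_def is_subringD)

lemma poly_polys_in: "is_subring S \<Longrightarrow> p \<in> polys_in S \<Longrightarrow> a \<in> S \<Longrightarrow> poly p a \<in> S"
  unfolding poly_altdef polys_in_def
  by (auto intro!: is_subring_sum is_subring_power is_subringD)

text \<open>The only coefficient that division would have to invert is the leading one of
  \<open>M\<close>, and it is 1; so quotient and remainder stay in \<open>S[X]\<close> for any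
  subring \<open>S\<close>.\<close>

lemma monic_division:
  fixes M f :: "'a::comm_ring_1 poly"
  assumes S: "is_subring S" and M: "M \<in> polys_in S" "lead_coeff M = 1" and f: "f \<in> polys_in S"
  shows "\<exists>q\<in>polys_in S. \<exists>r\<in>polys_in S. f = M * q + r \<and> (r = 0 \<or> degree r < degree M)"
  using f
proof (induction "degree f" arbitrary: f rule: less_induct)
  case less
  note PS = is_subring_polys_in[OF S]
  show ?case
  proof (cases "f = 0 \<or> degree f < degree M")
    case True
    then show ?thesis using less.prems is_subringD(1)[OF PS] by (intro bexI[of _ 0] bexI[of _ f]) auto
  next
    case False
    then have f0: "f \<noteq> 0" and d: "degree M \<le> degree f" by auto
    define t where "t = monom (lead_coeff f) (degree f - degree M)"
    have t: "t \<in> polys_in S"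
      unfolding t_def using less.prems by (intro polys_in_monom[OF S]) (auto simp: polys_in_def)
    define g where "g = f - M * t"
    have g: "g \<in> polys_in S"
      unfolding g_def using less.prems M(1) t by (intro is_subringD[OF PS])
    have dt: "degree (M * t) \<le> degree f"
      unfolding t_def using degree_mult_le[of M "monom (lead_coeff f) (degree f - degree M)"]
        degree_monom_le[of "lead_coeff f" "degree f - degree M"] d by linarith
    have ct: "coeff (M * t) (degree f) = lead_coeff f"
    proof -
      have "coeff (M * t) (degree f) = coeff (monom (lead_coeff f) (degree f - degree M) * M) ((degree f - degree M) + degree M)"
        using d by (simp add: t_def mult.commute)
      also have "\<dots> = lead_coeff f" using M(2) by (simp add: coeff_monom_mult)
      finally show ?thesis .
    qed
    show ?thesis
    proof (cases "g = 0")
      case True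
      then show ?thesis using t is_subringD(1)[OF PS] by (intro bexI[of _ t] bexI[of _ 0]) (auto simp: g_def)
    next
      case gn: False
      have "degree g \<le> degree f" unfolding g_def using dt by (simp add: degree_diff_le)
      moreover have "coeff g (degree f) = 0" unfolding g_def using ct by simp
      ultimately have "degree g < degree f" using gn
        by (metis leading_coeff_neq_0 le_neq_implies_less)
      from less.hyps[OF this g] obtain q r where qr: "q \<in> polys_in S" "r \<in> polys_in S"
        "g = M * q + r" "r = 0 \<or> degree r < degree M" by blast
      have "f = M * (q + t) + r" using qr(3) by (simp add: g_def algebra_simps)
      then show ?thesis using qr t is_subringD(3)[OF PS] by blast
    qed
  qed
qed

lemma monic_int_division:
  fixes M f :: "int poly"
  assumes "lead_coeff M = 1" "degree M > 0"
  shows "\<exists>q r. f = M * q + r \<and> degree r < degree M"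
proof -
  have "is_subring (UNIV :: int set)" by (auto simp: is_subring_def)
  from monic_division[OF this, of M f] assms show ?thesis by (force simp: polys_in_def)
qed

section \<open>Algebraic integers form a ring\<close>

lemma algebraic_int_iff_evz: "algebraic_int x \<longleftrightarrow> (\<exists>p. lead_coeff p = 1 \<and> evz p x = 0)"
  unfolding algebraic_int_altdef_ipoly evz_def by blast

text \<open>An eigenvalue of an integer matrix is a root of its characteristic polynomial, which is
  monic and integral. The index \<open>i0\<close> makes the eigenvector nonzero.\<close>

lemma algebraic_int_eigenvalue:
  fixes x :: "'a::field_char_0" and b :: "nat \<Rightarrow> 'a" and A :: "nat \<Rightarrow> nat \<Rightarrow> int"
  assumes "i0 < n" "b i0 \<noteq> 0" and eq: "\<And>i. i < n \<Longrightarrow> x * b i = (\<Sum>j<n. of_int (A i j) * b j)"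
  shows "algebraic_int x"
proof -
  define M where "M = mat n n (\<lambda>(i,j). A i j)"
  have M: "M \<in> carrier_mat n n" by (simp add: M_def)
  let ?M = "map_mat of_int M :: 'a mat"
  have "eigenvector ?M (vec n b) x"
    unfolding eigenvector_def using assms
    by (auto simp: M_def scalar_prod_def lessThan_atLeast0 intro!: eq_vecI dest!: arg_cong[of _ _ "\<lambda>v. vec_index v i0"])
  then have "eigenvalue ?M x" unfolding eigenvalue_def by blast
  then have "poly (char_poly ?M) x = 0" using eigenvalue_root_char_poly[of ?M n x] M by simp
  then have "evz (char_poly M) x = 0" unfolding evz_def of_int_hom.char_poly_hom[OF M] .
  then show ?thesis unfolding algebraic_int_iff_evz using degree_monic_char_poly[OF M] by auto
qed

definition int_span :: "'a::comm_ring_1 set \<Rightarrow> 'a set"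
  where "int_span B = {\<Sum>b\<in>B. of_int (c b) * b |c. True}"

lemma int_span_add: "u \<in> int_span B \<Longrightarrow> v \<in> int_span B \<Longrightarrow> u + v \<in> int_span B"
proof -
  assume "u \<in> int_span B" "v \<in> int_span B"
  then obtain c d where "u = (\<Sum>b\<in>B. of_int (c b) * b)" "v = (\<Sum>b\<in>B. of_int (d b) * b)"
    by (auto simp: int_span_def)
  then have "u + v = (\<Sum>b\<in>B. of_int (c b + d b) * b)"
    by (simp add: sum.distrib algebra_simps)
  then show ?thesis unfolding int_span_def by (auto intro: exI[of _ "\<lambda>b. c b + d b"])
qed

lemma int_span_mult: "u \<in> int_span B \<Longrightarrow> of_int k * u \<in> int_span B"
proof -
  assume "u \<in> int_span B"
  then obtain c where "u = (\<Sum>b\<in>B. of_int (c b) * b)" by (auto simp: int_span_def)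
  then have "of_int k * u = (\<Sum>b\<in>B. of_int (k * c b) * b)"
    by (simp add: sum_distrib_left algebra_simps)
  then show ?thesis unfolding int_span_def by (auto intro: exI[of _ "\<lambda>b. k * c b"])
qed

lemma int_span_0: "0 \<in> int_span B"
  unfolding int_span_def by (auto intro!: exI[of _ "\<lambda>_. 0"])

lemma int_span_sum: "(\<And>a. a \<in> A \<Longrightarrow> f a \<in> int_span B) \<Longrightarrow> sum f A \<in> int_span B"
  by (induction A rule: infinite_finite_induct) (auto intro: int_span_add int_span_0)

lemma int_span_base: "finite B \<Longrightarrow> b \<in> B \<Longrightarrow> b \<in> int_span B"
  unfolding int_span_def by (auto intro!: exI[of _ "\<lambda>x. if x = b then 1 else 0"] simp: if_distrib[of of_int] if_distrib[of "\<lambda>x. x * _"] cong: if_cong)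

lemma algebraic_int_span:
  fixes x :: "'a::field_char_0"
  assumes fin: "finite B" and b0: "b0 \<in> B" "b0 \<noteq> 0" and st: "\<And>b. b \<in> B \<Longrightarrow> x * b \<in> int_span B"
  shows "algebraic_int x"
proof -
  obtain f where f: "bij_betw f {..<card B} B"
    using ex_bij_betw_nat_finite[OF fin] by (auto simp: lessThan_atLeast0)
  have "\<forall>b\<in>B. \<exists>c. x * b = (\<Sum>a\<in>B. of_int (c a) * a)" using st unfolding int_span_def by blast
  then obtain c where c: "\<And>b. b \<in> B \<Longrightarrow> x * b = (\<Sum>a\<in>B. of_int (c b a) * a)" by metis
  obtain i0 where "i0 < card B" "f i0 = b0"
    using b0(1) bij_betw_imp_surj_on[OF f] by (metis imageE lessThan_iff)
  show ?thesis
  proof (rule algebraic_int_eigenvalue[of i0 "card B" f x "\<lambda>i j. c (f i) (f j)"])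
    fix i assume "i < card B"
    then have "f i \<in> B" using f by (auto simp: bij_betw_def)
    from c[OF this] show "x * f i = (\<Sum>j<card B. of_int (c (f i) (f j)) * f j)"
      by (simp add: sum.reindex_bij_betw[OF f, of "\<lambda>a. of_int (c (f i) a) * a"])
  qed (use \<open>i0 < card B\<close> \<open>f i0 = b0\<close> b0 in auto)
qed

lemma algebraic_int_power_reduce:
  fixes x :: "'a::field_char_0"
  assumes "lead_coeff p = 1" "evz p x = 0"
  shows "\<exists>c. x ^ k = (\<Sum>i<degree p. of_int (c i) * x ^ i)"
proof -
  have d: "degree p > 0"
  proof (rule ccontr)
    assume "\<not> degree p > 0"
    then have "p = 1" using assms(1) by (metis degree_0_id gr0I lead_coeff_1 degree_1 one_pCons)
    then show False using assms by simp
  qed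
  obtain q r where qr: "[:0,1:] ^ k = p * q + r" "degree r < degree p"
    using monic_int_division[OF assms(1) d] by blast
  have "x ^ k = evz ([:0,1:] ^ k) x" by (simp only: evz_simps)
  also have "\<dots> = evz r x" unfolding qr(1) using assms(2) by simp
  finally show ?thesis using evz_altdef[OF qr(2), of x] by auto
qed

text \<open>The additive group of \<open>\<int>[x, y]\<close> is spanned by the finitely many
  monomials below the degrees of the two monic equations, and it is stable under multiplication by
  \<open>x + y\<close> and by \<open>x * y\<close>.\<close>

lemma algebraic_int_add_mult:
  fixes x y :: "'a::field_char_0"
  assumes "algebraic_int x" "algebraic_int y"
  shows "algebraic_int (x + y)" "algebraic_int (x * y)"
proof -
  obtain p q where p: "lead_coeff p = 1" "evz p x = 0" and q: "lead_coeff q = 1" "evz q y = 0"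
    using assms unfolding algebraic_int_iff_evz by blast
  define B where "B = (\<lambda>(i,j). x ^ i * y ^ j) ` ({..<degree p} \<times> {..<degree q})"
  have fin: "finite B" by (simp add: B_def)
  have all: "x ^ k * y ^ l \<in> int_span B" for k l
  proof -
    obtain c where c: "x ^ k = (\<Sum>i<degree p. of_int (c i) * x ^ i)" using algebraic_int_power_reduce[OF p] by blast
    obtain d where d: "y ^ l = (\<Sum>i<degree q. of_int (d i) * y ^ i)" using algebraic_int_power_reduce[OF q] by blast
    have "x ^ k * y ^ l = (\<Sum>i<degree p. \<Sum>j<degree q. of_int (c i * d j) * (x ^ i * y ^ j))"
      unfolding c d sum_product by (simp add: algebra_simps)
    also have "\<dots> \<in> int_span B"
      by (intro int_span_sum int_span_mult int_span_base[OF fin]) (auto simp: B_def)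
    finally show ?thesis .
  qed
  have dp: "degree p > 0" "degree q > 0"
  proof -
    show "degree p > 0" by (rule ccontr) (use p in \<open>metis degree_0_id gr0I one_pCons evz_simps(2) one_neq_zero\<close>)
    show "degree q > 0" by (rule ccontr) (use q in \<open>metis degree_0_id gr0I one_pCons evz_simps(2) one_neq_zero\<close>)
  qed
  have one: "1 \<in> B" unfolding B_def using dp by (auto intro!: image_eqI[of _ _ "(0,0)"])
  have Bb: "\<exists>i j. b = x ^ i * y ^ j" if "b \<in> B" for b using that by (auto simp: B_def)
  show "algebraic_int (x + y)"
  proof (rule algebraic_int_span[OF fin one])
    fix b assume "b \<in> B"
    then obtain i j where b: "b = x ^ i * y ^ j" using Bb by blast
    have "(x + y) * b = x ^ Suc i * y ^ j + x ^ i * y ^ Suc j" by (simp add: b algebra_simps)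
    also have "\<dots> \<in> int_span B" by (intro int_span_add all)
    finally show "(x + y) * b \<in> int_span B" .
  qed simp
  show "algebraic_int (x * y)"
  proof (rule algebraic_int_span[OF fin one])
    fix b assume "b \<in> B"
    then obtain i j where b: "b = x ^ i * y ^ j" using Bb by blast
    have "(x * y) * b = x ^ Suc i * y ^ Suc j" by (simp add: b algebra_simps)
    also have "\<dots> \<in> int_span B" by (intro all)
    finally show "(x * y) * b \<in> int_span B" .
  qed simp
qed

lemma is_subring_algebraic_int: "is_subring {x :: 'a::field_char_0. algebraic_int x}"
  unfolding is_subring_def using algebraic_int_add_mult by auto

lemmas algebraic_int_ring = is_subringD[OF is_subring_algebraic_int, unfolded mem_Collect_eq]

lemma evz_algebraic_int: "algebraic_int x \<Longrightarrow> algebraic_int (evz p x)"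
  by (induction p) (auto simp: evz_pCons intro!: algebraic_int_ring(3,4))

section \<open>Minimal polynomials and their complex roots\<close>

text \<open>If \<open>M\<close> did not divide \<open>f\<close>, Bezout would give
  \<open>a * M + b * f = 1\<close>, and evaluation at \<open>x\<close> would yield
  \<open>0 = 1\<close>.\<close>

lemma irreducible_evq_iff:
  fixes M :: "rat poly" and x :: "'a::field_char_0"
  assumes "Factorial_Ring.irreducible M" "evq M x = 0"
  shows "evq f x = 0 \<longleftrightarrow> M dvd f"
proof
  assume f: "evq f x = 0"
  show "M dvd f"
  proof (rule ccontr)
    assume "\<not> M dvd f"
    then have "coprime M f"
      using assms(1) by (simp add: irreducible_imp_prime_elem_gcd prime_elem_imp_coprime)
    then obtain a b where "a * M + b * f = 1" 
      by (metis bezout_coefficients_fst_snd coprime_iff_gcd_eq_1)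
    from arg_cong[OF this, of "\<lambda>p. evq p x"] show False using f assms(2) by simp
  qed
qed (use assms in auto)

text \<open>A nonzero annihilating polynomial of least degree is irreducible: in a factorisation one
  factor annihilates \<open>x\<close>, so the other one is constant.\<close>

lemma exists_minpoly:
  assumes "algebraic (x :: 'a::field_char_0)"
  shows "\<exists>M::rat poly. lead_coeff M = 1 \<and> Factorial_Ring.irreducible M \<and> evq M x = 0"
proof -
  obtain p where "evz p x = 0" "p \<noteq> 0"
    using algebraicE'[OF assms] unfolding evz_def by metis
  then have "evq (map_poly of_int p) x = 0 \<and> map_poly of_int p \<noteq> (0 :: rat poly)"
    by (simp add: evq_of_int_poly)
  then obtain P :: "rat poly" where P: "evq P x = 0" "P \<noteq> 0"
    and min: "\<And>Q. evq Q x = 0 \<Longrightarrow> Q \<noteq> 0 \<Longrightarrow> degree P \<le> degree Q"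
    using ex_has_least_nat[of "\<lambda>Q. evq Q x = 0 \<and> Q \<noteq> 0" "map_poly of_int p :: rat poly" degree]
    by blast
  define M where "M = smult (inverse (lead_coeff P)) P"
  have M: "evq M x = 0" "M \<noteq> 0" "lead_coeff M = 1" "degree M = degree P"
    using P by (auto simp: M_def)
  have "Factorial_Ring.irreducible M"
  proof (rule irreducibleI)
    show "M \<noteq> 0" by fact
    show "\<not> M dvd 1"
    proof
      assume "M dvd 1"
      then obtain b where "1 = M * b" by (auto simp: dvd_def)
      from arg_cong[OF this, of "\<lambda>p. evq p x"] M(1) show False by simp
    qed
    fix a b assume ab: "M = a * b"
    have ab0: "a \<noteq> 0" "b \<noteq> 0" using ab M(2) by auto
    then have deg: "degree M = degree a + degree b" using ab by (simp add: degree_mult_eq)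
    have "evq a x = 0 \<or> evq b x = 0" using M(1) ab by auto
    then show "a dvd 1 \<or> b dvd 1"
    proof
      assume "evq a x = 0"
      from min[OF this ab0(1)] deg M(4) have "degree b = 0" by simp
      then show ?thesis using ab0 by (simp add: is_unit_iff_degree)
    next
      assume "evq b x = 0"
      from min[OF this ab0(2)] deg M(4) have "degree a = 0" by simp
      then show ?thesis using ab0 by (simp add: is_unit_iff_degree)
    qed
  qed
  then show ?thesis using M by blast
qed

lemma irreducible_degree_pos: "Factorial_Ring.irreducible (M :: rat poly) \<Longrightarrow> degree M > 0"
  by (metis gr0I irreducible_not_unit irreducible_def is_unit_iff_degree)

text \<open>These roots stand for the embeddings of \<open>\<rat>(x)\<close> when \<open>M\<close>
  is the minimal polynomial of \<open>x\<close>; sums and products over them are its trace and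
  norm.\<close>

definition croots :: "rat poly \<Rightarrow> complex set"
  where "croots M = {r. evq M r = 0}"

text \<open>Separability in characteristic 0: a root shared with \<open>pderiv M\<close> would make
  \<open>M\<close> divide a nonzero polynomial of smaller degree.\<close>

lemma croots_irreducible:
  assumes M: "Factorial_Ring.irreducible M" "lead_coeff M = 1"
  shows finite_croots: "finite (croots M)"
    and prod_croots: "map_poly of_rat M = (\<Prod>r\<in>croots M. [:- r, 1:])"
    and card_croots: "card (croots M) = degree M"
proof -
  let ?M = "map_poly of_rat M :: complex poly"
  have M0: "?M \<noteq> 0" using M(2) by auto
  have sq: "rsquarefree ?M"
    unfolding rsquarefree_roots
  proof (intro allI notI)
    fix r assume r: "poly ?M r = 0 \<and> poly (pderiv ?M) r = 0"
    then have "evq (pderiv M) r = 0" by (simp add: evq_def of_rat_hom.map_poly_pderiv)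
    then have "M dvd pderiv M" using irreducible_evq_iff[OF M(1), of r] r by (simp add: evq_def)
    moreover have "pderiv M \<noteq> 0" "degree (pderiv M) < degree M"
      using irreducible_degree_pos[OF M(1)] by (auto simp: pderiv_eq_0_iff degree_pderiv)
    ultimately show False using dvd_imp_degree_le by fastforce
  qed
  show fin: "finite (croots M)" unfolding croots_def evq_def using poly_roots_finite[OF M0] .
  have "?M = smult (lead_coeff ?M) (\<Prod>r | poly ?M r = 0. [:- r, 1:])"
    using complex_poly_decompose_rsquarefree[OF sq] by simp
  then show pr: "?M = (\<Prod>r\<in>croots M. [:- r, 1:])"
    using M(2) by (simp add: croots_def evq_def)
  have "degree ?M = (\<Sum>r\<in>croots M. degree [:- r, 1:])"
    unfolding pr by (rule degree_prod_eq_sum_degree) auto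
  then show "card (croots M) = degree M" by simp
qed

lemma croots_nonempty: "Factorial_Ring.irreducible M \<Longrightarrow> croots M \<noteq> {}"
proof -
  assume "Factorial_Ring.irreducible M"
  then have "\<not> constant (poly (map_poly of_rat M :: complex poly))"
    using irreducible_degree_pos[of M] by (simp add: constant_degree)
  then show ?thesis using fundamental_theorem_of_algebra by (auto simp: croots_def evq_def)
qed

section \<open>Characteristic polynomials over a subring\<close>

lemma vandermonde_det_nonzero:
  fixes \<theta> :: "nat \<Rightarrow> 'a::field"
  assumes inj: "inj_on \<theta> {..<n}"
  shows "det (mat n n (\<lambda>(i,k). \<theta> i ^ k)) \<noteq> 0"
proof
  let ?W = "mat n n (\<lambda>(i,k). \<theta> i ^ k)"
  assume "det ?W = 0"
  then obtain v where v: "v \<in> carrier_vec n" "v \<noteq> 0\<^sub>v n" "?W *\<^sub>v v = 0\<^sub>v n"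
    using det_0_iff_vec_prod_zero_field[of ?W n] by auto
  \<comment> \<open>A kernel vector, read as a list of coefficients, is a polynomial of degree below
    \<open>n\<close> that vanishes at \<open>n\<close> distinct points.\<close>
  define p where "p = (\<Sum>k<n. monom (v $ k) k)"
  have cp: "coeff p k = (if k < n then v $ k else 0)" for k
    by (simp add: p_def coeff_sum)
  have "poly p (\<theta> i) = 0" if "i < n" for i
  proof -
    have "(?W *\<^sub>v v) $ i = 0" using v(3) that by simp
    then show ?thesis using that v(1)
      by (simp add: p_def poly_sum poly_monom scalar_prod_def lessThan_atLeast0 mult.commute)
  qed
  then have sub: "\<theta> ` {..<n} \<subseteq> {x. poly p x = 0}" by auto
  have "p \<noteq> 0"
  proof
    assume "p = 0"
    then have "v $ k = 0" if "k < n" for k using cp[of k] that by simp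
    then show False using v by auto
  qed
  moreover from this have "degree p < n"
    using cp by (metis leading_coeff_neq_0)
  moreover have "n \<le> card {x. poly p x = 0}"
    using card_mono[OF _ sub] poly_roots_finite[OF \<open>p \<noteq> 0\<close>] card_image[OF inj] by simp
  ultimately show False using poly_roots_degree[of p] by simp
qed

lemma char_poly_polys_in:
  assumes S: "is_subring S" and A: "A \<in> carrier_mat n n" and ent: "\<And>i j. i < n \<Longrightarrow> j < n \<Longrightarrow> A $$ (i,j) \<in> S"
  shows "char_poly A \<in> polys_in S"
proof -
  note PS = is_subring_polys_in[OF S]
  have e: "char_poly_matrix A $$ (i,j) \<in> polys_in S" if "i < n" "j < n" for i j
  proof -
    have "char_poly_matrix A $$ (i,j) = (if i = j then [:- A $$ (i,j), 1:] else [:- A $$ (i,j):])"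
      using A that by (auto simp: char_poly_matrix_def)
    then show ?thesis
      using ent[OF that] by (auto simp: polys_in_def coeff_pCons is_subringD[OF S] split: nat.splits)
  qed
  have cA: "char_poly_matrix A \<in> carrier_mat n n" using A by simp
  show ?thesis
    unfolding char_poly_def det_def'[OF cA]
  proof (intro is_subring_sum[OF PS] is_subringD(4)[OF PS] is_subring_prod[OF PS])
    fix p show "signof p \<in> polys_in S"
      by (cases p rule: sign_cases) (auto intro: is_subringD[OF PS])
  qed (auto intro!: e simp: permutes_in_image)
qed

text \<open>
  With \<open>M = \<Prod>(X - r)\<close>, multiplication by \<open>g\<close> modulo \<open>M\<close> has a matrix over \<open>S\<close> in the basis of
  powers of \<open>X\<close>, and the Vandermonde matrix of the roots diagonalises it.
\<close>

lemma prod_poly_roots_polys_in: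
  fixes Rt :: "'a::field set"
  assumes S: "is_subring S" and fin: "finite Rt" and M: "(\<Prod>r\<in>Rt. [:- r, 1:]) \<in> polys_in S"
    and g: "g \<in> polys_in S"
  shows "(\<Prod>r\<in>Rt. [:- poly g r, 1:]) \<in> polys_in S"
proof (cases "Rt = {}")
  case True
  then show ?thesis using is_subringD(2)[OF is_subring_polys_in[OF S]] by simp
next
  case False
  define n where "n = card Rt"
  have n0: "n > 0" using False fin by (simp add: n_def card_gt_0_iff)
  let ?M = "\<Prod>r\<in>Rt. [:- r, 1:]"
  have degM: "degree ?M = n" unfolding n_def
    by (subst degree_prod_eq_sum_degree) auto
  have lcM: "lead_coeff ?M = 1" by (simp add: lead_coeff_prod)
  note PS = is_subring_polys_in[OF S]
  obtain \<theta> where \<theta>: "bij_betw \<theta> {..<n} Rt"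
    using ex_bij_betw_nat_finite[OF fin] by (auto simp: lessThan_atLeast0 n_def)
  have "\<forall>j. \<exists>q R. R \<in> polys_in S \<and> [:0,1:] ^ j * g = ?M * q + R \<and> degree R < n"
  proof
    fix j
    have "[:0,1:] ^ j * g \<in> polys_in S"
      by (intro is_subringD(4)[OF PS] is_subring_power[OF PS] polys_in_X[OF S] g)
    from monic_division[OF S M lcM this] degM n0
    show "\<exists>q R. R \<in> polys_in S \<and> [:0,1:] ^ j * g = ?M * q + R \<and> degree R < n" by fastforce
  qed
  then obtain q R where R: "\<And>j. R j \<in> polys_in S" "\<And>j. [:0,1:] ^ j * g = ?M * q j + R j" "\<And>j. degree (R j) < n"
    by metis
  have ev: "(\<Sum>k<n. coeff (R j) k * \<theta> i ^ k) = \<theta> i ^ j * poly g (\<theta> i)" if "i < n" for i j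
  proof -
    have "\<theta> i \<in> Rt" using \<theta> that by (auto simp: bij_betw_def)
    then have z: "poly ?M (\<theta> i) = 0" using fin by (auto simp: poly_prod)
    have "\<theta> i ^ j * poly g (\<theta> i) = poly ([:0,1:] ^ j * g) (\<theta> i)" by simp
    also have "\<dots> = poly (R j) (\<theta> i)" unfolding R(2) using z by simp
    also have "\<dots> = (\<Sum>k\<le>degree (R j). coeff (R j) k * \<theta> i ^ k)" by (simp add: poly_altdef)
    also have "\<dots> = (\<Sum>k<n. coeff (R j) k * \<theta> i ^ k)"
      using R(3)[of j] by (intro sum.mono_neutral_left) (auto simp: coeff_eq_0)
    finally show ?thesis by simp
  qed
  define A where "A = mat n n (\<lambda>(j,k). coeff (R j) k)"
  define V where "V = mat n n (\<lambda>(i,k). \<theta> i ^ k)"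
  define W where "W = transpose_mat V"
  define D where "D = mat n n (\<lambda>(i,j). if i = j then poly g (\<theta> i) else 0)"
  have carr: "A \<in> carrier_mat n n" "W \<in> carrier_mat n n" "D \<in> carrier_mat n n" "V \<in> carrier_mat n n"
    by (auto simp: A_def W_def D_def V_def)
  have AW: "A * W = W * D"
  proof (rule eq_matI)
    fix j i assume "j < dim_row (W * D)" "i < dim_col (W * D)"
    then have ji: "j < n" "i < n" using carr by auto
    have "(A * W) $$ (j,i) = (\<Sum>k<n. coeff (R j) k * \<theta> i ^ k)"
      using ji carr by (simp add: A_def W_def V_def scalar_prod_def lessThan_atLeast0)
    also have "\<dots> = \<theta> i ^ j * poly g (\<theta> i)" using ev ji by blast
    also have "\<dots> = (\<Sum>k<n. \<theta> k ^ j * (if k = i then poly g (\<theta> k) else 0))"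
      using ji by (simp add: if_distrib cong: if_cong)
    also have "\<dots> = (W * D) $$ (j,i)"
      using ji carr by (simp add: D_def W_def V_def scalar_prod_def lessThan_atLeast0)
    finally show "(A * W) $$ (j,i) = (W * D) $$ (j,i)" .
  qed (use carr in auto)
  have "det V \<noteq> 0" unfolding V_def using \<theta> by (intro vandermonde_det_nonzero) (auto simp: bij_betw_def)
  then have "det W \<noteq> 0" unfolding W_def using carr det_transpose by metis
  from det_non_zero_imp_unit[OF carr(2) this, where b = n] obtain W' where W': "W' \<in> carrier_mat n n" "W' * W = 1\<^sub>m n" "W * W' = 1\<^sub>m n"
    unfolding Units_def ring_mat_def by auto
  have "A = A * (W * W')" using carr W' by simp
  also have "\<dots> = W * D * W'" using carr W' AW by (metis assoc_mult_mat)
  finally have "similar_mat A D"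
    using similar_matI[of A D W W' n] carr W' by auto
  then have "char_poly A = char_poly D" by (rule char_poly_similar)
  also have "\<dots> = (\<Prod>a\<leftarrow>diag_mat D. [:- a, 1:])"
    by (rule char_poly_upper_triangular[OF carr(3)]) (auto simp: D_def)
  also have "diag_mat D = map (\<lambda>i. poly g (\<theta> i)) [0..<n]"
    by (auto simp: diag_mat_def D_def)
  also have "(\<Prod>a\<leftarrow>map (\<lambda>i. poly g (\<theta> i)) [0..<n]. [:- a, 1:]) = (\<Prod>i<n. [:- poly g (\<theta> i), 1:])"
    by (simp add: prod.distinct_set_conv_list[symmetric] lessThan_atLeast0 o_def)
  also have "\<dots> = (\<Prod>r\<in>Rt. [:- poly g r, 1:])"
    by (rule prod.reindex_bij_betw[OF \<theta>])
  finally show ?thesis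
    using char_poly_polys_in[OF S carr(1)] R(1) by (simp add: A_def polys_in_def)
qed

section \<open>Subfields of the ambient field\<close>

lemma ambient_sel [simp]:
  "carrier ambient = UNIV" "x \<otimes>\<^bsub>ambient\<^esub> y = x * y" "\<one>\<^bsub>ambient\<^esub> = 1" "\<zero>\<^bsub>ambient\<^esub> = 0"
  "x \<oplus>\<^bsub>ambient\<^esub> y = x + y"
  by (simp_all add: ring_of_type_algebra_def)

lemma ambient_a_inv [simp]: "\<ominus>\<^bsub>ambient\<^esub> x = - (x :: 'a::field_char_0)"
proof -
  interpret field "ambient :: 'a ring" by (rule field_from_type_algebra)
  show ?thesis by (rule minus_equality) auto
qed

lemma ambient_m_inv: "x \<noteq> 0 \<Longrightarrow> inv\<^bsub>ambient\<^esub> x = inverse (x :: 'a::field_char_0)"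
proof -
  interpret field "ambient :: 'a ring" by (rule field_from_type_algebra)
  assume "x \<noteq> 0"
  then show ?thesis by (intro comm_inv_char) auto
qed

text \<open>Translates the HOL-Algebra notion into plain closure properties once and for all.
  Quantifying over all of \<open>K\<close> is harmless since \<open>inverse 0 = 0\<close>.\<close>

lemma subfield_ambient_iff:
  "subfield K (ambient :: 'a::field_char_0 ring) \<longleftrightarrow> is_subring K \<and> (\<forall>a\<in>K. inverse a \<in> K)"
proof -
  interpret field "ambient :: 'a ring" by (rule field_from_type_algebra)
  show ?thesis
  proof (intro iffI conjI ballI)
    assume K: "subfield K ambient"
    have sr: "subring K ambient" using K by (metis subfieldE(1) subcring.axioms(1))
    show sub: "is_subring K" using subringE[OF sr] by (auto simp: is_subring_def)
    fix a assume a: "a \<in> K"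
    show "inverse a \<in> K"
    proof (cases "a = 0")
      case False
      then show ?thesis using subfield_m_inv(1)[OF K, of a] a by (simp add: ambient_m_inv)
    qed (use a in simp)
  next
    assume K: "is_subring K \<and> (\<forall>a\<in>K. inverse a \<in> K)"
    show "subfield K ambient"
    proof (rule subfieldI')
      show "subring K ambient" using K by (intro subringI) (auto simp: is_subring_def)
      show "inv\<^bsub>ambient\<^esub> k \<in> K" if "k \<in> K - {\<zero>\<^bsub>ambient\<^esub>}" for k
        using K that by (simp add: ambient_m_inv)
    qed
  qed
qed

lemma subfieldD:
  assumes "subfield K (ambient :: 'a::field_char_0 ring)"
  shows "is_subring K" "a \<in> K \<Longrightarrow> inverse a \<in> K" "a \<in> K \<Longrightarrow> b \<in> K \<Longrightarrow> a / b \<in> K"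
    "of_int k \<in> K" "of_rat q \<in> K"
proof -
  show sr: "is_subring K" and inv: "\<And>a. a \<in> K \<Longrightarrow> inverse a \<in> K"
    using assms unfolding subfield_ambient_iff by auto
  show div: "a \<in> K \<Longrightarrow> b \<in> K \<Longrightarrow> a / b \<in> K" for a b
    using is_subringD(4)[OF sr] inv by (simp add: divide_inverse)
  have n: "of_nat n \<in> K" for n by (induction n) (auto intro: is_subringD[OF sr])
  show i: "of_int k \<in> K" for k by (cases k) (auto intro!: is_subringD[OF sr] n simp del: of_nat_Suc)
  show "of_rat q \<in> K" by (cases q) (auto simp: of_rat_rat intro!: div i)
qed

lemma subfield_evq:
  assumes "subfield K (ambient :: 'a::field_char_0 ring)" "x \<in> K"
  shows "evq p x \<in> K"
  by (induction p) (auto simp: evq_pCons intro!: is_subringD[OF subfieldD(1)[OF assms(1)]] subfieldD(5)[OF assms(1)] assms)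

lemma subfield_evz:
  assumes "subfield K (ambient :: 'a::field_char_0 ring)" "x \<in> K"
  shows "evz p x \<in> K"
  unfolding evq_of_int_poly[symmetric] by (rule subfield_evq[OF assms])

lemma subfield_Rats: "subfield \<rat> (ambient :: 'a::field_char_0 ring)"
  by (auto simp: subfield_ambient_iff is_subring_Rats)

text \<open>Phrased by irreducibility instead of least degree, so that it passes at once to every
  other root, in whatever type that root lives.\<close>

definition is_minpoly :: "rat poly \<Rightarrow> 'a::field_char_0 \<Rightarrow> bool"
  where "is_minpoly M x \<longleftrightarrow> lead_coeff M = 1 \<and> Factorial_Ring.irreducible M \<and> evq M x = 0"

lemma is_minpolyD:
  assumes "is_minpoly M x"
  shows "lead_coeff M = 1" "Factorial_Ring.irreducible M" "evq M x = 0" "degree M > 0"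
    "finite (croots M)" "map_poly of_rat M = (\<Prod>r\<in>croots M. [:- r, 1:])" "card (croots M) = degree M"
    "croots M \<noteq> {}" "evq f x = 0 \<longleftrightarrow> M dvd f"
  using assms irreducible_degree_pos croots_irreducible croots_nonempty irreducible_evq_iff
  unfolding is_minpoly_def by blast+

lemma is_minpoly_croots: "is_minpoly M x \<Longrightarrow> r \<in> croots M \<Longrightarrow> is_minpoly M r"
  by (auto simp: is_minpoly_def croots_def)

text \<open>Both sides say that \<open>M\<close> divides \<open>f - g\<close>. This is the bridge by
  which identities pass between \<open>K\<close> and the complex numbers without a chosen
  embedding.\<close>

lemma evq_eq_iff:
  assumes "is_minpoly M x" "is_minpoly M y"
  shows "evq f x = evq g x \<longleftrightarrow> evq f y = evq g y"
  using is_minpolyD(9)[OF assms(1), of "f - g"] is_minpolyD(9)[OF assms(2), of "f - g"] by simp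

text \<open>An integral equation \<open>p\<close> of \<open>evq g x\<close> is the vanishing of
  \<open>pcompose p g\<close> at \<open>x\<close>, which passes to \<open>y\<close>.\<close>

lemma algebraic_int_evq_transfer:
  assumes "is_minpoly M x" "is_minpoly M y" "algebraic_int (evq g x)"
  shows "algebraic_int (evq g y)"
proof -
  obtain p where p: "lead_coeff p = 1" "evz p (evq g x) = 0" using assms(3) algebraic_int_iff_evz by blast
  then have "evq (pcompose (map_poly of_int p) g) x = evq 0 x"
    by (simp add: evq_pcompose evq_of_int_poly)
  then have "evq (pcompose (map_poly of_int p) g) y = evq 0 y"
    using evq_eq_iff[OF assms(1,2)] by blast
  then have "evz p (evq g y) = 0" by (simp add: evq_pcompose evq_of_int_poly)
  then show ?thesis using p(1) algebraic_int_iff_evz by blast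
qed

text \<open>The coefficients arise from the conjugates by ring operations, so they are algebraic
  integers; being rational, they are integers.\<close>

lemma is_minpoly_int:
  assumes M: "is_minpoly M x" and x: "algebraic_int x"
  shows "\<exists>Mz. M = map_poly of_int Mz \<and> lead_coeff Mz = 1 \<and> degree Mz = degree M"
proof -
  have r: "algebraic_int r" if "r \<in> croots M" for r
    using algebraic_int_evq_transfer[OF M is_minpoly_croots[OF M that], of "[:0,1:]"] x by simp
  have "(\<Prod>r\<in>croots M. [:- r, 1:]) \<in> polys_in {x. algebraic_int x}"
    by (intro is_subring_prod is_subring_polys_in is_subring_algebraic_int)
       (auto simp: polys_in_def coeff_pCons r split: nat.splits)
  then have c: "algebraic_int (of_rat (coeff M i) :: complex)" for i
    unfolding is_minpolyD(6)[OF M, symmetric] by (simp add: polys_in_def)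
  have "\<exists>k. coeff M i = of_int k" for i
  proof -
    obtain k where "(of_rat (coeff M i) :: complex) = of_int k"
      using rational_algebraic_int_is_int[OF c[of i]] Rats_of_rat by (auto elim: Ints_cases)
    then have "(of_rat (coeff M i) :: complex) = of_rat (of_int k)" by simp
    then show ?thesis unfolding of_rat_eq_iff by blast
  qed
  then have "\<forall>i. coeff M i = of_int \<lfloor>coeff M i\<rfloor>" by (metis floor_of_int)
  then have eq: "map_poly of_int (map_poly floor M) = M"
    by (intro poly_eqI) (auto simp: coeff_map_poly)
  have deg: "degree (map_poly floor M) = degree M"
    using arg_cong[OF eq, of degree] by simp
  have "(of_int (lead_coeff (map_poly floor M)) :: rat) = 1"
    using arg_cong[OF eq, of lead_coeff] is_minpolyD(1)[OF M] by simp
  then have "lead_coeff (map_poly floor M) = 1" by simp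
  then show ?thesis using eq deg by metis
qed

text \<open>The shift by \<open>pCons 0\<close> reads off the coefficient below the leading one
  without the expression \<open>card A - 1\<close>, so the empty set is no exception.\<close>

lemma coeff_prod_linear:
  assumes "finite A"
  shows "lead_coeff (\<Prod>a\<in>A. [:- f a, 1 :: 'a::idom:]) = 1" "degree (\<Prod>a\<in>A. [:- f a, 1 :: 'a::idom:]) = card A"
    "coeff (pCons 0 (\<Prod>a\<in>A. [:- f a, 1 :: 'a::idom:])) (card A) = - sum f A"
proof -
  show 1: "lead_coeff (\<Prod>a\<in>A. [:- f a, 1 :: 'a:]) = 1" for A by (simp add: lead_coeff_prod)
  show 2: "degree (\<Prod>a\<in>A. [:- f a, 1 :: 'a::idom:]) = card A" for A
    by (subst degree_prod_eq_sum_degree) auto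
  show "coeff (pCons 0 (\<Prod>a\<in>A. [:- f a, 1 :: 'a::idom:])) (card A) = - sum f A"
    using assms
  proof (induction A)
    case (insert a A)
    have "coeff (\<Prod>a\<in>A. [:- f a, 1 :: 'a:]) (card A) = 1" using 1[of A] 2[of A] by simp
    then show ?case using insert by simp
  qed simp
qed

text \<open>Trace and norm of \<open>evq g x\<close> are, up to sign, coefficients of the
  characteristic polynomial of multiplication by it, which is rational by
  \<open>prod_poly_roots_polys_in\<close>.\<close>

lemma is_minpoly_sum_prod_rat:
  assumes M: "is_minpoly M x"
  shows "(\<Sum>r\<in>croots M. evq g r) \<in> \<rat>" "(\<Prod>r\<in>croots M. evq g r) \<in> \<rat>"
    "(\<Prod>r\<in>croots M. [:- evq g r, 1:]) \<in> polys_in \<rat>"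
proof -
  note fin = is_minpolyD(5)[OF M]
  have ch: "(\<Prod>r\<in>croots M. [:- evq g r, 1:]) \<in> polys_in \<rat>" for g
    unfolding evq_def
    by (intro prod_poly_roots_polys_in[OF is_subring_Rats fin])
       (auto simp: is_minpolyD(6)[OF M, symmetric] polys_in_def)
  show "(\<Prod>r\<in>croots M. [:- evq g r, 1:]) \<in> polys_in \<rat>" by (rule ch)
  have "- (\<Sum>r\<in>croots M. evq g r) \<in> \<rat>"
    unfolding coeff_prod_linear(3)[OF fin, symmetric] using ch[of g]
    by (auto simp: coeff_pCons polys_in_def split: nat.splits)
  then show "(\<Sum>r\<in>croots M. evq g r) \<in> \<rat>" by (simp add: Rats_minus_iff)
  have "poly (\<Prod>r\<in>croots M. [:- evq (- g) r, 1:]) 0 \<in> \<rat>"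
    by (rule poly_polys_in[OF is_subring_Rats ch Rats_0])
  then show "(\<Prod>r\<in>croots M. evq g r) \<in> \<rat>" by (simp add: poly_prod)
qed

lemma sum_prod_in_Ints:
  assumes M: "is_minpoly M x" and g: "\<And>r. r \<in> croots M \<Longrightarrow> algebraic_int (evq g r)"
  shows "(\<Sum>r\<in>croots M. evq g r) \<in> \<int>" "(\<Prod>r\<in>croots M. evq g r) \<in> \<int>"
    using g is_minpoly_sum_prod_rat[OF M, of g]
    by (auto intro!: rational_algebraic_int_is_int is_subring_sum[OF is_subring_algebraic_int, unfolded mem_Collect_eq]
      is_subring_prod[OF is_subring_algebraic_int, unfolded mem_Collect_eq])

section \<open>Conjugates over a subfield\<close>

lemma order_prod_linear:
  assumes "finite A"
  shows "order a (\<Prod>b\<in>A. [:- f b, 1 :: 'a::field:]) = card {b\<in>A. f b = a}"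
  using assms
proof (induction A)
  case (insert b A)
  have "{c\<in>insert b A. f c = a} = (if f b = a then insert b {c\<in>A. f c = a} else {c\<in>A. f c = a})" by auto
  moreover have "order a [:- f b, 1:] = (if f b = a then 1 else 0)"
    using order_power_n_n[of a 1] by (auto intro: order_0I)
  moreover have "order a (\<Prod>c\<in>insert b A. [:- f c, 1:]) = order a [:- f b, 1:] + order a (\<Prod>c\<in>A. [:- f c, 1:])"
    using insert.hyps by (subst prod.insert) (auto simp: order_mult simp del: mult_pCons_left)
  ultimately show ?case using insert by (simp del: mult_pCons_left)
qed simp

text \<open>A nonconstant \<open>Q\<close> has a complex root; it is a root of the irreducible
  \<open>m\<close> too, so \<open>m\<close> divides \<open>Q\<close>. Splitting off one factor
  \<open>m\<close> at a time ends with 1.\<close>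

lemma roots_subset_imp_power:
  assumes m: "is_minpoly m x" and Q: "lead_coeff Q = 1" "\<And>r::complex. evq Q r = 0 \<Longrightarrow> evq m r = 0"
  shows "\<exists>k. Q = m ^ k"
  using Q
proof (induction "degree Q" arbitrary: Q rule: less_induct)
  case less
  show ?case
  proof (cases "degree Q = 0")
    case True
    then have "Q = m ^ 0" using less.prems(1) by (metis degree_0_id one_pCons power_0)
    then show ?thesis by blast
  next
    case False
    then have "\<not> constant (poly (map_poly of_rat Q :: complex poly))" by (simp add: constant_degree)
    then obtain r :: complex where r: "evq Q r = 0"
      using fundamental_theorem_of_algebra by (auto simp: evq_def)
    then have "r \<in> croots m" using less.prems(2) by (simp add: croots_def)
    then have "m dvd Q" using is_minpolyD(9)[OF is_minpoly_croots[OF m]] r by blast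
    then obtain Q' where Q': "Q = m * Q'" by (auto simp: dvd_def)
    have lc: "lead_coeff Q' = 1" using less.prems(1) is_minpolyD(1)[OF m] by (simp add: Q' lead_coeff_mult)
    have "Q' \<noteq> 0" "m \<noteq> 0" using lc is_minpolyD(1)[OF m] by auto
    then have "degree Q' < degree Q" using is_minpolyD(4)[OF m] by (simp add: Q' degree_mult_eq)
    from less.hyps[OF this lc] less.prems(2) obtain k where "Q' = m ^ k" by (auto simp: Q')
    then have "Q = m ^ Suc k" by (simp add: Q')
    then show ?thesis by blast
  qed
qed

text \<open>The polynomial whose roots are the \<open>evq g \<rho>\<close>, with multiplicity, is
  rational and has no roots outside those of \<open>m\<close>, so it is \<open>m ^ k\<close>; as
  \<open>m\<close> has simple roots, each of them is hit exactly \<open>k\<close> times. Here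
  \<open>k\<close> is the degree of \<open>\<rat>(\<theta>)\<close> over
  \<open>\<rat>(evq g \<theta>)\<close>, obtained without relative extensions. Positivity of
  \<open>k\<close> says that conjugates can be lifted.\<close>

lemma croots_fibres:
  assumes M: "is_minpoly M (\<theta> :: 'a::field_char_0)" and m: "is_minpoly m (evq g \<theta>)"
  shows "\<exists>k>0. degree M = k * degree m \<and> (\<forall>\<rho>\<in>croots M. evq g \<rho> \<in> croots m) \<and>
    (\<forall>r\<in>croots m. card {\<rho>\<in>croots M. evq g \<rho> = r} = k)"
proof -
  note finM = is_minpolyD(5)[OF M] and finm = is_minpolyD(5)[OF m]
  have im: "evq g \<rho> \<in> croots m" if "\<rho> \<in> croots M" for \<rho>
  proof -
    have "evq (pcompose m g) \<theta> = evq 0 \<theta>" using is_minpolyD(3)[OF m] by (simp add: evq_pcompose)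
    then have "evq (pcompose m g) \<rho> = evq 0 \<rho>"
      using evq_eq_iff[OF M is_minpoly_croots[OF M that]] by blast
    then show ?thesis by (simp add: evq_pcompose croots_def)
  qed
  let ?\<chi> = "\<Prod>\<rho>\<in>croots M. [:- evq g \<rho>, 1:]"
  have "\<forall>i. \<exists>q. coeff ?\<chi> i = of_rat q"
    using is_minpoly_sum_prod_rat(3)[OF M, of g] by (auto simp: polys_in_def elim: Rats_cases)
  then obtain q where q: "\<And>i. coeff ?\<chi> i = of_rat (q i)" by metis
  define Q where "Q = Abs_poly q"
  have "q i = 0" if "i > degree ?\<chi>" for i
    using q[of i] coeff_eq_0[OF that] by simp
  then have cQ: "coeff Q = q" unfolding Q_def
    by (intro Abs_poly_inverse) (auto simp: MOST_nat)
  then have Q: "map_poly of_rat Q = ?\<chi>" by (intro poly_eqI) (simp add: q)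
  have lcQ: "lead_coeff Q = 1"
    using coeff_prod_linear(1)[OF finM, of "evq g"] unfolding Q[symmetric] by simp
  have "evq m r = 0" if "evq Q r = 0" for r :: complex
    using that im finM by (auto simp: evq_def[of Q] Q poly_prod croots_def)
  from roots_subset_imp_power[OF m lcQ this] obtain k where k: "Q = m ^ k" by blast
  have "degree Q = card (croots M)" using coeff_prod_linear(2)[OF finM, of "evq g"] unfolding Q[symmetric] by simp
  then have deg: "degree M = k * degree m"
    unfolding is_minpolyD(7)[OF M] k using is_minpolyD(1)[OF m] by (subst (asm) degree_power_eq) (auto simp: mult.commute)
  have k0: "k > 0" using deg is_minpolyD(4)[OF M] by (cases k) auto
  have "card {\<rho>\<in>croots M. evq g \<rho> = r} = k" if r: "r \<in> croots m" for r
  proof -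
    have "card {\<rho>\<in>croots M. evq g \<rho> = r} = order r ?\<chi>" by (simp add: order_prod_linear[OF finM])
    also have "?\<chi> = (\<Prod>s\<in>croots m. [:- s, 1:]) ^ k"
      unfolding Q[symmetric] k by (simp add: hom_distribs is_minpolyD(6)[OF m])
    \<comment> \<open>Indexing the factors of the power by pairs brings it into the form counted by
      \<open>order_prod_linear\<close>.\<close>
    also have "\<dots> = (\<Prod>p\<in>croots m \<times> {..<k}. [:- fst p, 1:])"
      by (simp add: prod.cartesian_product' prod_power_distrib flip: prod.cartesian_product)
    also have "order r \<dots> = card {p\<in>croots m \<times> {..<k}. fst p = r}"
      using finm by (simp add: order_prod_linear)
    also have "{p\<in>croots m \<times> {..<k}. fst p = r} = {r} \<times> {..<k}" using r by auto
    finally show ?thesis by (simp add: card_cartesian_product)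
  qed
  then show ?thesis using deg im k0 by blast
qed

lemma sum_croots_fibres:
  fixes F :: "complex \<Rightarrow> complex"
  assumes M: "is_minpoly M (\<theta> :: 'a::field_char_0)" and m: "is_minpoly m (evq g \<theta>)"
  shows "(\<Sum>\<rho>\<in>croots M. F (evq g \<rho>)) = of_nat (degree M div degree m) * (\<Sum>r\<in>croots m. F r)"
proof -
  obtain k where k: "degree M = k * degree m" "\<forall>\<rho>\<in>croots M. evq g \<rho> \<in> croots m"
    "\<forall>r\<in>croots m. card {\<rho>\<in>croots M. evq g \<rho> = r} = k" using croots_fibres[OF M m] by blast
  have "(\<Sum>\<rho>\<in>croots M. F (evq g \<rho>)) = (\<Sum>r\<in>croots m. \<Sum>\<rho>\<in>{\<rho>\<in>croots M. evq g \<rho> = r}. F (evq g \<rho>))"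
    using k(2) by (intro sum.group[symmetric] is_minpolyD(5)[OF M] is_minpolyD(5)[OF m]) auto
  also have "\<dots> = (\<Sum>r\<in>croots m. of_nat k * F r)" using k(3) by (intro sum.cong) auto
  finally show ?thesis using k(1) is_minpolyD(4)[OF m] by (simp add: sum_distrib_left)
qed

text \<open>Expansion to second order in \<open>a\<close>: it turns a norm into a trace modulo the
  square of \<open>a\<close>.\<close>

lemma prod_one_plus:
  assumes "finite A" "\<And>i. i \<in> A \<Longrightarrow> algebraic_int (u i :: 'a::field_char_0)"
  shows "\<exists>Z. algebraic_int Z \<and> (\<Prod>i\<in>A. 1 + of_int a * u i) = 1 + of_int a * sum u A + of_int a ^ 2 * Z"
  using assms
proof (induction A)
  case empty
  then show ?case by (intro exI[of _ 0]) simp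
next
  case (insert i A)
  then obtain Z where Z: "algebraic_int Z" "(\<Prod>i\<in>A. 1 + of_int a * u i) = 1 + of_int a * sum u A + of_int a ^ 2 * Z"
    by auto
  have s: "algebraic_int (sum u A)" using insert.prems
    by (intro is_subring_sum[OF is_subring_algebraic_int, unfolded mem_Collect_eq]) auto
  show ?case
    using insert.hyps insert.prems
    by (intro exI[of _ "Z + u i * sum u A + of_int a * u i * Z"])
       (auto simp: Z(2) algebra_simps power2_eq_square intro!: algebraic_int_ring Z(1) s)
qed

section \<open>Units from the box principle\<close>

lemma evz_eq_iff:
  assumes "is_minpoly M x" "is_minpoly M y"
  shows "evz f x = evz g x \<longleftrightarrow> evz f y = evz g y"
  unfolding evq_of_int_poly[symmetric] by (rule evq_eq_iff[OF assms])

lemma evz_nonzero: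
  assumes M: "is_minpoly M x" and f: "f \<noteq> 0" "degree f < degree M"
  shows "evz f x \<noteq> 0"
proof
  assume "evz f x = 0"
  then have "M dvd map_poly of_int f" using is_minpolyD(9)[OF M, of "map_poly of_int f"] by (simp add: evq_of_int_poly)
  then show False using f dvd_imp_degree_le[of M "map_poly of_int f"] by simp
qed

lemma norm_evz_le:
  fixes s :: complex
  assumes "degree f < n" "\<And>i. \<bar>coeff f i\<bar> \<le> H" "\<And>i. i < n \<Longrightarrow> norm s ^ i \<le> C"
  shows "norm (evz f s) \<le> real n * C * real_of_int H"
proof -
  have "norm (evz f s) \<le> (\<Sum>i<n. norm (of_int (coeff f i) * s ^ i))"
    unfolding evz_altdef[OF assms(1)] by (rule norm_sum)
  also have "\<dots> \<le> (\<Sum>i<n. real_of_int H * C)"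
  proof (rule sum_mono)
    fix i assume "i \<in> {..<n}"
    then show "norm (of_int (coeff f i) * s ^ i) \<le> real_of_int H * C"
      using assms(2)[of i] assms(3)[of i]
      by (auto simp: norm_mult norm_power simp flip: of_int_abs intro!: mult_mono)
  qed
  finally show ?thesis by (simp add: algebra_simps)
qed

text \<open>\<open>E\<close> is meant to be \<open>r\<close> with its complex conjugate, the
  \<open>e\<close> conjugates that become small together. There are \<open>(h^e + 1)^n\<close>
  polynomials with coefficients in \<open>{0..h^e}\<close> but only \<open>h^(n e)\<close> cells for
  their values at \<open>r\<close>. A difference of two in one cell is of order
  \<open>h^(e - n)\<close> on \<open>E\<close> and \<open>h^e\<close> elsewhere, and the exponents
  cancel in the product over \<open>R\<close>: \<open>e (e - n) + (n - e) e = 0\<close>.\<close>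

lemma small_value_box:
  fixes R E :: "complex set"
  assumes R: "finite R" "E \<subseteq> R" "r \<in> E" and e: "card E = e" "e < card R" "e = 1 \<and> r \<in> \<real> \<or> e = 2"
    and E: "\<And>s f. s \<in> E \<Longrightarrow> norm (evz f s) = norm (evz f r)"
  shows "\<exists>K>0. \<forall>h::nat>0. \<exists>f. f \<noteq> 0 \<and> degree f < card R \<and> norm (evz f r) \<le> K / real h \<and>
    norm (\<Prod>s\<in>R. evz f s) \<le> K ^ card R"
proof -
  define n where "n = card R"
  define C where "C = Max (insert 1 ((\<lambda>(s,i). norm s ^ i) ` (R \<times> {..<n})))"
  have C: "norm s ^ i \<le> C" if "s \<in> R" "i < n" for s i
    unfolding C_def using R(1) that by (intro Max_ge) (auto intro!: image_eqI[of _ _ "(s,i)"])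
  have C1: "C \<ge> 1" unfolding C_def using R(1) by (intro Max_ge) auto
  \<comment> \<open>The 6 comes from real and imaginary part, each of which contributes at most
    \<open>3 * B / h ^ n\<close> at \<open>r\<close>.\<close>
  define K where "K = 6 * real n * C"
  have n0: "n > 0" "n \<ge> 1" using e(2) by (auto simp: n_def)
  have nC: "real n * C \<ge> 1" using mult_mono[of 1 "real n" 1 C] C1 n0 by simp
  have K0: "K > 0" using nC by (simp add: K_def mult.assoc)
  have rR: "r \<in> R" using R by auto
  have "\<exists>f. f \<noteq> 0 \<and> degree f < n \<and> norm (evz f r) \<le> K / real h \<and> norm (\<Prod>s\<in>R. evz f s) \<le> K ^ n"
    if h: "h > 0" for h :: nat
  proof -
    define H where "H = int h ^ e"
    have H1: "H \<ge> 1" using h by (simp add: H_def)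
    define B where "B = real n * C * real_of_int H"
    have B1: "B \<ge> 1" using mult_mono[of 1 "real n * C" 1 "real_of_int H"] nC H1 by (simp add: B_def)
    \<comment> \<open>The interval from \<open>- B\<close> to \<open>B\<close> is cut into
      \<open>h ^ n\<close> cells; dividing by \<open>2 * B + 1\<close> instead of
      \<open>2 * B\<close> keeps the endpoint \<open>B\<close> in range.\<close>
    define cell where "cell y = \<lfloor>(y + B) * real h ^ n / (2 * B + 1)\<rfloor>" for y
    have cell_range: "cell y \<in> {0..<int h ^ n}" if "\<bar>y\<bar> \<le> B" for y
    proof -
      have "(y + B) / (2 * B + 1) < 1" using that B1 by (simp add: divide_simps)
      then have "(y + B) / (2 * B + 1) * real h ^ n < 1 * real h ^ n"
        using h by (intro mult_strict_right_mono) auto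
      then have "(y + B) * real h ^ n / (2 * B + 1) < of_int (int h ^ n)" by (simp add: field_simps)
      moreover have "0 \<le> (y + B) * real h ^ n / (2 * B + 1)" using that B1 by simp
      ultimately show ?thesis unfolding cell_def by (simp add: floor_less_iff)
    qed
    have cell_eq: "\<bar>y - z\<bar> \<le> (2 * B + 1) / real h ^ n" if "cell y = cell z" for y z
    proof -
      have "\<bar>(y + B) * real h ^ n / (2 * B + 1) - (z + B) * real h ^ n / (2 * B + 1)\<bar> < 1"
        using that unfolding cell_def by linarith
      also have "(y + B) * real h ^ n / (2 * B + 1) - (z + B) * real h ^ n / (2 * B + 1) = (y - z) * (real h ^ n / (2 * B + 1))"
        by (simp add: diff_divide_distrib[symmetric] algebra_simps)
      finally have "\<bar>y - z\<bar> * (real h ^ n / (2 * B + 1)) < 1" using B1 by (simp add: abs_mult)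
      then show ?thesis using h B1 by (simp add: field_simps)
    qed
    define P where "P = {f :: int poly. degree f < n \<and> (\<forall>i. coeff f i \<in> {0..H})}"
    define L where "L = {xs. set xs \<subseteq> {0..H} \<and> length xs = n}"
    have cardL: "card L = nat (H + 1) ^ n" unfolding L_def by (subst card_lists_length_eq) auto
    have finL: "finite L" unfolding L_def by (rule finite_lists_length_eq) auto
    have cPoly: "coeff (Poly xs) i = (if i < n then xs ! i else 0)" if "xs \<in> L" for xs i
      using that by (auto simp: L_def nth_default_def)
    have PL: "Poly xs \<in> P" if "xs \<in> L" for xs
    proof -
      have "coeff (Poly xs) i \<in> {0..H}" for i
        using cPoly[OF that, of i] that H1 by (auto simp: L_def subset_iff)
      moreover have "degree (Poly xs) < n"
        using cPoly[OF that] n0 by (metis leading_coeff_neq_0 degree_0)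
      ultimately show ?thesis by (simp add: P_def)
    qed
    have bnd: "norm (evz f s) \<le> B" if "f \<in> P" "s \<in> R" for f s
      unfolding B_def using that C by (intro norm_evz_le) (auto simp: P_def abs_le_iff) 
    define cells where "cells f = (cell (Re (evz f r)), cell (Im (evz f r)))" for f
    \<comment> \<open>If \<open>e = 1\<close>, then \<open>r\<close> is real and the imaginary part
      needs only the cell of 0; so the count is \<open>(h ^ n) ^ e\<close> in both cases.\<close>
    define T where "T = (if e = 1 then {0..<int h ^ n} \<times> {cell 0} else {0..<int h ^ n} \<times> {0..<int h ^ n})"
    have finT: "finite T" by (simp add: T_def)
    have cardT: "card T = (h ^ n) ^ e" using e(3)
      by (auto simp: T_def card_cartesian_product nat_power_eq power2_eq_square)
    have real_ev: "Im (evz f r) = 0" if "e = 1" for f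
    proof -
      have "r \<in> \<real>" using that e(3) by auto
      then have "evz f r \<in> \<real>" unfolding evz_def by (induction f) (auto simp: of_int_hom.map_poly_pCons_hom)
      then show ?thesis by (simp add: complex_is_Real_iff)
    qed
    have "(\<lambda>xs. cells (Poly xs)) ` L \<subseteq> T"
    proof (rule image_subsetI)
      fix xs assume "xs \<in> L"
      then have b: "norm (evz (Poly xs) r) \<le> B" using bnd[OF PL rR] by blast
      then have "\<bar>Re (evz (Poly xs) r)\<bar> \<le> B" "\<bar>Im (evz (Poly xs) r)\<bar> \<le> B"
        using abs_Re_le_cmod abs_Im_le_cmod order_trans by blast+
      then show "cells (Poly xs) \<in> T"
        using cell_range real_ev[of "Poly xs"] by (simp add: cells_def T_def)
    qed
    then have "card ((\<lambda>xs. cells (Poly xs)) ` L) \<le> card T"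
      by (rule card_mono[OF finT])
    also have "card T < card L"
    proof -
      have "card T = (h ^ e) ^ n" unfolding cardT by (simp add: power_mult[symmetric] mult.commute)
      also have "\<dots> < (h ^ e + 1) ^ n" using n0 by (intro power_strict_mono) auto
      also have "\<dots> = card L" unfolding cardL H_def by (simp add: nat_add_distrib nat_power_eq)
      finally show ?thesis .
    qed
    finally have "\<not> inj_on (\<lambda>xs. cells (Poly xs)) L" by (rule pigeonhole)
    then obtain xs ys where xy: "xs \<in> L" "ys \<in> L" "xs \<noteq> ys" "cells (Poly xs) = cells (Poly ys)"
      unfolding inj_on_def by blast
    define f where "f = Poly xs - Poly ys"
    have cf: "coeff f i = coeff (Poly xs) i - coeff (Poly ys) i" for i by (simp add: f_def)
    have "f \<noteq> 0"
    proof
      assume "f = 0"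
      then have "xs ! i = ys ! i" if "i < n" for i
        using cf[of i] cPoly[OF xy(1), of i] cPoly[OF xy(2), of i] that by simp
      then show False using xy(1-3) by (auto simp: L_def intro: nth_equalityI)
    qed
    moreover have df: "degree f < n"
      using PL[OF xy(1)] PL[OF xy(2)] unfolding f_def P_def by (auto intro: degree_diff_less)
    moreover have B3: "2 * B + 1 \<le> 3 * B" using B1 by simp
    have fr: "norm (evz f r) \<le> K * (real h ^ e / real h ^ n)"
    proof -
      have "norm (evz f r) \<le> \<bar>Re (evz f r)\<bar> + \<bar>Im (evz f r)\<bar>" by (rule cmod_le)
      also have "\<dots> \<le> (2 * B + 1) / real h ^ n + (2 * B + 1) / real h ^ n"
        using xy(4) unfolding f_def cells_def by (intro add_mono) (auto intro: cell_eq)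
      also have "\<dots> \<le> 3 * B / real h ^ n + 3 * B / real h ^ n"
        using B3 h by (intro add_mono divide_right_mono) auto
      also have "\<dots> = K * (real h ^ e / real h ^ n)" by (simp add: K_def B_def H_def)
      finally show ?thesis .
    qed
    have fs: "norm (evz f s) \<le> K * real h ^ e" if "s \<in> R" for s
    proof -
      have "\<bar>coeff f i\<bar> \<le> H" for i
        using PL[OF xy(1)] PL[OF xy(2)] unfolding cf P_def by (auto simp: abs_le_iff intro: order_trans) (metis add.commute add_increasing diff_le_eq)+
      from norm_evz_le[OF df this, of s C] C[OF that] have "norm (evz f s) \<le> B" by (simp add: B_def)
      also have "B \<le> 6 * B" using B1 by simp
      also have "6 * B = K * real h ^ e" by (simp add: B_def K_def H_def)
      finally show ?thesis .
    qed
    have "norm (evz f r) \<le> K / real h"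
    proof -
      have "real h ^ e * real h \<le> real h ^ n"
        using h e(2) by (metis One_nat_def Suc_leI n_def of_nat_1 of_nat_le_iff power_Suc2 power_increasing)
      then have "real h ^ e / real h ^ n \<le> 1 / real h" using h by (simp add: field_simps)
      then have "K * (real h ^ e / real h ^ n) \<le> K * (1 / real h)" using K0 by (intro mult_left_mono) auto
      then show ?thesis using fr by simp
    qed
    moreover have "norm (\<Prod>s\<in>R. evz f s) \<le> K ^ n"
    proof -
      have finE: "finite E" using R finite_subset by blast
      have "norm (\<Prod>s\<in>R. evz f s) = (\<Prod>s\<in>E. norm (evz f s)) * (\<Prod>s\<in>R - E. norm (evz f s))"
        unfolding prod_norm[symmetric] using prod.subset_diff[OF R(2) R(1), of "\<lambda>s. norm (evz f s)"]
        by (simp add: mult.commute)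
      also have "\<dots> \<le> (\<Prod>s\<in>E. K * (real h ^ e / real h ^ n)) * (\<Prod>s\<in>R - E. K * real h ^ e)"
        using E fr fs K0 by (intro mult_mono prod_mono) (auto intro!: prod_nonneg)
      also have "\<dots> = (K * (real h ^ e / real h ^ n)) ^ e * (K * real h ^ e) ^ (n - e)"
        using R finE e(1) by (simp add: card_Diff_subset n_def)
      also have "\<dots> = (K ^ e * K ^ (n - e)) * ((real h ^ e) ^ e * (real h ^ e) ^ (n - e)) / (real h ^ n) ^ e"
        by (simp add: power_mult_distrib power_divide)
      also have "\<dots> = K ^ n * (real h ^ e) ^ n / (real h ^ n) ^ e"
        using e(2) by (simp add: n_def flip: power_add)
      also have "(real h ^ e) ^ n = (real h ^ n) ^ e" by (simp add: power_mult[symmetric] mult.commute)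
      finally show ?thesis using h by simp
    qed
    ultimately show ?thesis by blast
  qed
  then show ?thesis using K0 unfolding n_def by blast
qed

section \<open>Units as quotients of elements of equal norm\<close>

lemma finite_lists_mod:
  assumes "\<And>k::nat. \<bar>N k\<bar> \<le> (L::int)" "\<And>k. N k \<noteq> 0"
  shows "finite (range (\<lambda>k. map (\<lambda>i. c k i mod N k) [0..<n]))"
proof (rule finite_subset)
  show "finite {xs. set xs \<subseteq> {-L..L} \<and> length xs = n}" by (rule finite_lists_length_eq) simp
  have "\<bar>c k i mod N k\<bar> \<le> L" for k i
    using abs_mod_less[OF assms(2), of "c k i" k] assms(1)[of k] by linarith
  then have "c k i mod N k \<in> {-L..L}" for k i by (simp add: abs_le_iff minus_le_iff)
  then show "range (\<lambda>k. map (\<lambda>i. c k i mod N k) [0..<n]) \<subseteq> {xs. set xs \<subseteq> {-L..L} \<and> length xs = n}"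
    by auto
qed

lemma poly_cong_mod:
  fixes f g :: "int poly"
  assumes "degree f < n" "degree g < n"
    and "map (\<lambda>i. coeff f i mod N) [0..<n] = map (\<lambda>i. coeff g i mod N) [0..<n]"
  shows "\<exists>w. f = g + smult N w"
proof -
  have "N dvd coeff (f - g) i" for i
  proof (cases "i < n")
    case True
    then have "coeff f i mod N = coeff g i mod N" using assms(3) by auto
    then show ?thesis by (simp add: mod_eq_dvd_iff)
  next
    case False
    then show ?thesis using assms(1,2) by (simp add: coeff_eq_0)
  qed
  then have "[:N:] dvd f - g" by (simp add: const_poly_dvd_iff)
  then obtain w where "f - g = smult N w" by (auto simp: dvd_def)
  then show ?thesis by (intro exI[of _ w]) (simp add: algebra_simps)
qed

context
  fixes M :: "rat poly" and m :: "int poly" and r :: complex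
  assumes M: "is_minpoly M r" and m: "M = map_poly of_int m" "lead_coeff m = 1" "degree m = degree M"
begin

text \<open>Let \<open>N + X * q'\<close> be the characteristic polynomial of
  \<open>evz g r\<close>. It vanishes at \<open>evz g r\<close>, so \<open>- q'\<close> evaluated
  there is a cofactor of \<open>N\<close>: an element divides its norm inside
  \<open>\<int>[r]\<close>.\<close>

lemma norm_cofactor:
  "\<exists>N h. of_int N = (\<Prod>s\<in>croots M. - (evz g s :: complex)) \<and> evz g r * evz h r = (of_int N :: complex)"
proof -
  note fin = is_minpolyD(5)[OF M]
  have "(\<Prod>s\<in>croots M. [:- poly (map_poly of_int g) s, 1:]) \<in> polys_in \<int>"
  proof (rule prod_poly_roots_polys_in[OF is_subring_Ints fin])
    show "(\<Prod>r\<in>croots M. [:- r, 1:]) \<in> polys_in \<int>"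
      unfolding is_minpolyD(6)[OF M, symmetric] by (auto simp: m(1) polys_in_def)
  qed (auto simp: polys_in_def)
  then have ch: "(\<Prod>s\<in>croots M. [:- evz g s, 1:]) \<in> polys_in \<int>" by (simp add: evz_def)
  let ?\<chi> = "\<Prod>s\<in>croots M. [:- evz g s, 1:]"
  have "\<forall>i. \<exists>k. coeff ?\<chi> i = of_int k" using ch by (auto simp: polys_in_def elim: Ints_cases)
  then obtain k where k: "\<And>i. coeff ?\<chi> i = of_int (k i)" by metis
  define q where "q = Abs_poly k"
  have "k i = 0" if "i > degree ?\<chi>" for i using k[of i] coeff_eq_0[OF that] by simp
  then have cq: "coeff q = k" unfolding q_def by (intro Abs_poly_inverse) (auto simp: MOST_nat)
  have q: "map_poly of_int q = ?\<chi>" by (intro poly_eqI) (simp add: k cq)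
  obtain a q' where aq: "q = pCons a q'" by (cases q)
  have "evz q 0 = (of_int a :: complex)" by (simp add: aq evz_pCons)
  moreover have "evz q 0 = (\<Prod>s\<in>croots M. - (evz g s :: complex))"
    by (simp add: evz_def[of q] q poly_prod)
  moreover have "evz q (evz g r) = 0"
    using fin is_minpolyD(3)[OF M] by (auto simp: evz_def[of q] q poly_prod croots_def)
  then have "evz g r * evz (- (pcompose q' g)) r = (of_int a :: complex)"
    by (simp add: aq evz_pCons evz_pcompose add_eq_0_iff)
  ultimately show ?thesis by metis
qed

text \<open>Among elements of bounded norm and ever smaller value at \<open>r\<close>, two have the
  same \<open>N\<close> and agree modulo \<open>N\<close>. As both divide \<open>N\<close>, their
  quotient is a unit of \<open>\<int>[r]\<close>. The assumption ensures that \<open>r\<close> and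
  \<open>cnj r\<close> do not exhaust the conjugates.\<close>

lemma exists_unit_small:
  assumes "degree M \<ge> 2 \<and> r \<in> \<real> \<or> degree M \<ge> 3 \<and> r \<notin> \<real>"
  shows "\<exists>u v. evz u r * evz v r = 1 \<and> norm (evz u r) < 1"
proof -
  define n where "n = degree M"
  have cn: "card (croots M) = n" using is_minpolyD(7)[OF M] by (simp add: n_def)
  have fin: "finite (croots M)" by (rule is_minpolyD(5)[OF M])
  have rM: "r \<in> croots M" using is_minpolyD(3)[OF M] by (simp add: croots_def)
  define E where "E = {r, cnj r}"
  have cnj_evz: "evz f (cnj r) = cnj (evz f r)" for f
    by (induction f) (auto simp: evz_pCons)
  have "cnj r \<in> croots M"
    using is_minpolyD(3)[OF M] by (simp add: croots_def m(1) evq_of_int_poly cnj_evz)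
  then have ER: "E \<subseteq> croots M" using rM by (simp add: E_def)
  have e: "card E = 1 \<and> r \<in> \<real> \<or> card E = 2" "card E < card (croots M)"
    using assms by (auto simp: E_def cn n_def Reals_cnj_iff card_insert_if)
  have "\<exists>K>0. \<forall>h::nat>0. \<exists>f. f \<noteq> 0 \<and> degree f < n \<and> norm (evz f r) \<le> K / real h \<and>
    norm (\<Prod>s\<in>croots M. evz f s) \<le> K ^ n"
    by (rule small_value_box[OF fin ER _ refl e(2,1), unfolded cn]) (auto simp: E_def cnj_evz)
  then obtain K where "K > 0" and K: "\<forall>h::nat>0. \<exists>f. f \<noteq> 0 \<and> degree f < n \<and> norm (evz f r) \<le> K / real h \<and>
    norm (\<Prod>s\<in>croots M. evz f s) \<le> K ^ n" by blast
  from K have "\<forall>k::nat. \<exists>f. f \<noteq> 0 \<and> degree f < n \<and> norm (evz f r) \<le> K / real (Suc k) \<and>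
    norm (\<Prod>s\<in>croots M. evz f s) \<le> K ^ n" by blast
  then obtain f where f: "\<And>k::nat. f k \<noteq> 0" "\<And>k. degree (f k) < n" "\<And>k. norm (evz (f k) r) \<le> K / real (Suc k)"
    "\<And>k. norm (\<Prod>s\<in>croots M. evz (f k) s) \<le> K ^ n"
    by metis
  have "\<forall>k. \<exists>N h. of_int N = (\<Prod>s\<in>croots M. - (evz (f k) s :: complex)) \<and> evz (f k) r * evz h r = (of_int N :: complex)"
    using norm_cofactor by (intro allI)
  then obtain N g where N: "\<And>k. of_int (N k) = (\<Prod>s\<in>croots M. - (evz (f k) s :: complex))"
    and g: "\<And>k. evz (f k) r * evz (g k) r = (of_int (N k) :: complex)"
    by metis
  have fnz: "evz (f k) s \<noteq> 0" if "s \<in> croots M" for k s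
    using evz_nonzero[OF is_minpoly_croots[OF M that] f(1)] f(2) by (simp add: n_def)
  have N0: "N k \<noteq> 0" for k
  proof -
    have "(of_int (N k) :: complex) \<noteq> 0" unfolding N using fnz fin by auto
    then show ?thesis by simp
  qed
  have NK: "\<bar>N k\<bar> \<le> \<lfloor>K ^ n\<rfloor>" for k
  proof -
    have "norm (of_int (N k) :: complex) \<le> K ^ n" unfolding N using f(4)[of k] by (simp add: prod_norm[symmetric])
    then show ?thesis by (simp add: le_floor_iff)
  qed
  define key where "key k = (N k, map (\<lambda>i. coeff (f k) i mod N k) [0..<n])" for k
  have "finite (range key)"
  proof (rule finite_subset)
    show "range key \<subseteq> {- \<lfloor>K ^ n\<rfloor>..\<lfloor>K ^ n\<rfloor>} \<times> range (\<lambda>k. map (\<lambda>i. coeff (f k) i mod N k) [0..<n])"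
      using NK by (auto simp: key_def abs_le_iff minus_le_iff)
    show "finite ({- \<lfloor>K ^ n\<rfloor>..\<lfloor>K ^ n\<rfloor>} \<times> range (\<lambda>k. map (\<lambda>i. coeff (f k) i mod N k) [0..<n]))"
      using finite_lists_mod[OF NK N0] by (intro finite_cartesian_product) auto
  qed
  from pigeonhole_infinite[OF infinite_UNIV_nat this] obtain a where a: "infinite {k. key k = key a}" by auto
  have pos: "norm (evz (f a) r) > 0" using fnz[OF rM] by simp
  \<comment> \<open>Beyond \<open>k0\<close> the bound \<open>K / Suc b\<close> is below the size of
    \<open>f a\<close> at \<open>r\<close>, so the quotient has size below 1.\<close>
  obtain k0 :: nat where k0: "K / norm (evz (f a) r) < real k0" using reals_Archimedean2 by blast
  obtain b where b: "b > k0" "key b = key a" using a by (metis (mono_tags, lifting) infinite_nat_iff_unbounded mem_Collect_eq)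
  have "K / real (Suc b) < norm (evz (f a) r)"
  proof -
    have "K / norm (evz (f a) r) < real (Suc b)" using k0 b(1) by simp
    then show ?thesis using pos by (simp add: field_simps)
  qed
  then have lt: "norm (evz (f b) r) < norm (evz (f a) r)" using f(3)[of b] by linarith
  have Nab: "N b = N a" using b(2) by (simp add: key_def)
  obtain w where w: "f b = f a + smult (N a) w"
    using poly_cong_mod[OF f(2)[of b] f(2)[of a], of "N a"] b(2) by (auto simp: key_def)
  \<comment> \<open>At \<open>r\<close>, \<open>f b = f a + N w\<close> and
    \<open>N = f a * g a\<close> give \<open>f b / f a = 1 + w * g a\<close>; the reverse quotient
    \<open>v\<close> comes from \<open>N = f b * g b\<close>.\<close>
  define u where "u = 1 + w * g a"
  define v where "v = 1 - w * g b"
  have fw: "evz (f b) r = evz (f a) r + of_int (N a) * (evz w r :: complex)" by (simp add: w)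
  have u: "evz u r * evz (f a) r = evz (f b) r"
    unfolding u_def fw g[of a, symmetric] by (simp add: algebra_simps)
  have v: "evz v r * evz (f b) r = evz (f a) r"
  proof -
    have "evz v r * evz (f b) r = evz (f b) r - evz w r * (evz (f b) r * evz (g b) r)"
      by (simp add: v_def algebra_simps)
    also have "\<dots> = evz (f a) r" unfolding g Nab by (simp add: fw)
    finally show ?thesis .
  qed
  have "(evz u r * evz v r) * evz (f b) r = 1 * evz (f b) r"
    unfolding mult.assoc v u by simp
  then have uv: "evz u r * evz v r = 1" using fnz[OF rM, of b] by (simp only: mult_cancel_right) simp
  have "norm (evz u r) * norm (evz (f a) r) < 1 * norm (evz (f a) r)"
    using lt u by (simp flip: norm_mult)
  then have "norm (evz u r) < 1" using pos by (simp only: mult_less_cancel_right)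
  then show ?thesis using uv by blast
qed

text \<open>Powers of a unit repeat modulo \<open>A\<close>, and cancelling the smaller power leaves
  one congruent to 1. It is not 1 because its size at \<open>r\<close> is below 1.\<close>

lemma exists_unit_cong_one:
  assumes "degree M \<ge> 2 \<and> r \<in> \<real> \<or> degree M \<ge> 3 \<and> r \<notin> \<real>" and A: "(A::int) > 0"
  shows "\<exists>u v w. evz u r * evz v r = 1 \<and> evz u r = 1 + of_int A * evz w r \<and> evz u r \<noteq> 1"
proof -
  obtain u v where uv: "evz u r * evz v r = 1" "norm (evz u r) < 1" using exists_unit_small[OF assms(1)] by blast
  have "\<forall>k. \<exists>q R. u ^ k = m * q + R \<and> degree R < degree m"
    using monic_int_division[OF m(2)] is_minpolyD(4)[OF M] m(3) by metis
  then obtain q R where R: "\<And>k. u ^ k = m * q k + R k" "\<And>k. degree (R k) < degree m" by metis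
  have mr: "evz m r = 0" using is_minpolyD(3)[OF M] by (simp add: m(1) evq_of_int_poly)
  have uR: "evz u r ^ k = evz (R k) r" for k
    using arg_cong[OF R(1)[of k], of "\<lambda>p. evz p r"] mr by simp
  define key where "key k = map (\<lambda>i. coeff (R k) i mod A) [0..<degree m]" for k
  have "finite (range key)" unfolding key_def
    using A by (intro finite_lists_mod[of "\<lambda>_. A" A]) auto
  from pigeonhole_infinite[OF infinite_UNIV_nat this] obtain i where i: "infinite {k. key k = key i}" by auto
  then obtain j where j: "j > i" "key j = key i" by (metis (mono_tags, lifting) infinite_nat_iff_unbounded mem_Collect_eq)
  obtain w where w: "R j = R i + smult A w"
    using poly_cong_mod[OF R(2)[of j] R(2)[of i], of A] j(2) by (auto simp: key_def)
  have 1: "evz u r ^ j = evz u r ^ i + of_int A * evz w r" unfolding uR by (simp add: w)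
  define k where "k = j - i"
  have k: "j = i + k" "k > 0" using j(1) by (auto simp: k_def)
  have inv: "evz u r ^ i * evz v r ^ i = 1" using uv(1) by (simp flip: power_mult_distrib)
  have "evz u r ^ k = evz u r ^ j * evz v r ^ i"
    using inv by (simp add: k(1) power_add algebra_simps)
  also have "\<dots> = 1 + of_int A * evz (w * v ^ i) r" unfolding 1 using inv by (simp add: algebra_simps)
  finally have 2: "evz (u ^ k) r = 1 + of_int A * evz (w * v ^ i) r" by simp
  have 3: "evz (u ^ k) r * evz (v ^ k) r = 1" using uv(1) by (simp flip: power_mult_distrib)
  have "norm (evz (u ^ k) r) < 1" using uv(2) k(2) by (simp add: norm_power power_less_one_iff)
  then have "evz (u ^ k) r \<noteq> 1" by auto
  then show ?thesis using 2 3 by blast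
qed

end

text \<open>The unit is found at a complex conjugate \<open>r\<close> of \<open>x\<close> and
  carried back by \<open>evz_eq_iff\<close>. From degree 3 on any conjugate will do; in degree 2 it
  must be real.\<close>

lemma exists_unit_cong_one':
  fixes x :: "'a::field_char_0"
  assumes M: "is_minpoly M x" and x: "algebraic_int x" and A: "(A::int) > 0"
    and deg: "degree M \<ge> 2" "degree M = 2 \<Longrightarrow> \<exists>r\<in>croots M. r \<in> \<real>"
  shows "\<exists>u v w. evz u x * evz v x = 1 \<and> evz u x = 1 + of_int A * evz w x \<and> evz u x \<noteq> 1"
proof -
  obtain m where m: "M = map_poly of_int m" "lead_coeff m = 1" "degree m = degree M"
    using is_minpoly_int[OF M x] by blast
  obtain r where r: "r \<in> croots M" "degree M \<ge> 2 \<and> r \<in> \<real> \<or> degree M \<ge> 3 \<and> r \<notin> \<real>"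
  proof (cases "degree M = 2")
    case True
    then show ?thesis using deg that by auto
  next
    case False
    then have "degree M \<ge> 3" using deg(1) by simp
    moreover obtain r where "r \<in> croots M" using is_minpolyD(8)[OF M] by blast
    ultimately show ?thesis using that by fastforce
  qed
  have Mr: "is_minpoly M r" by (rule is_minpoly_croots[OF M r(1)])
  obtain u v w where "evz u r * evz v r = 1" "evz u r = 1 + of_int A * evz w r" "evz u r \<noteq> 1"
    using exists_unit_cong_one[OF Mr m r(2) A] by blast
  moreover have "evz f r = evz g r \<longleftrightarrow> evz f x = evz g x" for f g by (rule evz_eq_iff[OF Mr M])
  from this[of "u * v" 1] this[of u "1 + smult A w"] this[of u 1]
  have "evz u r * evz v r = 1 \<longleftrightarrow> evz u x * evz v x = 1" "evz u r = 1 + of_int A * evz w r \<longleftrightarrow> evz u x = 1 + of_int A * evz w x"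
    "evz u r = 1 \<longleftrightarrow> evz u x = 1" by auto
  ultimately show ?thesis by blast
qed

section \<open>Trace form, norms and primitive elements\<close>

lemma int_subgroup_generator:
  fixes S :: "int set"
  assumes "0 \<in> S" and sub: "\<And>a b k. a \<in> S \<Longrightarrow> b \<in> S \<Longrightarrow> a - k * b \<in> S"
  shows "\<exists>t\<in>S. \<forall>s\<in>S. t dvd s"
proof (cases "S = {0}")
  case False
  then obtain s where s: "s \<in> S" "s \<noteq> 0" using assms(1) by blast
  then have "\<bar>s\<bar> \<in> S" using sub[OF assms(1) s(1), of 1] by (auto simp: abs_if)
  then have ex: "\<exists>k::nat. k > 0 \<and> int k \<in> S" using s(2) by (intro exI[of _ "nat \<bar>s\<bar>"]) auto
  define t where "t = (LEAST k::nat. k > 0 \<and> int k \<in> S)"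
  have t: "t > 0" "int t \<in> S" using LeastI_ex[OF ex] by (auto simp: t_def)
  have "int t dvd s" if "s \<in> S" for s
  proof (rule ccontr)
    assume "\<not> int t dvd s"
    then have r: "s mod int t > 0" using t(1) by (simp add: dvd_eq_mod_eq_0 order_le_neq_trans)
    have "s mod int t = s - (s div int t) * int t" by (simp add: minus_div_mult_eq_mod)
    then have "s mod int t \<in> S" using sub[OF that t(2)] by simp
    then have "t \<le> nat (s mod int t)"
      using Least_le[of "\<lambda>k. k > 0 \<and> int k \<in> S" "nat (s mod int t)", folded t_def] r by simp
    moreover have "s mod int t < int t" using t(1) by simp
    ultimately show False using r by linarith
  qed
  then show ?thesis using t(2) by blast
qed auto

lemma dvd_content_iff: "(\<forall>i. t dvd coeff p i) \<longleftrightarrow> (t::int) dvd content p"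
  by (simp add: const_poly_dvd_iff_dvd_content[symmetric] const_poly_dvd_iff)

text \<open>\<open>D\<close> is the absolute determinant of the Gram matrix \<open>G\<close> of
  traces of powers; it is nonzero as \<open>G = V^T V\<close> for the Vandermonde matrix
  \<open>V\<close> of the conjugates. The traces of multiples of \<open>b\<close> form an ideal of
  \<open>\<int>\<close>, generated by some \<open>t\<close>. The adjugate of \<open>G\<close> shows
  that \<open>t\<close> divides \<open>det G\<close> times each coefficient of \<open>b\<close>, and
  content 1 leaves \<open>det G\<close>.\<close>

lemma trace_form_primitive:
  fixes x :: "'a::field_char_0"
  assumes M: "is_minpoly M x" and x: "algebraic_int x"
  shows "\<exists>D::int>0. \<forall>b. content b = 1 \<longrightarrow> degree b < degree M \<longrightarrow>
    (\<exists>c t. (\<Sum>s\<in>croots M. evz (b * c) s :: complex) = of_int t \<and> t dvd D)"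
proof -
  define n where "n = degree M"
  have s_int: "algebraic_int s" if "s \<in> croots M" for s
    using algebraic_int_evq_transfer[OF M is_minpoly_croots[OF M that], of "[:0,1:]"] x by simp
  have "\<exists>k. (\<Sum>s\<in>croots M. evz f s :: complex) = of_int k" for f
    using sum_prod_in_Ints(1)[OF M, of "map_poly of_int f"] s_int
    by (auto simp: evq_of_int_poly evz_algebraic_int elim!: Ints_cases)
  then obtain T where T: "\<And>f. (\<Sum>s\<in>croots M. evz f s :: complex) = of_int (T f)" by metis
  have T_lin: "T (\<Sum>i\<in>A. smult (c i) (p i)) = (\<Sum>i\<in>A. c i * T (p i))" for A :: "nat set" and c p
  proof -
    have "(of_int (T (\<Sum>i\<in>A. smult (c i) (p i))) :: complex) = (\<Sum>s\<in>croots M. \<Sum>i\<in>A. of_int (c i) * evz (p i) s)"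
      unfolding T[symmetric] by simp
    also have "\<dots> = (\<Sum>i\<in>A. \<Sum>s\<in>croots M. of_int (c i) * evz (p i) s)" by (rule sum.swap)
    also have "\<dots> = of_int (\<Sum>i\<in>A. c i * T (p i))" by (simp add: T flip: sum_distrib_left)
    finally show ?thesis by (simp only: of_int_eq_iff)
  qed
  have T_diff: "T (f - smult k g) = T f - k * T g" for f g k
  proof -
    have "(of_int (T (f - smult k g)) :: complex) = of_int (T f - k * T g)"
      unfolding of_int_diff of_int_mult T[symmetric] by (simp add: sum_subtractf sum_distrib_left)
    then show ?thesis by (simp only: of_int_eq_iff)
  qed
  obtain \<theta> where \<theta>: "bij_betw \<theta> {..<n} (croots M)"
    using ex_bij_betw_nat_finite[OF is_minpolyD(5)[OF M]] is_minpolyD(7)[OF M]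
    by (auto simp: n_def lessThan_atLeast0)
  define V where "V = mat n n (\<lambda>(i,k). \<theta> i ^ k)"
  define G where "G = mat n n (\<lambda>(i,j). T ([:0,1:] ^ (i + j)))"
  have carr: "V \<in> carrier_mat n n" "G \<in> carrier_mat n n" by (auto simp: V_def G_def)
  have GV: "map_mat of_int G = transpose_mat V * V"
  proof (rule eq_matI)
    fix i j assume "i < dim_row (transpose_mat V * V)" "j < dim_col (transpose_mat V * V)"
    then have ij: "i < n" "j < n" using carr by auto
    have "map_mat of_int G $$ (i,j) = (\<Sum>s\<in>croots M. evz ([:0,1:] ^ (i + j)) s)"
      using ij unfolding T by (simp add: G_def)
    also have "\<dots> = (\<Sum>s\<in>croots M. s ^ i * s ^ j)" by (simp only: evz_simps power_add)
    also have "\<dots> = (\<Sum>k<n. \<theta> k ^ i * \<theta> k ^ j)" by (rule sum.reindex_bij_betw[OF \<theta>, symmetric])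
    also have "\<dots> = (transpose_mat V * V) $$ (i,j)"
      using ij by (simp add: V_def scalar_prod_def lessThan_atLeast0)
    finally show "map_mat of_int G $$ (i,j) = (transpose_mat V * V) $$ (i,j)" .
  qed (use carr in auto)
  have "det V \<noteq> 0" unfolding V_def using \<theta> by (intro vandermonde_det_nonzero) (auto simp: bij_betw_def)
  then have "det (transpose_mat V * V) \<noteq> 0" using carr by (simp add: det_mult[of _ n] det_transpose)
  then have "det (map_mat of_int G :: complex mat) \<noteq> 0" unfolding GV .
  then have detG: "det G \<noteq> 0" by (simp add: of_int_hom.hom_det)
  have "\<exists>c t. (\<Sum>s\<in>croots M. evz (b * c) s :: complex) = of_int t \<and> t dvd \<bar>det G\<bar>"
    if b: "content b = 1" "degree b < degree M" for b
  proof -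
    have "\<exists>t\<in>range (\<lambda>c. T (b * c)). \<forall>s\<in>range (\<lambda>c. T (b * c)). t dvd s"
    proof (rule int_subgroup_generator)
      have "T (b * 0) = 0" using T_lin[of "\<lambda>_. 0" "\<lambda>_. 0" "{}"] by simp
      then show "0 \<in> range (\<lambda>c. T (b * c))" by (metis rangeI)
      show "u - k * v \<in> range (\<lambda>c. T (b * c))" if uv: "u \<in> range (\<lambda>c. T (b * c))" "v \<in> range (\<lambda>c. T (b * c))" for u v k
      proof -
        obtain c d where "u = T (b * c)" "v = T (b * d)" using uv by blast
        then have "u - k * v = T (b * (c - smult k d))" by (simp add: T_diff algebra_simps)
        then show ?thesis by blast
      qed
    qed
    then obtain c where c: "\<And>d. T (b * c) dvd T (b * d)" by blast
    let ?t = "T (b * c)"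
    have bsum: "b = (\<Sum>j<n. smult (coeff b j) ([:0,1:] ^ j))"
    proof -
      have "b = (\<Sum>j\<le>degree b. monom (coeff b j) j)" by (simp add: poly_as_sum_of_monoms)
      also have "\<dots> = (\<Sum>j<n. monom (coeff b j) j)"
        using b(2) by (intro sum.mono_neutral_left) (auto simp: n_def coeff_eq_0)
      finally show ?thesis by (simp add: monom_altdef)
    qed
    \<comment> \<open>\<open>G\<close> maps the coefficient vector of \<open>b\<close> to the traces
      of \<open>b * X ^ i\<close>, all of which are divisible by \<open>?t\<close>.\<close>
    have Gb: "(\<Sum>j<n. G $$ (i,j) * coeff b j) = T (b * [:0,1:] ^ i)" if "i < n" for i
    proof -
      have "b * [:0,1:] ^ i = (\<Sum>j<n. smult (coeff b j) ([:0,1:] ^ (i + j)))"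
        unfolding sum_distrib_right[symmetric] mult_smult_left[symmetric] power_add mult.commute[of "[:0,1:] ^ i"]
        by (simp only: bsum[symmetric])
      then show ?thesis using that by (simp add: T_lin G_def mult.commute)
    qed
    have "?t dvd det G * coeff b j" if j: "j < n" for j
    proof -
      have adj: "adj_mat G * G = det G \<cdot>\<^sub>m 1\<^sub>m n" "adj_mat G \<in> carrier_mat n n" using adj_mat[OF carr(2)] by auto
      have "det G * coeff b j = (\<Sum>k<n. if k = j then det G * coeff b k else 0)" using j by simp
      also have "\<dots> = (\<Sum>k<n. (det G \<cdot>\<^sub>m 1\<^sub>m n) $$ (j,k) * coeff b k)"
        using j by (intro sum.cong) auto
      also have "\<dots> = (\<Sum>k<n. (\<Sum>i<n. adj_mat G $$ (j,i) * G $$ (i,k)) * coeff b k)"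
        unfolding adj(1)[symmetric] using j carr adj(2)
        by (intro sum.cong) (auto simp: scalar_prod_def lessThan_atLeast0)
      also have "\<dots> = (\<Sum>k<n. \<Sum>i<n. adj_mat G $$ (j,i) * (G $$ (i,k) * coeff b k))"
        by (simp add: sum_distrib_right mult.assoc)
      also have "\<dots> = (\<Sum>i<n. \<Sum>k<n. adj_mat G $$ (j,i) * (G $$ (i,k) * coeff b k))" by (rule sum.swap)
      also have "\<dots> = (\<Sum>i<n. adj_mat G $$ (j,i) * T (b * [:0,1:] ^ i))"
        by (simp add: Gb flip: sum_distrib_left)
      also have "?t dvd \<dots>" using c by (intro dvd_sum dvd_mult)
      finally show ?thesis .
    qed
    then have "?t dvd coeff (smult (det G) b) j" for j
      by (cases "j < n") (use b(2) in \<open>auto simp: n_def coeff_eq_0\<close>)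
    then have "?t dvd content (smult (det G) b)" using dvd_content_iff by blast
    then have "?t dvd \<bar>det G\<bar>" using b(1) by (simp add: content_smult)
    then show ?thesis using T by blast
  qed
  then show ?thesis using detG by (intro exI[of _ "\<bar>det G\<bar>"]) auto
qed

lemma evq_inverse:
  assumes P: "is_minpoly P \<theta>" and h: "evq h \<theta> \<noteq> 0"
  shows "\<exists>h'. evq h' \<theta> = inverse (evq h \<theta>)"
proof -
  have "\<not> P dvd h" using h is_minpolyD(9)[OF P] by blast
  then have "coprime P h"
    using is_minpolyD(2)[OF P] by (simp add: irreducible_imp_prime_elem_gcd prime_elem_imp_coprime)
  then obtain a b where "a * P + b * h = 1" by (metis bezout_coefficients_fst_snd coprime_iff_gcd_eq_1)
  from arg_cong[OF this, of "\<lambda>p. evq p \<theta>"] have "evq b \<theta> * evq h \<theta> = 1" using is_minpolyD(3)[OF P] by simp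
  then show ?thesis using h by (intro exI[of _ b]) (simp add: field_simps)
qed

text \<open>The norm of the unit \<open>evq h \<theta>\<close> is 1 or -1, and as a product over
  conjugates it is \<open>1 + a * k * t\<close> modulo the square of \<open>a\<close>, where
  \<open>k\<close> is the fibre size from \<open>croots_fibres\<close>. The value -1 would need
  \<open>a dvd -2\<close>, which \<open>a \<ge> 3\<close> excludes.\<close>

lemma norm_congruence:
  fixes \<theta> x \<delta> \<delta>' Y :: "'a::field_char_0"
  assumes P: "is_minpoly P \<theta>" and M: "is_minpoly M (evq g \<theta>)" and x: "algebraic_int (evq g \<theta>)"
    and \<delta>: "algebraic_int (evq h \<theta>)" "algebraic_int \<delta>'" "evq h \<theta> * \<delta>' = 1"
    and Y: "algebraic_int (evq l \<theta>)" and a: "a \<ge> 3"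
    and eq: "evq h \<theta> = 1 + of_int a * evz f (evq g \<theta>) + of_int a ^ 2 * evq l \<theta>"
    and t: "(\<Sum>s\<in>croots M. evz f s :: complex) = of_int t"
  shows "a dvd int (degree P div degree M) * t"
proof -
  note fin = is_minpolyD(5)[OF P]
  define k where "k = degree P div degree M"
  have conj: "is_minpoly P \<rho>" if "\<rho> \<in> croots P" for \<rho> by (rule is_minpoly_croots[OF P that])
  have "evq h \<theta> \<noteq> 0" using \<delta>(3) by auto
  \<comment> \<open>Writing the inverse unit as a polynomial in \<open>\<theta>\<close> gives it
    conjugates, so that the two norms are integers with product 1.\<close>
  then obtain h' where "evq h' \<theta> = inverse (evq h \<theta>)" using evq_inverse[OF P] by blast
  then have h': "evq h' \<theta> = \<delta>'" using \<delta>(3) by (metis inverse_unique)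
  have pr: "(\<Prod>\<rho>\<in>croots P. evq h \<rho>) \<in> \<int>" "(\<Prod>\<rho>\<in>croots P. evq h' \<rho>) \<in> \<int>"
    using algebraic_int_evq_transfer[OF P conj] \<delta>(1,2) h' by (auto intro!: sum_prod_in_Ints(2)[OF P])
  then obtain p p' where p: "(\<Prod>\<rho>\<in>croots P. evq h \<rho>) = of_int p" "(\<Prod>\<rho>\<in>croots P. evq h' \<rho>) = of_int p'"
    by (auto elim!: Ints_cases)
  have "evq h \<rho> * evq h' \<rho> = 1" if "\<rho> \<in> croots P" for \<rho>
    using evq_eq_iff[OF P conj[OF that], of "h * h'" 1] \<delta>(3) h' by simp
  then have "(\<Prod>\<rho>\<in>croots P. evq h \<rho> * evq h' \<rho>) = 1" by simp
  then have "(of_int (p * p') :: complex) = of_int 1" unfolding prod.distrib p by simp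
  then have "p * p' = 1" by (simp only: of_int_eq_iff)
  then have p1: "p = 1 \<or> p = -1" by (simp add: zmult_eq_1_iff) blast
  define u where "u \<rho> = evz f (evq g \<rho>) + of_int a * evq l \<rho>" for \<rho> :: complex
  have hu: "evq h \<rho> = 1 + of_int a * u \<rho>" if "\<rho> \<in> croots P" for \<rho>
    using evq_eq_iff[OF P conj[OF that], of h "1 + smult (of_int a) (pcompose (map_poly of_int f) g + smult (of_int a) l)"] eq
    by (simp add: u_def evq_pcompose evq_of_int_poly algebra_simps power2_eq_square)
  have l_int: "algebraic_int (evq l \<rho>)" if "\<rho> \<in> croots P" for \<rho>
    by (rule algebraic_int_evq_transfer[OF P conj[OF that] Y])
  have u_int: "algebraic_int (u \<rho>)" if "\<rho> \<in> croots P" for \<rho>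
    unfolding u_def
    by (intro algebraic_int_ring evz_algebraic_int algebraic_int_of_int l_int that algebraic_int_evq_transfer[OF P conj[OF that] x])
  have "\<exists>Z. algebraic_int Z \<and> (\<Prod>\<rho>\<in>croots P. 1 + of_int a * u \<rho>) = 1 + of_int a * sum u (croots P) + of_int a ^ 2 * Z"
    by (rule prod_one_plus[OF fin]) (rule u_int)
  then obtain Z where Z: "algebraic_int Z" "(\<Prod>\<rho>\<in>croots P. 1 + of_int a * u \<rho>) = 1 + of_int a * sum u (croots P) + of_int a ^ 2 * Z"
    by (elim exE conjE)
  have "sum u (croots P) = of_nat k * of_int t + of_int a * (\<Sum>\<rho>\<in>croots P. evq l \<rho>)"
    unfolding u_def sum.distrib sum_distrib_left[symmetric] sum_croots_fibres[OF P M] t k_def ..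
  then have eq2: "of_int p = 1 + of_int a * (of_nat k * of_int t) + of_int a ^ 2 * (Z + (\<Sum>\<rho>\<in>croots P. evq l \<rho>))"
    using Z(2) hu by (simp add: p(1)[symmetric] algebra_simps power2_eq_square)
  let ?Z = "Z + (\<Sum>\<rho>\<in>croots P. evq l \<rho>)"
  have "algebraic_int ?Z"
    using l_int by (intro algebraic_int_ring Z(1) is_subring_sum[OF is_subring_algebraic_int, unfolded mem_Collect_eq])
  \<comment> \<open>The error term is a complex algebraic integer; solving the equation for it shows
    that it is also rational, hence an integer.\<close>
  moreover have "?Z = (of_int p - 1 - of_int a * (of_nat k * of_int t)) / of_int a ^ 2"
    using eq2 a by (simp add: field_simps)
  then have "?Z \<in> \<rat>" by (simp only:) (intro Rats_divide Rats_diff Rats_mult Rats_power Rats_of_int Rats_of_nat Rats_1)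
  ultimately have "?Z \<in> \<int>" by (rule rational_algebraic_int_is_int)
  then obtain z where "?Z = of_int z" by (auto elim: Ints_cases)
  then have "(of_int p :: complex) = of_int (1 + a * (int k * t) + a ^ 2 * z)" using eq2 by simp
  then have pz: "p = 1 + a * (int k * t + a * z)" by (simp only: of_int_eq_iff) (simp add: algebra_simps power2_eq_square)
  then have "a dvd p - 1" by simp
  moreover have "\<not> a dvd - 2" using a zdvd_imp_le[of a 2] by auto
  ultimately have "p = 1" using p1 by auto
  then have "int k * t = a * (- z)" using pz a by (simp add: add_eq_0_iff)
  then show ?thesis unfolding k_def by simp
qed

section \<open>Primitive elements and degrees\<close>

interpretation to_ac_hom: inj_idom_hom "to_ac :: 'a::field \<Rightarrow> 'a alg_closure"
  by unfold_locales (auto simp: to_ac_eq_iff)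

interpretation to_ac_poly_hom: map_poly_inj_idom_hom "to_ac :: 'a::field \<Rightarrow> 'a alg_closure" ..

lemma subfield_range_evq:
  assumes P: "is_minpoly P (\<theta> :: 'a::field_char_0)"
  shows "subfield (range (\<lambda>p. evq p \<theta>)) ambient"
  unfolding subfield_ambient_iff is_subring_def
proof (intro conjI ballI)
  show "0 \<in> range (\<lambda>p. evq p \<theta>)" by (metis evq_simps(1) rangeI)
  show "1 \<in> range (\<lambda>p. evq p \<theta>)" by (metis evq_simps(2) rangeI)
  fix a assume "a \<in> range (\<lambda>p. evq p \<theta>)"
  then obtain p where p: "a = evq p \<theta>" by blast
  show "- a \<in> range (\<lambda>p. evq p \<theta>)" unfolding p by (metis evq_simps(4) rangeI)
  show "inverse a \<in> range (\<lambda>p. evq p \<theta>)"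
  proof (cases "a = 0")
    case True
    then have "inverse a = evq 0 \<theta>" by simp
    then show ?thesis by blast
  next
    case False
    then show ?thesis using evq_inverse[OF P, of p] unfolding p by (metis rangeI)
  qed
  fix b assume "b \<in> range (\<lambda>p. evq p \<theta>)"
  then obtain q where q: "b = evq q \<theta>" by blast
  show "a + b \<in> range (\<lambda>p. evq p \<theta>)" unfolding p q by (metis evq_simps(3) rangeI)
  show "a * b \<in> range (\<lambda>p. evq p \<theta>)" unfolding p q by (metis evq_simps(6) rangeI)
qed

text \<open>The minimal polynomial \<open>d\<close> of \<open>y\<close> over
  \<open>S = \<rat>(\<theta>)\<close> divides both that of \<open>y\<close> over
  \<open>\<rat>\<close> and \<open>B(\<theta> - c X)\<close>. For all but finitely many
  \<open>c\<close> these share only the root \<open>y\<close>, and by separability \<open>d\<close>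
  is linear, so \<open>y\<close> lies in \<open>S\<close>. A natural number \<open>c\<close> keeps
  \<open>\<theta>\<close> an algebraic integer.\<close>

lemma primitive_element_int:
  fixes x y :: "'a::field_char_0"
  assumes x: "algebraic_int x" and y: "algebraic_int y"
  shows "\<exists>c::nat. \<exists>gx gy. x = evq gx (x + of_nat c * y) \<and> y = evq gy (x + of_nat c * y)"
proof -
  obtain A where A: "is_minpoly A y" using exists_minpoly[of y] y unfolding is_minpoly_def by auto
  obtain B where B: "is_minpoly B x" using exists_minpoly[of x] x unfolding is_minpoly_def by auto
  define A' where "A' = (map_poly of_rat A :: 'a poly)"
  define B' where "B' = (map_poly of_rat B :: 'a poly)"
  have AB0: "A' \<noteq> 0" "B' \<noteq> 0" using is_minpolyD(4)[OF A] is_minpolyD(4)[OF B] by (auto simp: A'_def B'_def)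
  let ?E = "map_poly to_ac :: 'a poly \<Rightarrow> 'a alg_closure poly"
  define RA where "RA = {s. poly (?E A') s = 0}"
  define RB where "RB = {s. poly (?E B') s = 0}"
  have fin: "finite RA" "finite RB" using AB0 unfolding RA_def RB_def by (auto intro: poly_roots_finite)
  \<comment> \<open>\<open>c = (r - x) / (y - s)\<close> means \<open>x + c * y = r + c * s\<close>,
    a coincidence of conjugates. Roots are taken in the algebraic closure since the field itself may
    lack them.\<close>
  define bad where "bad = (\<lambda>(r,s). (r - to_ac x) / (to_ac y - s)) ` (RB \<times> RA)"
  have "finite bad" unfolding bad_def using fin by auto
  moreover have "inj (of_nat :: nat \<Rightarrow> 'a alg_closure)" by (auto simp: inj_on_def)
  ultimately have "finite ((of_nat :: nat \<Rightarrow> 'a alg_closure) -` bad)" by (rule finite_vimageI)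
  then obtain c :: nat where c: "of_nat c \<notin> bad" using ex_new_if_finite[OF infinite_UNIV_nat] by blast
  define \<theta> where "\<theta> = x + of_nat c * y"
  have "algebraic_int \<theta>" unfolding \<theta>_def using x y by (intro algebraic_int_ring) auto
  then obtain P where P: "is_minpoly P \<theta>" using exists_minpoly[of \<theta>] unfolding is_minpoly_def by auto
  define S where "S = range (\<lambda>p. evq p \<theta>)"
  have Sf: "subfield S ambient" unfolding S_def by (rule subfield_range_evq[OF P])
  note Sr = subfieldD(1)[OF Sf]
  have \<theta>S: "\<theta> \<in> S" unfolding S_def by (metis evq_simps(8) rangeI)
  define G where "G = pcompose B' [:\<theta>, - of_nat c:]"
  have ratS: "map_poly of_rat p \<in> polys_in S" for p using subfieldD(5)[OF Sf] by (auto simp: polys_in_def)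
  have G_in: "pcompose (map_poly of_rat p) [:\<theta>, - of_nat c:] \<in> polys_in S" for p
  proof (induction p)
    case (pCons a p)
    have "[:\<theta>, - of_nat c:] \<in> polys_in S"
      using \<theta>S subfieldD(5)[OF Sf, of "- of_nat c"] is_subringD(1)[OF Sr]
      by (auto simp: polys_in_def coeff_pCons of_rat_minus split: nat.splits)
    then show ?case
      using pCons is_subring_polys_in[OF Sr] subfieldD(5)[OF Sf]
      by (auto simp: of_rat_hom.map_poly_pCons_hom pcompose_pCons intro!: is_subringD polys_in_const[OF Sr]
          simp del: mult_pCons_left)
  qed (use is_subringD(1)[OF is_subring_polys_in[OF Sr]] in simp)
  have Ay: "poly A' y = 0" using is_minpolyD(3)[OF A] by (simp add: A'_def evq_def)
  have Gy: "poly G y = 0" using is_minpolyD(3)[OF B] by (simp add: G_def B'_def evq_def poly_pcompose \<theta>_def algebra_simps)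
  obtain d1 where d1: "d1 \<in> polys_in S" "d1 \<noteq> 0" "poly d1 y = 0"
    and min1: "\<And>f. f \<in> polys_in S \<Longrightarrow> f \<noteq> 0 \<Longrightarrow> poly f y = 0 \<Longrightarrow> degree d1 \<le> degree f"
    using ex_has_least_nat[of "\<lambda>f. f \<in> polys_in S \<and> f \<noteq> 0 \<and> poly f y = 0" A' degree] ratS[of A] AB0 Ay
    unfolding A'_def by blast
  define d where "d = smult (inverse (lead_coeff d1)) d1"
  have d: "d \<in> polys_in S" "lead_coeff d = 1" "poly d y = 0" "degree d = degree d1"
    using d1 subfieldD(2)[OF Sf] is_subringD(4)[OF Sr] by (auto simp: d_def polys_in_def)
  have d_dvd: "d dvd f" if f: "f \<in> polys_in S" "poly f y = 0" for f
  proof -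
    obtain q r where qr: "r \<in> polys_in S" "f = d * q + r" "r = 0 \<or> degree r < degree d"
      using monic_division[OF Sr d(1,2) f(1)] by blast
    have "poly r y = 0" using f(2) d(3) by (simp add: qr(2))
    then have "r = 0" using min1[OF qr(1)] qr(3) d(4) by fastforce
    then show ?thesis by (simp add: qr(2))
  qed
  have dA: "d dvd A'" using d_dvd[OF _ Ay] ratS by (simp add: A'_def)
  have dG: "d dvd G" using d_dvd[OF _ Gy] G_in by (simp add: G_def B'_def)
  obtain d' where d': "d = [:- y, 1:] * d'" using d(3) by (auto simp: poly_eq_0_iff_dvd dvd_def)
  \<comment> \<open>A further root of \<open>d\<close> must be \<open>y\<close> by the choice of
    \<open>c\<close>, and then \<open>y\<close> would be a double root of the separable
    \<open>A\<close>.\<close>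
  have deg: "degree d' = 0"
  proof (rule ccontr)
    assume "degree d' \<noteq> 0"
    then obtain s where s: "poly (?E d') s = 0" using alg_closed_imp_poly_has_root[of "?E d'"] by auto
    then have s0: "poly (?E d) s = 0" by (simp add: d' to_ac_poly_hom.hom_mult del: mult_pCons_left)
    have sA: "s \<in> RA" using s0 dA unfolding RA_def dvd_def by (auto simp: to_ac_poly_hom.hom_mult)
    have "poly (?E G) s = 0" using s0 dG unfolding dvd_def by (auto simp: to_ac_poly_hom.hom_mult)
    then have "to_ac \<theta> - of_nat c * s \<in> RB"
      by (simp add: RB_def G_def to_ac_hom.map_poly_pcompose poly_pcompose mult.commute to_ac_hom.map_poly_pCons_hom)
    then have "(to_ac \<theta> - of_nat c * s - to_ac x) / (to_ac y - s) \<in> bad" unfolding bad_def using sA by auto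
    moreover have "to_ac \<theta> - of_nat c * s - to_ac x = of_nat c * (to_ac y - s)" by (simp add: \<theta>_def algebra_simps)
    ultimately have "s = to_ac y" using c by (cases "to_ac y - s = 0") auto
    then have "poly d' y = 0" using s by simp
    then have "[:- y, 1:] dvd d'" by (simp add: poly_eq_0_iff_dvd)
    then have "[:- y, 1:] * [:- y, 1:] dvd A'" using dA unfolding d' by (meson dvd_trans mult_dvd_mono dvd_refl)
    then obtain e where "A' = [:- y, 1:] * ([:- y, 1:] * e)" by (elim dvdE) (simp only: mult.assoc)
    then have "poly (pderiv A') y = 0" by (simp add: pderiv_mult del: mult_pCons_left)
    then have "evq (pderiv A) y = 0" by (simp add: A'_def evq_def of_rat_hom.map_poly_pderiv)
    then have "A dvd pderiv A" using is_minpolyD(9)[OF A] by blast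
    moreover have "pderiv A \<noteq> 0" "degree (pderiv A) < degree A"
      using is_minpolyD(4)[OF A] by (auto simp: pderiv_eq_0_iff degree_pderiv)
    ultimately show False using dvd_imp_degree_le by fastforce
  qed
  have "lead_coeff d' = 1" using d(2) unfolding d' lead_coeff_mult by simp
  then have "d' = 1" using deg by (metis degree_0_id one_pCons)
  then have "- y \<in> S" using d(1) unfolding d' polys_in_def by (auto dest: spec[of _ 0])
  then have yS: "y \<in> S" using is_subringD(5)[OF Sr] by fastforce
  have "x = \<theta> - of_nat c * y" by (simp add: \<theta>_def)
  then have "x \<in> S" using \<theta>S yS subfieldD(4)[OF Sf, of "int c"] by (auto intro!: is_subringD[OF Sr])
  then show ?thesis using yS unfolding S_def \<theta>_def by blast
qed

text \<open>Each new power of \<open>\<theta>\<close> below \<open>degree P\<close> adds one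
  \<open>line_extension\<close>, since a linear relation would be a multiple of \<open>P\<close> of
  too small degree; division by \<open>P\<close> shows that these powers span.\<close>

lemma has_degree_evq:
  assumes P: "is_minpoly P (\<theta> :: 'a::field_char_0)"
  shows "has_degree (range (\<lambda>p. evq p \<theta>)) \<rat> (degree P)"
proof -
  have amb: "ring (ambient :: 'a ring)" by (rule ring_from_type_algebra)
  define E where "E n = {\<Sum>i<n. of_rat (c i) * \<theta> ^ i |c. True}" for n :: nat
  have E_ev: "u \<in> E n \<Longrightarrow> \<exists>p. (\<forall>i\<ge>n. coeff p i = 0) \<and> u = evq p \<theta>" for u n
  proof -
    assume "u \<in> E n"
    then obtain c where c: "u = (\<Sum>i<n. of_rat (c i) * \<theta> ^ i)" by (auto simp: E_def)
    have "evq (monom a i) \<theta> = of_rat a * \<theta> ^ i" for a i by (simp add: evq_def poly_monom)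
    then have "u = evq (\<Sum>i<n. monom (c i) i) \<theta>" by (simp add: c)
    then show ?thesis by (intro exI[of _ "\<Sum>i<n. monom (c i) i"]) (auto simp: coeff_sum)
  qed
  have "ring.dimension ambient n \<rat> (E n)" if "n \<le> degree P" for n
    using that
  proof (induction n)
    case 0
    have "E 0 = {\<zero>\<^bsub>ambient\<^esub>}" by (simp add: E_def)
    then show ?case using ring.zero_dim[OF amb] by simp
  next
    case (Suc n)
    have "\<theta> ^ n \<notin> E n"
    proof
      assume "\<theta> ^ n \<in> E n"
      then obtain p where p: "\<forall>i\<ge>n. coeff p i = 0" "\<theta> ^ n = evq p \<theta>" using E_ev by blast
      have "evq (monom 1 n) \<theta> = \<theta> ^ n" by (simp add: evq_def poly_monom)
      then have "evq (monom 1 n - p) \<theta> = 0" using p(2) by simp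
      then have "P dvd monom 1 n - p" using is_minpolyD(9)[OF P] by blast
      moreover have "coeff (monom 1 n - p) n = 1" using p(1) by simp
      then have "monom 1 n - p \<noteq> 0" by (metis coeff_0 zero_neq_one)
      moreover have "degree (monom 1 n - p) \<le> n" using p(1) by (intro degree_le) auto
      ultimately have "degree P \<le> n" using dvd_imp_degree_le order_trans by blast
      then show False using Suc.prems by simp
    qed
    moreover have "ring.line_extension ambient \<rat> (\<theta> ^ n) (E n) = E (Suc n)"
    proof (intro equalityI subsetI)
      fix u assume "u \<in> ring.line_extension ambient \<rat> (\<theta> ^ n) (E n)"
      then obtain k v where "k \<in> \<rat>" "v \<in> E n" "u = k * \<theta> ^ n + v" unfolding ring.line_extension_mem_iff[OF amb] by auto
      then obtain q c where "k = of_rat q" "v = (\<Sum>i<n. of_rat (c i) * \<theta> ^ i)" "u = k * \<theta> ^ n + v"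
        by (auto simp: E_def elim!: Rats_cases)
      then have "u = (\<Sum>i<Suc n. of_rat ((c(n := q)) i) * \<theta> ^ i)" by simp
      then show "u \<in> E (Suc n)" unfolding E_def by blast
    next
      fix u assume "u \<in> E (Suc n)"
      then obtain c where "u = (\<Sum>i<Suc n. of_rat (c i) * \<theta> ^ i)" unfolding E_def by blast
      then have "u = of_rat (c n) * \<theta> ^ n + (\<Sum>i<n. of_rat (c i) * \<theta> ^ i)" by simp
      then show "u \<in> ring.line_extension ambient \<rat> (\<theta> ^ n) (E n)" unfolding ring.line_extension_mem_iff[OF amb]
        by (auto simp: E_def intro!: bexI[of _ "of_rat (c n)"] exI[of _ c])
    qed
    ultimately show ?case using ring.Suc_dim[OF amb, of "\<theta> ^ n" "E n" n \<rat>] Suc by simp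
  qed
  moreover have "range (\<lambda>p. evq p \<theta>) = E (degree P)"
  proof (intro equalityI subsetI)
    fix u assume "u \<in> range (\<lambda>p. evq p \<theta>)"
    then obtain p where u: "u = evq p \<theta>" by blast
    have "u = evq (p mod P) \<theta>"
    proof -
      have "P * (p div P) + p mod P = p" by (rule mult_div_mod_eq)
      from arg_cong[OF this, of "\<lambda>f. evq f \<theta>"]
      have "evq P \<theta> * evq (p div P) \<theta> + evq (p mod P) \<theta> = evq p \<theta>" by (simp only: evq_simps)
      then show ?thesis using is_minpolyD(3)[OF P] by (simp add: u)
    qed
    moreover have "degree (p mod P) < degree P" using is_minpolyD(4)[OF P] degree_mod_less'[of P p] by (cases "p mod P = 0"; cases "P = 0") auto
    ultimately show "u \<in> E (degree P)" using evq_altdef[of "p mod P" "degree P" \<theta>] by (auto simp: E_def)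
  next
    fix u assume "u \<in> E (degree P)"
    then show "u \<in> range (\<lambda>p. evq p \<theta>)" using E_ev by blast
  qed
  moreover have "\<rat> \<subseteq> range (\<lambda>p. evq p \<theta>)"
  proof
    fix a :: 'a assume "a \<in> \<rat>"
    then obtain q where "a = evq [:q:] \<theta>" by (auto elim: Rats_cases)
    then show "a \<in> range (\<lambda>p. evq p \<theta>)" by blast
  qed
  ultimately show ?thesis unfolding has_degree_def
    using subfield_Rats subfield_range_evq[OF P] by simp
qed

section \<open>The ring of solutions\<close>

lemma is_subring_evz:
  fixes x :: "'a::field_char_0"
  assumes S: "is_subring S" and x: "x \<in> S"
  shows "evz p x \<in> S"
proof -
  have n: "of_nat n \<in> S" for n by (induction n) (auto intro: is_subringD[OF S])
  have "of_int k \<in> S" for k by (cases k) (auto intro!: is_subringD[OF S] n simp del: of_nat_Suc)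
  then show ?thesis by (induction p) (auto simp: evz_pCons intro!: is_subringD[OF S] x)
qed

lemma is_subring_integers_of:
  assumes "subfield K ambient"
  shows "is_subring (integers_of K)"
  using is_subringD[OF subfieldD(1)[OF assms]] algebraic_int_ring
  by (auto simp: is_subring_def integers_of_def)

lemma integer_unitsD:
  assumes "u \<in> integer_units K"
  shows "u \<in> integers_of K" "inverse u \<in> integers_of K" "u \<noteq> 0" "u \<in> K" "algebraic_int u"
    "inverse u \<in> integer_units K"
proof -
  obtain v where v: "u \<in> integers_of K" "v \<in> integers_of K" "u * v = 1"
    using assms by (auto simp: integer_units_def)
  then have "v = inverse u" by (metis inverse_unique)
  then show "u \<in> integers_of K" "inverse u \<in> integers_of K" "u \<noteq> 0" "u \<in> K" "algebraic_int u"
    using v by (auto simp: integers_of_def)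
  show "inverse u \<in> integer_units K"
    unfolding integer_units_def using v \<open>v = inverse u\<close> by (auto intro!: bexI[of _ u] simp: mult.commute)
qed

lemma integer_units_mult:
  assumes K: "subfield K ambient" and u: "u \<in> integer_units K" and v: "v \<in> integer_units K"
  shows "u * v \<in> integer_units K"
  unfolding integer_units_def
proof (intro CollectI conjI bexI)
  show "u * v \<in> integers_of K" "inverse u * inverse v \<in> integers_of K"
    using integer_unitsD[OF u] integer_unitsD[OF v] is_subringD(4)[OF is_subring_integers_of[OF K]] by auto
  show "u * v * (inverse u * inverse v) = 1"
    using integer_unitsD(3)[OF u] integer_unitsD(3)[OF v] by (simp add: field_simps)
qed

lemma one_integer_unit: "subfield K ambient \<Longrightarrow> 1 \<in> integer_units K"
  unfolding integer_units_def using is_subringD(2)[OF is_subring_integers_of] by auto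

lemma unit_set_iff:
  fixes K :: "'a::field_char_0 set"
  shows
  "x \<in> unit_set K \<longleftrightarrow> x \<in> integers_of K \<and>
    (\<forall>\<epsilon>\<in>integer_units K. \<exists>\<delta>\<in>integer_units K. \<exists>y\<in>integers_of K. \<delta> = 1 + (\<epsilon> - 1) * x + (\<epsilon> - 1)\<^sup>2 * y)"
proof -
  have "\<delta> - 1 - u = v \<longleftrightarrow> \<delta> = 1 + u + v" for \<delta> u v :: 'a by (auto simp: algebra_simps)
  then show ?thesis unfolding unit_set_def by simp
qed

lemma unit_setE:
  assumes "x \<in> unit_set K" "\<epsilon> \<in> integer_units K"
  obtains \<delta> y where "\<delta> \<in> integer_units K" "y \<in> integers_of K" "\<delta> = 1 + (\<epsilon> - 1) * x + (\<epsilon> - 1)\<^sup>2 * y"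
  using assms unfolding unit_set_iff by blast

lemma unit_setI:
  assumes "x \<in> integers_of K"
    and "\<And>\<epsilon>. \<epsilon> \<in> integer_units K \<Longrightarrow> \<exists>\<delta>\<in>integer_units K. \<exists>y\<in>integers_of K. \<delta> = 1 + (\<epsilon> - 1) * x + (\<epsilon> - 1)\<^sup>2 * y"
  shows "x \<in> unit_set K"
  unfolding unit_set_iff using assms by blast

text \<open>Witnesses: \<delta> = 1 for 0, \<delta> = \<epsilon> for 1 and the inverse of \<epsilon>
  for -1; the product of the two units for a sum. For \<open>x * x'\<close>, the condition on
  \<open>x'\<close> is applied to the unit that \<open>x\<close> supplies.\<close>

lemma is_subring_unit_set:
  assumes K: "subfield K ambient"
  shows "is_subring (unit_set K)"
proof -
  note O = is_subring_integers_of[OF K]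
  have int: "x \<in> integers_of K" if "x \<in> unit_set K" for x using that by (auto simp: unit_set_def)
  have zero: "0 \<in> unit_set K"
    by (intro unit_setI bexI[of _ 1] bexI[of _ 0] is_subringD[OF O] one_integer_unit[OF K]) auto
  have one: "1 \<in> unit_set K"
  proof (intro unit_setI is_subringD(2)[OF O])
    fix \<epsilon> assume "\<epsilon> \<in> integer_units K"
    then show "\<exists>\<delta>\<in>integer_units K. \<exists>y\<in>integers_of K. \<delta> = 1 + (\<epsilon> - 1) * 1 + (\<epsilon> - 1)\<^sup>2 * y"
      by (intro bexI[of _ \<epsilon>] bexI[of _ 0] is_subringD[OF O]) auto
  qed
  have minus_one: "- 1 \<in> unit_set K"
  proof (intro unit_setI is_subringD(5,2)[OF O])
    fix \<epsilon> assume \<epsilon>: "\<epsilon> \<in> integer_units K"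
    have "inverse \<epsilon> = 1 + (\<epsilon> - 1) * - 1 + (\<epsilon> - 1)\<^sup>2 * inverse \<epsilon>"
      using integer_unitsD(3)[OF \<epsilon>] by (simp add: field_simps power2_eq_square)
    then show "\<exists>\<delta>\<in>integer_units K. \<exists>y\<in>integers_of K. \<delta> = 1 + (\<epsilon> - 1) * - 1 + (\<epsilon> - 1)\<^sup>2 * y"
      using integer_unitsD[OF \<epsilon>] by blast
  qed
  have add: "x + x' \<in> unit_set K" if x: "x \<in> unit_set K" and x': "x' \<in> unit_set K" for x x'
  proof (rule unit_setI)
    show "x + x' \<in> integers_of K" by (intro is_subringD(3)[OF O] int x x')
    fix \<epsilon> assume \<epsilon>: "\<epsilon> \<in> integer_units K"
    obtain \<delta> y where d: "\<delta> \<in> integer_units K" "y \<in> integers_of K" "\<delta> = 1 + (\<epsilon> - 1) * x + (\<epsilon> - 1)\<^sup>2 * y"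
      using unit_setE[OF x \<epsilon>] .
    obtain \<delta>' y' where d': "\<delta>' \<in> integer_units K" "y' \<in> integers_of K" "\<delta>' = 1 + (\<epsilon> - 1) * x' + (\<epsilon> - 1)\<^sup>2 * y'"
      using unit_setE[OF x' \<epsilon>] .
    show "\<exists>\<delta>\<in>integer_units K. \<exists>y\<in>integers_of K. \<delta> = 1 + (\<epsilon> - 1) * (x + x') + (\<epsilon> - 1)\<^sup>2 * y"
    proof (intro bexI)
      show "\<delta> * \<delta>' \<in> integer_units K" by (rule integer_units_mult[OF K d(1) d'(1)])
      show "y + y' + (x + (\<epsilon> - 1) * y) * (x' + (\<epsilon> - 1) * y') \<in> integers_of K"
        by (intro is_subringD[OF O] int x x' d d' integer_unitsD(1)[OF \<epsilon>])
      show "\<delta> * \<delta>' = 1 + (\<epsilon> - 1) * (x + x') + (\<epsilon> - 1)\<^sup>2 * (y + y' + (x + (\<epsilon> - 1) * y) * (x' + (\<epsilon> - 1) * y'))"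
        unfolding d d' by (simp add: algebra_simps power2_eq_square)
    qed
  qed
  have mult: "x * x' \<in> unit_set K" if x: "x \<in> unit_set K" and x': "x' \<in> unit_set K" for x x'
  proof (rule unit_setI)
    show "x * x' \<in> integers_of K" by (intro is_subringD(4)[OF O] int x x')
    fix \<epsilon> assume \<epsilon>: "\<epsilon> \<in> integer_units K"
    obtain \<delta> y where d: "\<delta> \<in> integer_units K" "y \<in> integers_of K" "\<delta> = 1 + (\<epsilon> - 1) * x + (\<epsilon> - 1)\<^sup>2 * y"
      using unit_setE[OF x \<epsilon>] .
    obtain \<delta>' y' where d': "\<delta>' \<in> integer_units K" "y' \<in> integers_of K" "\<delta>' = 1 + (\<delta> - 1) * x' + (\<delta> - 1)\<^sup>2 * y'"
      using unit_setE[OF x' d(1)] .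
    show "\<exists>\<delta>\<in>integer_units K. \<exists>y\<in>integers_of K. \<delta> = 1 + (\<epsilon> - 1) * (x * x') + (\<epsilon> - 1)\<^sup>2 * y"
    proof (intro bexI)
      show "\<delta>' \<in> integer_units K" by (rule d'(1))
      show "y * x' + (x + (\<epsilon> - 1) * y) * (x + (\<epsilon> - 1) * y) * y' \<in> integers_of K"
        by (intro is_subringD[OF O] int x x' d d' integer_unitsD(1)[OF \<epsilon>])
      show "\<delta>' = 1 + (\<epsilon> - 1) * (x * x') + (\<epsilon> - 1)\<^sup>2 * (y * x' + (x + (\<epsilon> - 1) * y) * (x + (\<epsilon> - 1) * y) * y')"
        unfolding d'(3) d(3) by (simp add: algebra_simps power2_eq_square)
    qed
  qed
  show ?thesis
    unfolding is_subring_def using zero one add mult mult[OF minus_one] by auto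
qed

section \<open>Bounding the degree of a solution\<close>

lemma algebraic_int_Ints_of_degree_1:
  assumes M: "is_minpoly M x" and d: "degree M = 1" and x: "algebraic_int x"
  shows "x \<in> \<int>"
proof -
  have "evq M x = of_rat (coeff M 0) + x" using is_minpolyD(1)[OF M] d evq_altdef[of M 2 x]
    by (simp add: numeral_2_eq_2)
  then have "x = of_rat (- coeff M 0)" using is_minpolyD(3)[OF M] by (simp add: eq_neg_iff_add_eq_0 add.commute of_rat_minus)
  then have "x \<in> \<rat>" by simp
  then show ?thesis using rational_algebraic_int_is_int[OF x] by blast
qed

text \<open>Not being big supplies \<open>n0\<close> that divides no degree of a number field inside
  \<open>K\<close>; the argument makes \<open>n0\<close> divide the degree of
  \<open>\<rat>(x, \<delta>)\<close>. The condition \<open>re\<close> provides the unit in degree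
  2.\<close>

lemma unit_set_degree_less_2:
  fixes K :: "'a::field_char_0 set"
  assumes K: "subfield K ambient" and nb: "\<not> big_field K" and x: "x \<in> unit_set K"
    and M: "is_minpoly M x" and re: "degree M = 2 \<Longrightarrow> \<exists>r\<in>croots M. r \<in> \<real>"
  shows "degree M < 2"
proof (rule ccontr)
  assume "\<not> degree M < 2"
  then have deg2: "degree M \<ge> 2" by simp
  have xO: "x \<in> integers_of K" using x by (auto simp: unit_set_def)
  then have xK: "x \<in> K" and xi: "algebraic_int x" by (auto simp: integers_of_def)
  note O = is_subring_integers_of[OF K]
  obtain n0 :: nat where n0: "n0 > 0" "\<And>F d. F \<subseteq> K \<Longrightarrow> has_degree F \<rat> d \<Longrightarrow> \<not> n0 dvd d"
    using nb unfolding big_field_def by blast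
  obtain D :: int where D: "D > 0" "\<And>b. content b = 1 \<Longrightarrow> degree b < degree M \<Longrightarrow>
    \<exists>c t. (\<Sum>s\<in>croots M. evz (b * c) s :: complex) = of_int t \<and> t dvd D"
    using trace_form_primitive[OF M xi] by blast
  \<comment> \<open>The factor 3 serves \<open>a \<ge> 3\<close>, the factor \<open>D\<close> allows
    \<open>t\<close> to be cancelled at the end, and \<open>n0\<close> is the divisor that
    remains.\<close>
  define A where "A = 3 * int n0 * D"
  have A0: "A > 0" using n0(1) D(1) by (simp add: A_def)
  obtain u v w where u: "evz u x * evz v x = 1" "evz u x = 1 + of_int A * evz w x" "evz u x \<noteq> 1"
    using exists_unit_cong_one'[OF M xi A0 deg2 re] by blast
  define \<epsilon> where "\<epsilon> = evz u x"
  have \<epsilon>: "\<epsilon> \<in> integer_units K"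
    unfolding integer_units_def \<epsilon>_def using u(1) is_subring_evz[OF O xO] by blast
  obtain m where m: "M = map_poly of_int m" "lead_coeff m = 1" "degree m = degree M"
    using is_minpoly_int[OF M xi] by blast
  \<comment> \<open>Reduction modulo \<open>m\<close> brings the degree below that of
    \<open>M\<close>, as the choice of \<open>D\<close> requires.\<close>
  obtain q R where qR: "w = m * q + R" "degree R < degree m"
    using monic_int_division[OF m(2)] is_minpolyD(4)[OF M] m(3) by metis
  have "evz m x = 0" using is_minpolyD(3)[OF M] by (simp add: m(1) evq_of_int_poly)
  then have wR: "evz w x = evz R x" by (simp add: qR(1))
  then have "R \<noteq> 0" using u(2,3) by auto
  define b where "b = primitive_part R"
  define c where "c = content R"
  have "\<bar>content R\<bar> = content R" using normalize_content[of R] by (simp only: normalize_int_def)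
  moreover have "content R \<noteq> 0" using \<open>R \<noteq> 0\<close> by simp
  ultimately have c0: "c > 0" unfolding c_def by linarith
  have Rb: "R = smult c b" by (simp add: c_def b_def)
  have b: "content b = 1" "degree b < degree M"
    using \<open>R \<noteq> 0\<close> qR(2) m(3) by (auto simp: b_def)
  define a where "a = A * c"
  have a3: "a \<ge> 3"
  proof -
    have "1 * 1 * 1 \<le> int n0 * D * c" using n0(1) D(1) c0 by (intro mult_mono) auto
    then show ?thesis by (simp add: a_def A_def)
  qed
  have \<epsilon>1: "\<epsilon> - 1 = of_int a * evz b x" unfolding \<epsilon>_def u(2) wR Rb by (simp add: a_def)
  obtain f t where t: "(\<Sum>s\<in>croots M. evz (b * f) s :: complex) = of_int t" "t dvd D"
    using D(2)[OF b] by (elim exE conjE)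
  have "evz f x \<in> unit_set K" by (rule is_subring_evz[OF is_subring_unit_set[OF K] x])
  then obtain \<delta> y where \<delta>: "\<delta> \<in> integer_units K" "y \<in> integers_of K"
    "\<delta> = 1 + (\<epsilon> - 1) * evz f x + (\<epsilon> - 1)\<^sup>2 * y" using unit_setE[OF _ \<epsilon>] by blast
  define Y where "Y = (evz b x)\<^sup>2 * y"
  have Y: "Y \<in> integers_of K" unfolding Y_def
    by (intro is_subringD(4)[OF O] is_subring_power[OF O] is_subring_evz[OF O xO] \<delta>(2))
  have \<delta>_eq: "\<delta> = 1 + of_int a * evz (b * f) x + of_int a ^ 2 * Y"
    unfolding \<delta>(3) \<epsilon>1 Y_def by (simp add: power_mult_distrib mult.assoc)
  note d = integer_unitsD[OF \<delta>(1)]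
  obtain c' :: nat and gx gy where g: "x = evq gx (x + of_nat c' * \<delta>)" "\<delta> = evq gy (x + of_nat c' * \<delta>)"
    using primitive_element_int[OF xi d(5)] by blast
  define \<theta> where "\<theta> = x + of_nat c' * \<delta>"
  have \<theta>K: "\<theta> \<in> K" unfolding \<theta>_def using subfieldD(4)[OF K, of "int c'"] xK d(4)
    by (auto intro!: is_subringD[OF subfieldD(1)[OF K]])
  have "algebraic_int \<theta>" unfolding \<theta>_def using xi d(5) by (auto intro!: algebraic_int_ring)
  then obtain P where P: "is_minpoly P \<theta>" using exists_minpoly[of \<theta>] unfolding is_minpoly_def by auto
  have gx: "evq gx \<theta> = x" and gy: "evq gy \<theta> = \<delta>" using g by (auto simp: \<theta>_def)
  let ?F = "range (\<lambda>p. evq p \<theta>)"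
  have F: "subfield ?F ambient" by (rule subfield_range_evq[OF P])
  have xF: "x \<in> ?F" and dF: "\<delta> \<in> ?F" using gx gy by (metis rangeI)+
  \<comment> \<open>\<open>y\<close> is only known to lie in \<open>K\<close>; solving for
    \<open>Y\<close> places it in \<open>\<rat>(\<theta>)\<close>, where it has conjugates.\<close>
  have "Y = (\<delta> - 1 - of_int a * evz (b * f) x) / of_int a ^ 2" using a3 unfolding \<delta>_eq by simp
  also have "\<dots> \<in> ?F"
    by (intro subfieldD(3)[OF F] is_subringD[OF subfieldD(1)[OF F]] is_subring_power[OF subfieldD(1)[OF F]] subfieldD(4)[OF F] subfield_evz[OF F xF] dF)
  finally obtain l where l: "Y = evq l \<theta>" by blast
  have "a dvd int (degree P div degree M) * t"
  proof (rule norm_congruence[OF P])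
    show "is_minpoly M (evq gx \<theta>)" "algebraic_int (evq gx \<theta>)" using M xi by (auto simp: gx)
    show "algebraic_int (evq gy \<theta>)" "algebraic_int (inverse \<delta>)" "evq gy \<theta> * inverse \<delta> = 1"
      using d(2,3,5) by (auto simp: gy integers_of_def)
    show "algebraic_int (evq l \<theta>)" using Y by (simp add: l integers_of_def)
    show "evq gy \<theta> = 1 + of_int a * evz (b * f) (evq gx \<theta>) + of_int a ^ 2 * evq l \<theta>"
      unfolding gx gy l[symmetric] by (rule \<delta>_eq)
  qed (use a3 t in auto)
  moreover obtain s where s: "D = t * s" using t(2) by (auto simp: dvd_def)
  then have "t \<noteq> 0" using D(1) by auto
  moreover have "a = t * (int n0 * (3 * s * c))" by (simp add: a_def A_def s)
  ultimately have "int n0 * (3 * s * c) dvd int (degree P div degree M)" by (simp add: mult.commute[of _ t])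
  then have "int n0 dvd int (degree P div degree M)" using dvd_mult_left by blast
  then have "n0 dvd degree P div degree M" by simp
  moreover have "degree P = degree P div degree M * degree M"
    using croots_fibres[OF P, of M gx] M by (auto simp: gx)
  ultimately have "n0 dvd degree P" by (metis dvd_mult2)
  moreover have "?F \<subseteq> K" using subfield_evq[OF K \<theta>K] by auto
  ultimately show False using n0(2) has_degree_evq[OF P] by blast
qed

section \<open>Embeddings into the complex numbers\<close>

text \<open>An equation of degree \<open>n\<close> with leading coefficient \<open>d\<close>,
  multiplied by \<open>d ^ (n - 1)\<close>, becomes a monic equation of
  \<open>d * a\<close>.\<close>

lemma algebraic_scale_int:
  fixes a :: "'a::field_char_0"
  assumes "algebraic a"
  shows "\<exists>d::int. d \<noteq> 0 \<and> algebraic_int (of_int d * a)"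
proof -
  obtain p where p: "evz p a = 0" "p \<noteq> 0" using algebraicE'[OF assms] unfolding evz_def by metis
  define n where "n = degree p"
  define d where "d = lead_coeff p"
  have d0: "d \<noteq> 0" using p(2) by (simp add: d_def)
  have n0: "n > 0"
  proof (rule ccontr)
    assume "\<not> n > 0"
    then obtain c where "p = [:c:]" unfolding n_def by (metis degree_0_id gr0I)
    then show False using p by simp
  qed
  define q where "q = monom 1 n + (\<Sum>i<n. monom (coeff p i * d ^ (n - 1 - i)) i)"
  have evm: "evz (monom k i) x = of_int k * x ^ i" for k i and x :: 'a by (simp add: evz_def poly_monom)
  have cq: "coeff q i = (if i = n then 1 else if i < n then coeff p i * d ^ (n - 1 - i) else 0)" for i
    by (auto simp: q_def coeff_sum)
  have "degree q = n"
    by (intro antisym degree_le le_degree) (auto simp: cq)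
  then have lq: "lead_coeff q = 1" by (simp add: cq)
  have "0 = of_int d ^ (n - 1) * evz p a" using p(1) by simp
  also have "evz p a = (\<Sum>i<Suc n. of_int (coeff p i) * a ^ i)" by (rule evz_altdef) (simp add: n_def)
  also have "of_int d ^ (n - 1) * \<dots> = (\<Sum>i<n. of_int d ^ (n - 1) * (of_int (coeff p i) * a ^ i)) + of_int d ^ (n - 1) * (of_int d * a ^ n)"
    by (simp add: sum_distrib_left ring_distribs d_def n_def)
  also have "of_int d ^ (n - 1) * (of_int d * a ^ n) = (of_int d * a) ^ n"
    using n0 by (cases n) (simp_all add: power_mult_distrib algebra_simps)
  also have "(\<Sum>i<n. of_int d ^ (n - 1) * (of_int (coeff p i) * a ^ i)) = (\<Sum>i<n. of_int (coeff p i * d ^ (n - 1 - i)) * (of_int d * a) ^ i)"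
  proof (intro sum.cong refl)
    fix i assume "i \<in> {..<n}"
    then have "n - 1 = (n - 1 - i) + i" by auto
    then have "of_int d ^ (n - 1) = of_int d ^ (n - 1 - i) * (of_int d :: 'a) ^ i" by (metis power_add)
    then show "of_int d ^ (n - 1) * (of_int (coeff p i) * a ^ i) = of_int (coeff p i * d ^ (n - 1 - i)) * (of_int d * a) ^ i"
      by (simp add: power_mult_distrib)
  qed
  finally have "evz q (of_int d * a) = 0" by (simp add: q_def evm add.commute)
  then show ?thesis using lq d0 algebraic_int_iff_evz by blast
qed

lemma countable_algebraic_int: "countable {a :: 'a::field_char_0. algebraic_int a}"
proof (rule countable_subset)
  show "{a :: 'a. algebraic_int a} \<subseteq> (\<Union>xs :: int list. {a. Poly xs \<noteq> 0 \<and> evz (Poly xs) a = 0})"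
  proof
    fix a :: 'a assume "a \<in> {a. algebraic_int a}"
    then obtain p where "lead_coeff p = 1" "evz p a = 0" using algebraic_int_iff_evz by blast
    then have "Poly (coeffs p) \<noteq> 0 \<and> evz (Poly (coeffs p)) a = 0" by auto
    then show "a \<in> (\<Union>xs :: int list. {a. Poly xs \<noteq> 0 \<and> evz (Poly xs) a = 0})" by blast
  qed
  have "finite {a :: 'a. p \<noteq> 0 \<and> evz p a = 0}" for p
    using poly_roots_finite[of "map_poly of_int p :: 'a poly"] by (cases "p = 0") (auto simp: evz_def)
  then show "countable (\<Union>xs :: int list. {a :: 'a. Poly xs \<noteq> 0 \<and> evz (Poly xs) a = 0})"
    by (intro countable_UN) (auto intro: countable_finite)
qed

lemma embeddings_iff:
  "\<sigma> \<in> embeddings K \<longleftrightarrow> (\<forall>a\<in>K. \<forall>b\<in>K. \<sigma> (a * b) = \<sigma> a * \<sigma> b \<and> \<sigma> (a + b) = \<sigma> a + \<sigma> b) \<and> \<sigma> 1 = 1"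
  unfolding embeddings_def Ring.ring_hom_def by (auto simp: ring_of_type_algebra_def)

lemma embeddings_subset: "\<sigma> \<in> embeddings K \<Longrightarrow> L \<subseteq> K \<Longrightarrow> \<sigma> \<in> embeddings L"
  unfolding embeddings_iff by blast

lemma embeddingsD:
  assumes \<sigma>: "\<sigma> \<in> embeddings K" and K: "subfield K (ambient :: 'a::field_char_0 ring)"
  shows "\<sigma> 1 = 1" "\<sigma> 0 = 0" "a \<in> K \<Longrightarrow> b \<in> K \<Longrightarrow> \<sigma> (a + b) = \<sigma> a + \<sigma> b"
    "a \<in> K \<Longrightarrow> b \<in> K \<Longrightarrow> \<sigma> (a * b) = \<sigma> a * \<sigma> b" "a \<in> K \<Longrightarrow> b \<in> K \<Longrightarrow> \<sigma> (a - b) = \<sigma> a - \<sigma> b"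
    "\<sigma> (of_int k) = of_int k" "\<sigma> (of_rat q) = of_rat q" "a \<in> K \<Longrightarrow> \<sigma> (evq p a) = evq p (\<sigma> a)"
    "a \<in> K \<Longrightarrow> \<sigma> (evz f a) = evz f (\<sigma> a)" "a \<in> K \<Longrightarrow> b \<in> K \<Longrightarrow> \<sigma> a = \<sigma> b \<longleftrightarrow> a = b"
    "a \<in> K \<Longrightarrow> \<sigma> (a ^ n) = \<sigma> a ^ n"
proof -
  note Kr = is_subringD[OF subfieldD(1)[OF K]]
  show one: "\<sigma> 1 = 1" using \<sigma> by (simp add: embeddings_iff)
  show add: "a \<in> K \<Longrightarrow> b \<in> K \<Longrightarrow> \<sigma> (a + b) = \<sigma> a + \<sigma> b" for a b using \<sigma> by (simp add: embeddings_iff)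
  show mult: "a \<in> K \<Longrightarrow> b \<in> K \<Longrightarrow> \<sigma> (a * b) = \<sigma> a * \<sigma> b" for a b using \<sigma> by (simp add: embeddings_iff)
  show zero: "\<sigma> 0 = 0" using add[OF Kr(1) Kr(1)] by simp
  have minus: "\<sigma> (- a) = - \<sigma> a" if "a \<in> K" for a
    using add[OF that Kr(5)[OF that]] zero by (simp add: eq_neg_iff_add_eq_0 add.commute)
  show diff: "a \<in> K \<Longrightarrow> b \<in> K \<Longrightarrow> \<sigma> (a - b) = \<sigma> a - \<sigma> b" for a b
    using add[of a "- b"] minus[of b] Kr(5)[of b] by simp
  have nat: "\<sigma> (of_nat n) = of_nat n" for n
  proof (induction n)
    case (Suc n)
    then show ?case using add[OF Kr(2), of "of_nat n"] subfieldD(4)[OF K, of "int n"] one by simp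
  qed (simp add: zero)
  show int: "\<sigma> (of_int k) = of_int k" for k
    using nat[of "nat \<bar>k\<bar>"] minus[of "of_nat (nat \<bar>k\<bar>)"] subfieldD(4)[OF K, of "\<bar>k\<bar>"]
    by (cases "k \<ge> 0") (auto simp: of_nat_nat)
  show rat: "\<sigma> (of_rat q) = of_rat q" for q
  proof (cases q)
    case (Fract a b)
    have "of_rat q * of_int b = (of_int a :: 'a)" using Fract by (simp add: of_rat_rat)
    from arg_cong[OF this, of \<sigma>] have "\<sigma> (of_rat q) * of_int b = of_int a"
      by (simp add: mult subfieldD[OF K] int)
    then show ?thesis using Fract by (simp add: of_rat_rat field_simps)
  qed
  show "a \<in> K \<Longrightarrow> \<sigma> (evq p a) = evq p (\<sigma> a)" for a p
  proof (induction p)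
    case (pCons c p)
    then show ?case
      using subfieldD(5)[OF K, of c] subfield_evq[OF K pCons.prems, of p] pCons.prems
      by (simp add: evq_pCons add mult rat Kr(4))
  qed (simp add: zero)
  then show "a \<in> K \<Longrightarrow> \<sigma> (evz f a) = evz f (\<sigma> a)" unfolding evq_of_int_poly[symmetric] .
  show "\<sigma> a = \<sigma> b \<longleftrightarrow> a = b" if ab: "a \<in> K" "b \<in> K"
  proof
    assume eq: "\<sigma> a = \<sigma> b"
    show "a = b"
    proof (rule ccontr)
      assume "a \<noteq> b"
      then have "(a - b) * inverse (a - b) = 1" by simp
      moreover have "a - b \<in> K" "inverse (a - b) \<in> K" using ab Kr(6) subfieldD(2)[OF K] by auto
      ultimately have "\<sigma> (a - b) * \<sigma> (inverse (a - b)) = 1" using mult one by metis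
      then show False using diff[OF ab] eq by simp
    qed
  qed simp
  show "a \<in> K \<Longrightarrow> \<sigma> (a ^ n) = \<sigma> a ^ n"
    by (induction n) (auto simp: one mult is_subring_power[OF subfieldD(1)[OF K]])
qed

lemma embedding_croots:
  assumes \<sigma>: "\<sigma> \<in> embeddings K" and K: "subfield K ambient" and x: "x \<in> K" and M: "is_minpoly M x"
  shows "\<sigma> x \<in> croots M"
  using embeddingsD(8)[OF \<sigma> K x, of M] is_minpolyD(3)[OF M] embeddingsD(2)[OF \<sigma> K] by (simp add: croots_def)

text \<open>
  \<open>K\<close> is exhausted by a chain of simple extensions \<open>\<rat>(\<theta> n)\<close>; the conjugates of the \<open>\<theta> n\<close> are
  chosen compatibly along the chain.
\<close>

lemma embedding_extension:
  fixes K :: "'a::field_char_0 set"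
  assumes K: "field_of_algebraic_numbers K" and x: "x \<in> integers_of K" and M: "is_minpoly M x" and r: "r \<in> croots M"
  shows "\<exists>\<sigma>\<in>embeddings K. \<sigma> x = r"
proof -
  have Ks: "subfield K ambient" and Ka: "\<And>a. a \<in> K \<Longrightarrow> algebraic a"
    using K by (auto simp: field_of_algebraic_numbers_def)
  note O = is_subring_integers_of[OF Ks]
  have "countable (integers_of K)"
    by (rule countable_subset[OF _ countable_algebraic_int]) (auto simp: integers_of_def)
  then obtain e :: "nat \<Rightarrow> 'a" where e: "range e = integers_of K"
    using x uncountable_def by (metis empty_iff)
  define conj where "conj \<theta> \<rho> \<longleftrightarrow> (\<exists>P. is_minpoly P \<theta> \<and> is_minpoly P \<rho>)" for \<theta> :: 'a and \<rho> :: complex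
  define A where "A n = (\<lambda>(\<theta>,\<rho>). \<theta> \<in> integers_of K \<and> conj \<theta> \<rho> \<and> (n = 0 \<longrightarrow> \<theta> = x \<and> \<rho> = r))" for n :: nat
  \<comment> \<open>Compatibility: one and the same \<open>g\<close> expresses the old generator by
    the new one and the old conjugate by the new one. The new field also contains
    \<open>e n\<close>, so every integer is reached.\<close>
  define B where "B n p p' \<longleftrightarrow> (\<exists>g h. fst p = evq g (fst p') \<and> snd p = evq g (snd p') \<and> e n = evq h (fst p'))"
    for n and p p' :: "'a \<times> complex"
  have "\<exists>f. \<forall>n. A n (f n) \<and> B n (f n) (f (Suc n))"
  proof (rule dependent_nat_choice)
    have "conj x r" unfolding conj_def using M is_minpoly_croots[OF M r] by blast
    then show "\<exists>p. A 0 p" using x by (auto simp: A_def)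
    fix p n assume "A n p"
    then obtain \<theta> \<rho> where p: "p = (\<theta>, \<rho>)" "\<theta> \<in> integers_of K" "conj \<theta> \<rho>" by (cases p) (auto simp: A_def)
    have en: "e n \<in> integers_of K" using e by auto
    obtain c :: nat and g h where gh: "\<theta> = evq g (\<theta> + of_nat c * e n)" "e n = evq h (\<theta> + of_nat c * e n)"
      using primitive_element_int[of \<theta> "e n"] p(2) en by (auto simp: integers_of_def)
    define \<theta>' where "\<theta>' = \<theta> + of_nat c * e n"
    have "of_nat c \<in> integers_of K" using subfieldD(4)[OF Ks, of "int c"] by (simp add: integers_of_def)
    then have \<theta>': "\<theta>' \<in> integers_of K" unfolding \<theta>'_def by (intro is_subringD[OF O] p(2) en)
    then obtain P' where P': "is_minpoly P' \<theta>'"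
      using exists_minpoly[of \<theta>'] unfolding is_minpoly_def integers_of_def by blast
    obtain P where P: "is_minpoly P \<theta>" "is_minpoly P \<rho>" using p(3) by (auto simp: conj_def)
    have "is_minpoly P (evq g \<theta>')" using P(1) gh(1) by (simp add: \<theta>'_def)
    \<comment> \<open>The chosen conjugate \<open>\<rho>\<close> lifts to the new generator because
      its fibre is nonempty.\<close>
    from croots_fibres[OF P' this] obtain k where "k > 0" "card {\<rho>'\<in>croots P'. evq g \<rho>' = \<rho>} = k"
      using is_minpolyD(3)[OF P(2)] by (auto simp: croots_def)
    then obtain \<rho>' where \<rho>': "\<rho>' \<in> croots P'" "evq g \<rho>' = \<rho>"
      by (metis (mono_tags, lifting) card.empty empty_Collect_eq less_irrefl)
    have "conj \<theta>' \<rho>'" unfolding conj_def using P' is_minpoly_croots[OF P' \<rho>'(1)] by blast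
    then have "A (Suc n) (\<theta>', \<rho>')" using \<theta>' by (simp add: A_def)
    moreover have "B n p (\<theta>', \<rho>')" using gh \<rho>'(2) unfolding p(1) B_def by (auto simp: \<theta>'_def)
    ultimately show "\<exists>q. A (Suc n) q \<and> B n p q" by blast
  qed
  then obtain F where F: "\<And>n. A n (F n)" "\<And>n. B n (F n) (F (Suc n))" by blast
  define \<theta> where "\<theta> n = fst (F n)" for n
  define \<rho> where "\<rho> n = snd (F n)" for n
  have Fp: "F n = (\<theta> n, \<rho> n)" for n by (simp add: \<theta>_def \<rho>_def)
  have cj: "conj (\<theta> n) (\<rho> n)" for n using F(1)[of n] by (simp add: Fp A_def)
  have z: "\<theta> 0 = x" "\<rho> 0 = r" using F(1)[of 0] by (auto simp: Fp A_def)
  have step: "\<exists>g h. \<theta> n = evq g (\<theta> (Suc n)) \<and> \<rho> n = evq g (\<rho> (Suc n)) \<and> e n = evq h (\<theta> (Suc n))" for n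
    using F(2)[of n] by (simp add: Fp B_def)
  have up: "\<exists>g. \<theta> n = evq g (\<theta> m) \<and> \<rho> n = evq g (\<rho> m)" if "n \<le> m" for n m
    using that
  proof (induction m rule: dec_induct)
    case base
    then show ?case by (intro exI[of _ "[:0,1:]"]) simp
  next
    case (step m)
    then obtain g where g: "\<theta> n = evq g (\<theta> m)" "\<rho> n = evq g (\<rho> m)" by blast
    obtain g' where g': "\<theta> m = evq g' (\<theta> (Suc m))" "\<rho> m = evq g' (\<rho> (Suc m))"
      using \<open>\<And>n. \<exists>g h. \<theta> n = evq g (\<theta> (Suc n)) \<and> \<rho> n = evq g (\<rho> (Suc n)) \<and> e n = evq h (\<theta> (Suc n))\<close> by blast
    show ?case by (intro exI[of _ "pcompose g g'"]) (simp add: evq_pcompose g g'[symmetric])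
  qed
  have up': "\<exists>f'. evq f (\<theta> n) = evq f' (\<theta> m) \<and> evq f (\<rho> n) = evq f' (\<rho> m)" if nm: "n \<le> m" for n m f
  proof -
    obtain g where "\<theta> n = evq g (\<theta> m)" "\<rho> n = evq g (\<rho> m)" using up[OF nm] by blast
    then show ?thesis by (intro exI[of _ "pcompose f g"]) (simp add: evq_pcompose)
  qed
  have eq_iff: "evq f (\<theta> n) = evq g (\<theta> n) \<longleftrightarrow> evq f (\<rho> n) = evq g (\<rho> n)" for f g n
    using cj[of n] evq_eq_iff unfolding conj_def by blast
  \<comment> \<open>Representations at two stages are compared at the later one, so the embedding is
    well defined.\<close>
  have wd: "evq f (\<rho> n) = evq g (\<rho> m)" if eq: "evq f (\<theta> n) = evq g (\<theta> m)" for f g n m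
  proof -
    obtain f' where f': "evq f (\<theta> n) = evq f' (\<theta> (max n m))" "evq f (\<rho> n) = evq f' (\<rho> (max n m))"
      using up'[of n "max n m" f] by auto
    obtain g' where g': "evq g (\<theta> m) = evq g' (\<theta> (max n m))" "evq g (\<rho> m) = evq g' (\<rho> (max n m))"
      using up'[of m "max n m" g] by auto
    show ?thesis using eq eq_iff[of f' "max n m" g'] unfolding f' g' by simp
  qed
  \<comment> \<open>Only integers are enumerated; any other element is scaled to an integer and
    recovered by a rational factor.\<close>
  have rep: "\<exists>n f. a = evq f (\<theta> n)" if aK: "a \<in> K" for a
  proof -
    obtain d :: int where d: "d \<noteq> 0" "algebraic_int (of_int d * a)" using algebraic_scale_int[OF Ka[OF aK]] by blast
    then have "of_int d * a \<in> integers_of K"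
      using is_subringD(4)[OF subfieldD(1)[OF Ks] subfieldD(4)[OF Ks] aK] by (simp add: integers_of_def)
    then obtain n where "of_int d * a = e n" using e by auto
    then obtain h where "of_int d * a = evq h (\<theta> (Suc n))" using step[of n] by auto
    then have "evq (smult (inverse (of_int d)) h) (\<theta> (Suc n)) = inverse (of_int d) * (of_int d * a)"
      by (simp only: evq_simps of_rat_inverse of_rat_of_int_eq)
    then have "a = evq (smult (inverse (of_int d)) h) (\<theta> (Suc n))" using d(1) by simp
    then show ?thesis by blast
  qed
  then have "\<forall>a. \<exists>p. a \<in> K \<longrightarrow> a = evq (snd p) (\<theta> (fst p))" by fastforce
  then obtain R where R: "\<And>a. a \<in> K \<Longrightarrow> a = evq (snd (R a)) (\<theta> (fst (R a)))" by metis
  define \<sigma> where "\<sigma> a = evq (snd (R a)) (\<rho> (fst (R a)))" for a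
  have \<sigma>: "\<sigma> (evq f (\<theta> n)) = evq f (\<rho> n)" if "evq f (\<theta> n) \<in> K" for f n
    unfolding \<sigma>_def by (rule wd) (rule R[OF that, symmetric])
  have "\<sigma> \<in> embeddings K"
    unfolding embeddings_iff
  proof (intro conjI ballI)
    have "1 \<in> K" by (rule is_subringD(2)[OF subfieldD(1)[OF Ks]])
    then show "\<sigma> 1 = 1" using \<sigma>[of 1 0] by simp
    fix a b assume ab: "a \<in> K" "b \<in> K"
    obtain n f where f: "a = evq f (\<theta> n)" using rep[OF ab(1)] by blast
    obtain m g where g: "b = evq g (\<theta> m)" using rep[OF ab(2)] by blast
    obtain f' where f': "a = evq f' (\<theta> (max n m))" using up'[of n "max n m" f] f by auto
    obtain g' where g': "b = evq g' (\<theta> (max n m))" using up'[of m "max n m" g] g by auto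
    have "a * b \<in> K" "a + b \<in> K" using ab by (auto intro: is_subringD[OF subfieldD(1)[OF Ks]])
    then show "\<sigma> (a * b) = \<sigma> a * \<sigma> b" "\<sigma> (a + b) = \<sigma> a + \<sigma> b"
      using \<sigma>[of f' "max n m"] \<sigma>[of g' "max n m"] \<sigma>[of "f' * g'" "max n m"] \<sigma>[of "f' + g'" "max n m"] ab
      by (simp_all add: f' g')
  qed
  moreover have "\<sigma> x = r" using \<sigma>[of "[:0,1:]" 0] x z by (simp add: integers_of_def)
  ultimately show ?thesis by blast
qed

text \<open>Every conjugate is the value of an embedding, so the norm of \<open>x\<close> is an
  integer of absolute value below 1. Hence 0 is a conjugate of \<open>x\<close>, and
  \<open>x\<close> is 0.\<close>

lemma small_conjugates_imp_zero:
  assumes K: "field_of_algebraic_numbers K" and x: "x \<in> integers_of K"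
    and small: "\<And>\<sigma>. \<sigma> \<in> embeddings K \<Longrightarrow> norm (\<sigma> x) < 1"
  shows "x = 0"
proof -
  have xi: "algebraic_int x" using x by (simp add: integers_of_def)
  then obtain M where M: "is_minpoly M x" using exists_minpoly[of x] unfolding is_minpoly_def by auto
  have n: "norm r < 1" if "r \<in> croots M" for r using embedding_extension[OF K x M that] small by blast
  have i: "algebraic_int (evq [:0,1:] r)" if "r \<in> croots M" for r
    using algebraic_int_evq_transfer[OF M is_minpoly_croots[OF M that], of "[:0,1:]"] xi by simp
  have "(\<Prod>r\<in>croots M. evq [:0,1:] r) \<in> \<int>" by (rule sum_prod_in_Ints(2)[OF M i])
  then obtain k where k: "(\<Prod>r\<in>croots M. r) = of_int k" by (auto elim: Ints_cases)
  have "norm (\<Prod>r\<in>croots M. r) < 1"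
  proof -
    obtain r where r: "r \<in> croots M" using is_minpolyD(8)[OF M] by blast
    note fin = is_minpolyD(5)[OF M]
    have "norm (\<Prod>r\<in>croots M. r) = norm r * (\<Prod>r\<in>croots M - {r}. norm r)"
      unfolding prod_norm[symmetric] by (rule prod.remove[OF fin r])
    also have "\<dots> \<le> norm r * 1" using n by (intro mult_left_mono prod_le_1) (auto intro: less_imp_le)
    finally show ?thesis using n[OF r] by simp
  qed
  then have "\<bar>k\<bar> < 1" unfolding k by (simp add: norm_of_int)
  then have "(\<Prod>r\<in>croots M. r) = 0" using k by simp
  then have "0 \<in> croots M" using is_minpolyD(5)[OF M] by simp
  from evq_eq_iff[OF M is_minpoly_croots[OF M this], of "[:0,1:]" 0] show ?thesis by simp
qed

section \<open>CM-fields\<close>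

lemma field_of_algebraic_numbersD:
  assumes "field_of_algebraic_numbers K"
  shows "subfield K ambient" "a \<in> K \<Longrightarrow> algebraic a"
  using assms by (auto simp: field_of_algebraic_numbers_def)

text \<open>Dimension 2 unfolds to \<open>K = L v + L w\<close>, that is \<open>L + L \<eta>\<close>
  with \<open>\<eta> = w / v\<close>; completing the square in the equation of \<open>\<eta>\<close>
  gives \<open>\<omega>\<close>.\<close>

lemma quadratic_generator:
  fixes K L :: "'a::field_char_0 set"
  assumes "has_degree K L 2"
  obtains \<omega> where "\<omega> \<in> K" "\<omega>\<^sup>2 \<in> L" "\<And>k. k \<in> K \<Longrightarrow> \<exists>a\<in>L. \<exists>b\<in>L. k = a + b * \<omega>"
proof -
  have amb: "ring (ambient :: 'a ring)" by (rule ring_from_type_algebra)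
  have L: "subfield L ambient" and K: "subfield K ambient" and LK: "L \<subseteq> K"
    and dim: "ring.dimension ambient 2 L K" using assms by (auto simp: has_degree_def)
  note Lr = is_subringD[OF subfieldD(1)[OF L]] and Kr = is_subringD[OF subfieldD(1)[OF K]]
  obtain v E where v: "v \<notin> E" "ring.dimension ambient (Suc 0) L E" "K = ring.line_extension ambient L v E"
    using ring.dimension_backwards[OF amb L dim[unfolded numeral_2_eq_2]] by auto
  obtain w E' where w: "ring.dimension ambient 0 L E'" "E = ring.line_extension ambient L w E'"
    using ring.dimension_backwards[OF amb L v(2)] by auto
  have E': "E' = {0}" using ring.dimension_zero[OF amb L w(1)] by simp
  have memE: "u \<in> E \<longleftrightarrow> (\<exists>b\<in>L. u = b * w)" for u
    unfolding w(2) E' ring.line_extension_mem_iff[OF amb] by simp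
  have memK: "k \<in> K \<longleftrightarrow> (\<exists>a\<in>L. \<exists>b\<in>L. k = a * v + b * w)" for k
    unfolding v(3) ring.line_extension_mem_iff[OF amb] Bex_def[of E] memE by auto
  have v0: "v \<noteq> 0" using memE[of 0] Lr(1) v(1) by auto
  have vK: "v \<in> K" unfolding memK by (intro bexI[of _ 1] bexI[of _ 0] Lr) auto
  have wK: "w \<in> K" unfolding memK by (intro bexI[of _ 0] bexI[of _ 1] Lr) auto
  define \<eta> where "\<eta> = w / v"
  have \<eta>K: "\<eta> \<in> K" unfolding \<eta>_def by (rule subfieldD(3)[OF K wK vK])
  have gen: "\<exists>a\<in>L. \<exists>b\<in>L. k = a + b * \<eta>" if kK: "k \<in> K" for k
  proof -
    obtain a b where "a \<in> L" "b \<in> L" "k * v = a * v + b * w" using memK[of "k * v"] Kr(4)[OF kK vK] by blast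
    then show ?thesis using v0 by (intro bexI[of _ a] bexI[of _ b]) (auto simp: \<eta>_def field_simps)
  qed
  obtain p q where pq: "p \<in> L" "q \<in> L" "\<eta> * \<eta> = p + q * \<eta>" using gen[OF Kr(4)[OF \<eta>K \<eta>K]] by blast
  have q2: "q / 2 \<in> L" using subfieldD(3)[OF L pq(2), of 2] subfieldD(4)[OF L, of 2] by simp
  show ?thesis
  proof (rule that)
    show "\<eta> - q / 2 \<in> K" using \<eta>K q2 LK by (intro Kr(6)) auto
    have "(\<eta> - q / 2)\<^sup>2 = \<eta> * \<eta> - q * \<eta> + (q / 2)\<^sup>2" unfolding power2_diff by (simp add: power2_eq_square)
    also have "\<dots> = p + (q / 2)\<^sup>2" using pq(3) by simp
    also have "\<dots> \<in> L" by (intro Lr(3) pq(1) is_subring_power[OF subfieldD(1)[OF L]] q2)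
    finally show "(\<eta> - q / 2)\<^sup>2 \<in> L" .
    fix k assume "k \<in> K"
    then obtain a b where ab: "a \<in> L" "b \<in> L" "k = a + b * \<eta>" using gen by blast
    then have "k = (a + b * (q / 2)) + b * (\<eta> - q / 2)" by (simp add: algebra_simps)
    then show "\<exists>a\<in>L. \<exists>b\<in>L. k = a + b * (\<eta> - q / 2)" using ab Lr q2 by blast
  qed
qed

lemma cnj_eq_uminus:
  assumes "z\<^sup>2 \<in> \<real>" "z \<notin> \<real>"
  shows "cnj z = - z"
proof -
  have "Im z \<noteq> 0" using assms(2) by (simp add: complex_is_Real_iff)
  moreover have "Im (z\<^sup>2) = 0" using assms(1) by (simp add: complex_is_Real_iff)
  then have "Re z * Im z = 0" by (auto simp: power2_eq_square)
  ultimately show ?thesis by (simp add: complex_eq_iff)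
qed

text \<open>In each embedding \<open>\<omega>\<close> has a real square but is not real, as
  otherwise all of \<open>K\<close> would become real; so it is purely imaginary, and
  \<open>a - b * \<omega>\<close> is conjugate to \<open>a + b * \<omega>\<close>. The point is that
  one element serves all embeddings.\<close>

lemma CM_conjugation:
  fixes K L :: "'a::field_char_0 set"
  assumes tr: "totally_real L" and ti: "totally_imaginary K" and deg: "has_degree K L 2" and k: "k \<in> K"
  shows "\<exists>k'\<in>K. \<forall>\<sigma>\<in>embeddings K. \<sigma> k' = cnj (\<sigma> k)"
proof -
  obtain \<omega> where \<omega>: "\<omega> \<in> K" "\<omega>\<^sup>2 \<in> L" "\<And>k. k \<in> K \<Longrightarrow> \<exists>a\<in>L. \<exists>b\<in>L. k = a + b * \<omega>"
    by (rule quadratic_generator[OF deg]) blast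
  have K: "subfield K ambient" and LK: "L \<subseteq> K" using deg by (auto simp: has_degree_def)
  note Kr = is_subringD[OF subfieldD(1)[OF K]]
  have real: "\<sigma> a \<in> \<real>" if "\<sigma> \<in> embeddings K" "a \<in> L" for \<sigma> a
    using tr embeddings_subset[OF that(1) LK] that(2) unfolding totally_real_def by blast
  have im: "cnj (\<sigma> \<omega>) = - \<sigma> \<omega>" if \<sigma>: "\<sigma> \<in> embeddings K" for \<sigma>
  proof (rule cnj_eq_uminus)
    show "(\<sigma> \<omega>)\<^sup>2 \<in> \<real>" using real[OF \<sigma> \<omega>(2)] embeddingsD(11)[OF \<sigma> K \<omega>(1), of 2] by simp
    show "\<sigma> \<omega> \<notin> \<real>"
    proof
      assume r: "\<sigma> \<omega> \<in> \<real>"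
      have "\<sigma> k \<in> \<real>" if kK: "k \<in> K" for k
      proof -
        obtain a b where ab: "a \<in> L" "b \<in> L" "k = a + b * \<omega>" using \<omega>(3)[OF kK] by blast
        then have "\<sigma> k = \<sigma> a + \<sigma> b * \<sigma> \<omega>"
          using LK \<omega>(1) by (simp add: embeddingsD(3,4)[OF \<sigma> K] Kr(4) subset_iff)
        then show ?thesis using real[OF \<sigma>] ab r by simp
      qed
      then show False using ti \<sigma> unfolding totally_imaginary_def by blast
    qed
  qed
  obtain a b where ab: "a \<in> L" "b \<in> L" "k = a + b * \<omega>" using \<omega>(3)[OF k] by blast
  then have abK: "a \<in> K" "b \<in> K" using LK by auto
  show ?thesis
  proof (intro bexI ballI)
    show "a - b * \<omega> \<in> K" by (intro Kr(6,4) abK \<omega>(1))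
    fix \<sigma> assume \<sigma>: "\<sigma> \<in> embeddings K"
    have "\<sigma> (a - b * \<omega>) = \<sigma> a - \<sigma> b * \<sigma> \<omega>" "\<sigma> k = \<sigma> a + \<sigma> b * \<sigma> \<omega>"
      using abK \<omega>(1) by (simp_all add: ab(3) embeddingsD(3,4,5)[OF \<sigma> K] Kr(4))
    then show "\<sigma> (a - b * \<omega>) = cnj (\<sigma> k)"
      using im[OF \<sigma>] real[OF \<sigma> ab(1)] real[OF \<sigma> ab(2)] by (simp add: Reals_cnj_iff)
  qed
qed

text \<open>An irrational element of \<open>L\<close>, scaled to an integer, has only real
  conjugates because each comes from an embedding of \<open>K\<close>; so the box principle applies
  to it and the unit stays in \<open>L\<close>.\<close>

lemma totally_real_unit:
  fixes K L :: "'a::field_char_0 set"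
  assumes K: "field_of_algebraic_numbers K" and L: "subfield L ambient" "L \<subseteq> K" "L \<noteq> \<rat>" and tr: "totally_real L"
    and A: "(A::int) > 0"
  shows "\<exists>\<epsilon>\<in>integer_units K. \<exists>w\<in>integers_of K. \<epsilon> = 1 + of_int A * w \<and> w \<noteq> 0 \<and> \<epsilon> \<in> L"
proof -
  note Ks = field_of_algebraic_numbersD(1)[OF K] and Lr = is_subringD[OF subfieldD(1)[OF L(1)]]
  note O = is_subring_integers_of[OF Ks]
  obtain l where l: "l \<in> L" "l \<notin> \<rat>" using L(3) subfieldD(5)[OF L(1)] by (auto elim!: Rats_cases)
  obtain d :: int where d: "d \<noteq> 0" "algebraic_int (of_int d * l)"
    using algebraic_scale_int field_of_algebraic_numbersD(2)[OF K] L(2) l(1) by blast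
  define x where "x = of_int d * l"
  have xL: "x \<in> L" unfolding x_def by (intro Lr subfieldD(4)[OF L(1)] l)
  have xi: "algebraic_int x" and xO: "x \<in> integers_of K" using d(2) xL L(2) by (auto simp: x_def integers_of_def)
  obtain M where M: "is_minpoly M x" using exists_minpoly[of x] xi unfolding is_minpoly_def by auto
  have "x \<notin> \<rat>"
  proof
    assume "x \<in> \<rat>"
    then have "x / of_int d \<in> \<rat>" by simp
    then show False using l(2) d(1) by (simp add: x_def)
  qed
  then have "degree M \<noteq> 1" using algebraic_int_Ints_of_degree_1[OF M _ xi] Ints_subset_Rats by blast
  then have deg: "degree M \<ge> 2" using is_minpolyD(4)[OF M] by simp
  have real: "r \<in> \<real>" if r: "r \<in> croots M" for r
  proof -
    obtain \<sigma> where "\<sigma> \<in> embeddings K" "\<sigma> x = r" using embedding_extension[OF K xO M r] by blast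
    then show ?thesis using tr embeddings_subset L(2) xL unfolding totally_real_def by blast
  qed
  obtain u v w where u: "evz u x * evz v x = 1" "evz u x = 1 + of_int A * evz w x" "evz u x \<noteq> 1"
    using exists_unit_cong_one'[OF M xi A deg] real is_minpolyD(8)[OF M] by blast
  have "evz u x \<in> integer_units K" unfolding integer_units_def using u(1) is_subring_evz[OF O xO] by blast
  moreover have "evz w x \<noteq> 0" using u(2,3) by auto
  moreover have "evz u x \<in> L" by (rule is_subring_evz[OF subfieldD(1)[OF L(1)] xL])
  ultimately show ?thesis using u(2) is_subring_evz[OF O xO] by blast
qed

text \<open>
  For a real unit \<open>\<epsilon> = 1 + A w\<close> and \<open>\<delta> = 1 + (\<epsilon> - 1) x + \<dots>\<close>, the quotient of \<open>\<delta>\<close> by its complex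
  conjugate has absolute value 1 in every embedding and is congruent to 1 modulo \<open>A\<close>; hence it is
  1, so that \<open>\<epsilon> - 1\<close> divides \<open>x - x'\<close>, where \<open>x'\<close> is the complex conjugate of \<open>x\<close>.
\<close>

lemma unit_set_CM_real:
  fixes K :: "'a::field_char_0 set"
  assumes CM: "CM_field K" and nq: "\<not> imaginary_quadratic_field K" and x: "x \<in> unit_set K" and \<sigma>: "\<sigma> \<in> embeddings K"
  shows "\<sigma> x \<in> \<real>"
proof -
  obtain L where K: "field_of_algebraic_numbers K" and ti: "totally_imaginary K" and tr: "totally_real L"
    and deg: "has_degree K L 2" using CM by (auto simp: CM_field_def)
  note Ks = field_of_algebraic_numbersD(1)[OF K]
  note O = is_subring_integers_of[OF Ks] and emb = embeddingsD[OF _ Ks]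
  have L: "subfield L ambient" "L \<subseteq> K" using deg by (auto simp: has_degree_def)
  \<comment> \<open>Over \<open>L = \<rat>\<close> the field \<open>K\<close> would be imaginary
    quadratic, and \<open>L\<close> would have only the units 1 and -1.\<close>
  have LQ: "L \<noteq> \<rat>" using nq deg ti by (auto simp: imaginary_quadratic_field_def)
  have OK: "k \<in> K" if "k \<in> integers_of K" for k using that by (simp add: integers_of_def)
  obtain bar where bar: "\<And>k. k \<in> K \<Longrightarrow> bar k \<in> K" "\<And>k \<sigma>. k \<in> K \<Longrightarrow> \<sigma> \<in> embeddings K \<Longrightarrow> \<sigma> (bar k) = cnj (\<sigma> k)"
    using CM_conjugation[OF tr ti deg] by metis
  have barO: "bar k \<in> integers_of K" if k: "k \<in> integers_of K" for k
  proof -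
    obtain p where p: "lead_coeff p = 1" "evz p k = 0" using k algebraic_int_iff_evz by (auto simp: integers_of_def)
    have cnj_evz: "evz p (cnj z) = cnj (evz p z)" for z by (induction p) (auto simp: evz_pCons)
    have "\<sigma> (evz p (bar k)) = cnj (\<sigma> (evz p k))"
      using bar(1)[OF OK[OF k]] OK[OF k] by (simp add: emb(9)[OF \<sigma>] bar(2)[OF OK[OF k] \<sigma>] cnj_evz)
    then have "\<sigma> (evz p (bar k)) = \<sigma> 0" using p(2) emb(2)[OF \<sigma>] by simp
    then have "evz p (bar k) = 0"
      using emb(10)[OF \<sigma>] subfield_evz[OF Ks bar(1)[OF OK[OF k]]] is_subringD(1)[OF subfieldD(1)[OF Ks]] by blast
    then show ?thesis using p(1) bar(1)[OF OK[OF k]] algebraic_int_iff_evz by (auto simp: integers_of_def)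
  qed
  have xO: "x \<in> integers_of K" using x by (auto simp: unit_set_def)
  define \<kappa> where "\<kappa> = x - bar x"
  have \<kappa>O: "\<kappa> \<in> integers_of K" unfolding \<kappa>_def by (intro is_subringD[OF O] xO barO)
  obtain M where M: "is_minpoly M \<kappa>" using exists_minpoly[of \<kappa>] \<kappa>O unfolding is_minpoly_def integers_of_def by auto
  \<comment> \<open>Two demands: \<open>A\<close> must exceed the bound 2 for the quotient of
    \<delta> by its conjugate, minus 1, and it must exceed all conjugates of
    \<open>\<kappa>\<close>.\<close>
  define A where "A = max 3 (\<lfloor>Max (norm ` croots M)\<rfloor> + 1)"
  have A3: "A \<ge> 3" by (simp add: A_def)
  have A_gt: "norm (\<tau> \<kappa>) < real_of_int A" if \<tau>: "\<tau> \<in> embeddings K" for \<tau>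
  proof -
    have "norm (\<tau> \<kappa>) \<le> Max (norm ` croots M)"
      using embedding_croots[OF \<tau> Ks OK[OF \<kappa>O] M] is_minpolyD(5)[OF M] by (intro Max_ge) auto
    then show ?thesis unfolding A_def by linarith
  qed
  obtain \<epsilon> w where \<epsilon>: "\<epsilon> \<in> integer_units K" "w \<in> integers_of K" "\<epsilon> = 1 + of_int A * w" "w \<noteq> 0" "\<epsilon> \<in> L"
    using totally_real_unit[OF K L LQ tr, of A] A3 by auto
  have e1: "\<epsilon> - 1 = of_int A * w" by (simp add: \<epsilon>(3))
  have \<epsilon>K: "\<epsilon> \<in> K" "1 \<in> K" "of_int A \<in> K" "w \<in> K"
    using \<epsilon>(2,5) L(2) is_subringD(2)[OF subfieldD(1)[OF Ks]] subfieldD(4)[OF Ks] OK by auto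
  have "\<sigma> \<epsilon> \<in> \<real>" using tr embeddings_subset[OF \<sigma> L(2)] \<epsilon>(5) unfolding totally_real_def by blast
  then have \<epsilon>_real: "cnj (\<sigma> \<epsilon>) = \<sigma> \<epsilon>" by (simp add: Reals_cnj_iff)
  obtain \<delta> y where \<delta>: "\<delta> \<in> integer_units K" "y \<in> integers_of K" "\<delta> = 1 + (\<epsilon> - 1) * x + (\<epsilon> - 1)\<^sup>2 * y"
    using unit_setE[OF x \<epsilon>(1)] .
  note d = integer_unitsD[OF \<delta>(1)]
  note Kr = is_subringD[OF subfieldD(1)[OF Ks]]
  have eqI: "a = b" if "a \<in> K" "b \<in> K" "\<sigma> a = \<sigma> b" for a b using emb(10)[OF \<sigma>] that by blast
  \<comment> \<open>\<open>\<epsilon>\<close> lies in \<open>L\<close> and is fixed by conjugation,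
    so only \<open>x\<close> and \<open>y\<close> change; the identity is checked under the
    injective \<open>\<sigma>\<close>.\<close>
  have bar\<delta>: "bar \<delta> = 1 + (\<epsilon> - 1) * bar x + (\<epsilon> - 1)\<^sup>2 * bar y"
  proof (rule eqI)
    have yK: "y \<in> K" and xK: "x \<in> K" using OK \<delta>(2) xO by auto
    have in_K: "(\<epsilon> - 1) * u \<in> K" "(\<epsilon> - 1)\<^sup>2 * u \<in> K" "1 + (\<epsilon> - 1) * u \<in> K" "\<epsilon> - 1 \<in> K" "(\<epsilon> - 1)\<^sup>2 \<in> K" if "u \<in> K" for u
      using that \<epsilon>K by (auto intro!: Kr is_subring_power[OF subfieldD(1)[OF Ks]])
    show "bar \<delta> \<in> K" by (rule bar(1)[OF d(4)])
    show "1 + (\<epsilon> - 1) * bar x + (\<epsilon> - 1)\<^sup>2 * bar y \<in> K" by (intro Kr(3) in_K bar(1) xK yK)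
    have ev: "\<sigma> (1 + (\<epsilon> - 1) * u + (\<epsilon> - 1)\<^sup>2 * v) = 1 + (\<sigma> \<epsilon> - 1) * \<sigma> u + (\<sigma> \<epsilon> - 1)\<^sup>2 * \<sigma> v"
      if "u \<in> K" "v \<in> K" for u v
      using in_K[OF that(1)] in_K[OF that(2)] \<epsilon>K that
      by (simp add: emb(1,3,4,5,11)[OF \<sigma>])
    show "\<sigma> (bar \<delta>) = \<sigma> (1 + (\<epsilon> - 1) * bar x + (\<epsilon> - 1)\<^sup>2 * bar y)"
      unfolding bar(2)[OF d(4) \<sigma>] ev[OF bar(1)[OF xK] bar(1)[OF yK]] bar(2)[OF xK \<sigma>] bar(2)[OF yK \<sigma>]
      unfolding \<delta>(3) ev[OF xK yK] using \<epsilon>_real by simp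
  qed
  have dinvK: "inverse \<delta> \<in> K" by (rule OK[OF d(2)])
  define \<delta>' where "\<delta>' = bar (inverse \<delta>)"
  have \<delta>'O: "\<delta>' \<in> integers_of K" unfolding \<delta>'_def by (rule barO[OF d(2)])
  have \<tau>d: "\<tau> \<delta> * \<tau> (inverse \<delta>) = 1" if "\<tau> \<in> embeddings K" for \<tau>
    using emb(4)[OF that d(4) dinvK] emb(1)[OF that] d(3) by simp
  have bb: "bar \<delta> * \<delta>' = 1"
  proof (rule eqI)
    show "bar \<delta> * \<delta>' \<in> K" using bar(1)[OF d(4)] OK[OF \<delta>'O] by (rule Kr(4))
    show "\<sigma> (bar \<delta> * \<delta>') = \<sigma> 1"
      unfolding \<delta>'_def using \<tau>d[OF \<sigma>] emb(1)[OF \<sigma>]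
      by (simp add: emb(4)[OF \<sigma>] bar d(4) dinvK \<sigma> flip: complex_cnj_mult)
  qed (rule \<epsilon>K(2))
  \<comment> \<open>Chosen so that
    \<open>\<delta> - bar \<delta> = (\<epsilon> - 1) * \<mu>\<close>; then
    \<open>A * \<beta>\<close> is the quotient of \<open>\<delta>\<close> by
    \<open>bar \<delta>\<close>, minus 1.\<close>
  define \<mu> where "\<mu> = \<kappa> + (\<epsilon> - 1) * (y - bar y)"
  define \<beta> where "\<beta> = w * \<mu> * \<delta>'"
  have \<mu>O: "\<mu> \<in> integers_of K" unfolding \<mu>_def
    by (intro is_subringD[OF O] \<kappa>O barO \<delta>(2) integer_unitsD(1)[OF \<epsilon>(1)])
  have \<beta>O: "\<beta> \<in> integers_of K" unfolding \<beta>_def by (intro is_subringD(4)[OF O] \<mu>O \<epsilon>(2) \<delta>'O)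
  have \<beta>_eq: "\<delta> * \<delta>' = 1 + of_int A * \<beta>"
  proof -
    have "\<delta> * \<delta>' - 1 = (\<delta> - bar \<delta>) * \<delta>'" using bb by (simp add: algebra_simps)
    also have "\<delta> - bar \<delta> = (\<epsilon> - 1) * \<mu>" unfolding bar\<delta> unfolding \<delta>(3) \<mu>_def \<kappa>_def by (simp add: algebra_simps power2_eq_square)
    finally show ?thesis unfolding e1 \<beta>_def by (simp add: algebra_simps)
  qed
  have "\<beta> = 0"
  proof (rule small_conjugates_imp_zero[OF K \<beta>O])
    fix \<tau> assume \<tau>: "\<tau> \<in> embeddings K"
    have "\<tau> (\<delta> * \<delta>') = \<tau> \<delta> * cnj (\<tau> (inverse \<delta>))"
      using emb(4)[OF \<tau> d(4) OK[OF \<delta>'O]] bar(2)[OF dinvK \<tau>] by (simp add: \<delta>'_def)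
    then have 1: "norm (\<tau> (\<delta> * \<delta>')) = 1" using \<tau>d[OF \<tau>] by (simp add: norm_mult flip: norm_mult) (metis complex_mod_cnj norm_mult norm_one)
    have "\<tau> (\<delta> * \<delta>') = 1 + of_int A * \<tau> \<beta>"
      unfolding \<beta>_eq using \<epsilon>K(2,3) OK[OF \<beta>O] by (simp add: emb(1,3,4,6)[OF \<tau>] Kr(4))
    then have "norm (of_int A * \<tau> \<beta>) \<le> 2"
      using norm_triangle_ineq4[of "\<tau> (\<delta> * \<delta>')" 1] 1 by simp
    then have "real_of_int A * norm (\<tau> \<beta>) \<le> 2" using A3 by (simp add: norm_mult norm_of_int)
    moreover have "3 * norm (\<tau> \<beta>) \<le> real_of_int A * norm (\<tau> \<beta>)" using A3 by (intro mult_right_mono) auto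
    ultimately show "norm (\<tau> \<beta>) < 1" by linarith
  qed
  moreover have "\<delta>' \<noteq> 0" using bb by auto
  ultimately have "\<mu> = 0" using \<epsilon>(4) by (simp add: \<beta>_def)
  \<comment> \<open>\<open>\<mu> = 0\<close> makes \<open>\<kappa>\<close> a multiple of
    \<open>A\<close>, while it is smaller than \<open>A\<close> in every embedding.\<close>
  define \<nu> where "\<nu> = w * (bar y - y)"
  have \<nu>O: "\<nu> \<in> integers_of K" unfolding \<nu>_def by (intro is_subringD(4,6)[OF O] \<epsilon>(2) barO \<delta>(2))
  have \<kappa>\<nu>: "\<kappa> = of_int A * \<nu>" using \<open>\<mu> = 0\<close> unfolding \<mu>_def e1 \<nu>_def by (simp add: algebra_simps eq_neg_iff_add_eq_0)
  have "\<nu> = 0"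
  proof (rule small_conjugates_imp_zero[OF K \<nu>O])
    fix \<tau> assume \<tau>: "\<tau> \<in> embeddings K"
    have "\<tau> \<kappa> = of_int A * \<tau> \<nu>" unfolding \<kappa>\<nu> using emb(4)[OF \<tau> \<epsilon>K(3) OK[OF \<nu>O]] emb(6)[OF \<tau>] by simp
    then have "real_of_int A * norm (\<tau> \<nu>) < real_of_int A * 1"
      using A_gt[OF \<tau>] A3 by (simp add: norm_mult norm_of_int)
    then show "norm (\<tau> \<nu>) < 1" using A3 by (simp only: mult_less_cancel_left)
  qed
  then have "bar x = x" using \<kappa>\<nu> by (simp add: \<kappa>_def)
  then have "cnj (\<sigma> x) = \<sigma> x" using bar(2)[OF OK[OF xO] \<sigma>] by simp
  then show ?thesis by (simp add: Reals_cnj_iff)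
qed

lemma imaginary_quadratic_evq:
  assumes M: "is_minpoly M (x :: 'a::field_char_0)" and deg: "degree M = 2" and r: "\<And>r. r \<in> croots M \<Longrightarrow> r \<notin> \<real>"
  shows "imaginary_quadratic_field (range (\<lambda>p. evq p x))"
proof -
  let ?F = "range (\<lambda>p. evq p x)"
  have F: "subfield ?F ambient" by (rule subfield_range_evq[OF M])
  have x: "x \<in> ?F" by (rule range_eqI[of _ _ "[:0,1:]"]) simp
  have "totally_imaginary ?F"
    unfolding totally_imaginary_def
  proof
    fix \<sigma> assume "\<sigma> \<in> embeddings ?F"
    then have "\<sigma> x \<notin> \<real>" using embedding_croots[OF _ F x M] r by blast
    then show "\<not> \<sigma> ` ?F \<subseteq> \<real>" using x by blast
  qed
  then show ?thesis unfolding imaginary_quadratic_field_def using has_degree_evq[OF M] deg by simp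
qed

text \<open>Both alternatives of the last hypothesis serve one purpose: a real conjugate of
  \<open>x\<close> in case its degree is 2, as \<open>unit_set_degree_less_2\<close>
  demands.\<close>

theorem corollary3p12:
  fixes K :: "'a::field_char_0 set"
  assumes "field_of_algebraic_numbers K"
    and "\<not> big_field K"
    and "(\<nexists>F. F \<subseteq> K \<and> imaginary_quadratic_field F) \<or>
         (CM_field K \<and> \<not> imaginary_quadratic_field K)"
  shows "unit_set K = \<int>"
proof (intro equalityI subsetI)
  note K = field_of_algebraic_numbersD(1)[OF assms(1)]
  fix x assume x: "x \<in> unit_set K"
  then have xO: "x \<in> integers_of K" by (auto simp: unit_set_def)
  then have xK: "x \<in> K" and xi: "algebraic_int x" by (auto simp: integers_of_def)
  obtain M where M: "is_minpoly M x" using exists_minpoly[of x] xi unfolding is_minpoly_def by auto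
  have "\<exists>r\<in>croots M. r \<in> \<real>" if deg: "degree M = 2"
    using assms(3)
  proof
    assume nq: "\<nexists>F. F \<subseteq> K \<and> imaginary_quadratic_field F"
    have "range (\<lambda>p. evq p x) \<subseteq> K" using subfield_evq[OF K xK] by auto
    then show ?thesis using imaginary_quadratic_evq[OF M deg] nq by blast
  next
    assume CM: "CM_field K \<and> \<not> imaginary_quadratic_field K"
    obtain r where r: "r \<in> croots M" using is_minpolyD(8)[OF M] by blast
    obtain \<sigma> where "\<sigma> \<in> embeddings K" "\<sigma> x = r" using embedding_extension[OF assms(1) xO M r] by blast
    then show ?thesis using unit_set_CM_real[of K x \<sigma>] CM x r by blast
  qed
  then have "degree M < 2" using unit_set_degree_less_2[OF K assms(2) x M] by blast
  then have "degree M = 1" using is_minpolyD(4)[OF M] by simp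
  then show "x \<in> \<int>" using algebraic_int_Ints_of_degree_1[OF M _ xi] by blast
next
  fix x :: 'a assume "x \<in> \<int>"
  then obtain k where k: "x = of_int k" by (auto elim: Ints_cases)
  note S = is_subring_unit_set[OF field_of_algebraic_numbersD(1)[OF assms(1)]]
  \<comment> \<open>An integer is a constant polynomial evaluated at 1, so it lies in every
    subring.\<close>
  have "evz [:k:] 1 \<in> unit_set K" by (rule is_subring_evz[OF S is_subringD(2)[OF S]])
  then show "x \<in> unit_set K" by (simp add: k)
qed

end
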